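(* Let $F$ be a field of characteristic $0$, $V$ an $n$-dimensional $F$-vector space, $G\le\mathrm{GL}(V)$ a finite group generated by pseudo-reflections, $M$ an $r$-dimensional $F[G]$-module, and $\chi$ a one-dimensional character of $G$. Suppose $J_{M^*}$ divides $\Delta_\chi$. Then the $2^r$ elements \[ \{d_{i_1}^*\cdots d_{i_k}^*\Delta_\chi : 0\le k\le r,\ 1\le i_1<\cdots<i_k\le r\} \] form an $F$-basis of $(\mathcal{H}(V^* )\otimes\wedge M^* )^\chi$, and hence their images form a basis of $(\mathrm{S}(V^* )/\mathcal{I}^*\otimes\wedge M^* )^\chi$.
   Context: A pseudo-reflection is $g\in\mathrm{GL}(V)$ with $\dim\ker(g-I)=n-1$. $G$ acts contragrediently on $V^*,M^*$ and diagonally on tensor products of symmetric algebras $\mathrm{S}(\cdot)$ and exterior algebras $\wedge(\cdot)$. $W^\chi=\{w: gw=\chi(g)w\ \forall g\}$. $\Delta_\chi$ is a homogeneous generator of $\mathrm{S}(V^* )^\chi$ as a (rank-one free) $\mathrm{S}(V^* )^G$-module. Jacobian: $(\mathrm{S}(V^* )\otimes M)^G$ is a free $\mathrm{S}(V^* )^G$-module with homogeneous basis $\omega_1^{M^*},\dots,\omega_r^{M^*}$; writing $\omega_i^{M^*}=\sum_j J_{ij}\otimes m_j$ for a basis $m_j$ of $M$, $J_{M^*}=\det(J_{ij})$. $(\mathrm{S}(V)\otimes M^* )^G$ is a free $\mathrm{S}(V)^G$-module with homogeneous basis $\tilde\omega_1^{M^*},\dots,\tilde\omega_r^{M^*}$.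 For $s\in\mathrm{S}(V)$, $\partial_s$ is the constant-coefficient differential operator on $\mathrm{S}(V^* )$ (for $v\in V$, $\partial_v$ is the derivation with $\partial_v\lambda=\lambda(v)$, extended multiplicatively in $s$); $\epsilon_\mu$ is left exterior multiplication by $\mu\in\wedge M^*$. If $\tilde\omega_i^{M^*}=\sum_j s_j\otimes\mu_j$, then $d_i^*:=\sum_j\partial_{s_j}\otimes\epsilon_{\mu_j}$ on $\mathrm{S}(V^* )\otimes\wedge M^*$. $\mathcal{I}\subset\mathrm{S}(V)$ and $\mathcal{I}^*\subset\mathrm{S}(V^* )$ are the ideals generated by homogeneous $G$-invariants of positive degree. The pairing $\mathrm{S}(V^* )\times\mathrm{S}(V)\to F$ is $\langle\lambda_1\cdots\lambda_k, v_1\cdots v_l\rangle=\delta_{kl}\sum_{\sigma\in\mathfrak{S}_k}\prod_i\lambda_i(v_{\sigma(i)})$, and $\mathcal{H}(V^* )=\{f\in\mathrm{S}(V^* ):\langle f,s\rangle=0\ \forall s\in\mathcal{I}\}$ (the $G$-harmonics). *)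

theory Defs
  imports "HOL-Library.Poly_Mapping" "Jordan_Normal_Form.Matrix_Kernel"
begin

text \<open>Coordinate model.  V = F^n with standard basis e_0..e_(n-1); V^* has the dual
basis x_0..x_(n-1).  Both S(V^*) and S(V) are modelled as polynomials in the variables
0..n-1 (type mpoly, finitely supported maps from monomials to coefficients).  A group
element g acts on V by the matrix g; M = F^r with basis m_0..m_(r-1), g acting by the
matrix rho g; M^* has the dual basis mu_0..mu_(r-1).\<close>

type_synonym 'a mpoly = "(nat \<Rightarrow>\<^sub>0 nat) \<Rightarrow>\<^sub>0 'a"

definition poly_in :: "nat \<Rightarrow> 'a::zero mpoly \<Rightarrow> bool" where
  "poly_in n p \<longleftrightarrow> (\<forall>m\<in>Poly_Mapping.keys p. Poly_Mapping.keys m \<subseteq> {..<n})"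

definition pconst :: "'a::zero \<Rightarrow> 'a mpoly" where
  "pconst c = Poly_Mapping.single 0 c"

definition pvar :: "nat \<Rightarrow> 'a::{zero,one} mpoly" where
  "pvar i = Poly_Mapping.single (Poly_Mapping.single i 1) 1"

definition pmonom :: "(nat \<Rightarrow>\<^sub>0 nat) \<Rightarrow> 'a::{zero,one} mpoly" where
  "pmonom m = Poly_Mapping.single m 1"

definition tdeg :: "(nat \<Rightarrow>\<^sub>0 nat) \<Rightarrow> nat" where
  "tdeg m = (\<Sum>i\<in>Poly_Mapping.keys m. Poly_Mapping.lookup m i)"

definition homogeneous :: "nat \<Rightarrow> 'a::zero mpoly \<Rightarrow> bool" where
  "homogeneous d p \<longleftrightarrow> (\<forall>m\<in>Poly_Mapping.keys p. tdeg m = d)"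

definition subst :: "(nat \<Rightarrow> 'a::comm_ring_1 mpoly) \<Rightarrow> 'a mpoly \<Rightarrow> 'a mpoly" where
  "subst L p = (\<Sum>m\<in>Poly_Mapping.keys p.
      pconst (Poly_Mapping.lookup p m) * (\<Prod>i\<in>Poly_Mapping.keys m. L i ^ Poly_Mapping.lookup m i))"

definition lin_form :: "nat \<Rightarrow> (nat \<Rightarrow> 'a::comm_ring_1) \<Rightarrow> 'a mpoly" where
  "lin_form n c = (\<Sum>j<n. pconst (c j) * pvar j)"

definition mat_group :: "nat \<Rightarrow> 'a::field mat set \<Rightarrow> bool" where
  "mat_group n G \<longleftrightarrow> finite G \<and> (\<forall>g\<in>G. g \<in> carrier_mat n n \<and> det g \<noteq> 0) \<and>
     1\<^sub>m n \<in> G \<and> (\<forall>g\<in>G. \<forall>h\<in>G. g * h \<in> G) \<and> (\<forall>g\<in>G. \<exists>h\<in>G. g * h = 1\<^sub>m n)"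

definition ginv :: "nat \<Rightarrow> 'a::field mat set \<Rightarrow> 'a mat \<Rightarrow> 'a mat" where
  "ginv n G g = (THE h. h \<in> G \<and> g * h = 1\<^sub>m n)"

definition pseudo_reflection :: "nat \<Rightarrow> 'a::field mat \<Rightarrow> bool" where
  "pseudo_reflection n g \<longleftrightarrow> g \<in> carrier_mat n n \<and> kernel_dim (g - 1\<^sub>m n) + 1 = n"

definition generated_by_pseudo_reflections :: "nat \<Rightarrow> 'a::field mat set \<Rightarrow> bool" where
  "generated_by_pseudo_reflections n G \<longleftrightarrow>
     (\<forall>H. H \<subseteq> G \<and> {g\<in>G. pseudo_reflection n g} \<subseteq> H \<and> 1\<^sub>m n \<in> H \<and>
          (\<forall>a\<in>H. \<forall>b\<in>H. a * b \<in> H) \<and> (\<forall>a\<in>H. ginv n G a \<in> H) \<longrightarrow> H = G)"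

definition representation :: "nat \<Rightarrow> nat \<Rightarrow> 'a::field mat set \<Rightarrow> ('a mat \<Rightarrow> 'a mat) \<Rightarrow> bool" where
  "representation n r G \<rho> \<longleftrightarrow> (\<forall>g\<in>G. \<rho> g \<in> carrier_mat r r) \<and> \<rho> (1\<^sub>m n) = 1\<^sub>m r \<and>
     (\<forall>g\<in>G. \<forall>h\<in>G. \<rho> (g * h) = \<rho> g * \<rho> h)"

definition linear_character :: "'a::field mat set \<Rightarrow> ('a mat \<Rightarrow> 'a) \<Rightarrow> bool" where
  "linear_character G \<chi> \<longleftrightarrow> (\<forall>g\<in>G. \<chi> g \<noteq> 0) \<and> (\<forall>g\<in>G. \<forall>h\<in>G. \<chi> (g * h) = \<chi> g * \<chi> h)"

text \<open>contragredient: g.x_i = sum_j (g^-1)_ij x_j\<close>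
definition actVs :: "nat \<Rightarrow> 'a::field mat set \<Rightarrow> 'a mat \<Rightarrow> 'a mpoly \<Rightarrow> 'a mpoly" where
  "actVs n G g f = subst (\<lambda>i. lin_form n (\<lambda>j. ginv n G g $$ (i, j))) f"

definition actV :: "nat \<Rightarrow> 'a::field mat \<Rightarrow> 'a mpoly \<Rightarrow> 'a mpoly" where
  "actV n g s = subst (\<lambda>j. lin_form n (\<lambda>i. g $$ (i, j))) s"

definition SVs_inv :: "nat \<Rightarrow> 'a::field mat set \<Rightarrow> 'a mpoly set" where
  "SVs_inv n G = {f. poly_in n f \<and> (\<forall>g\<in>G. actVs n G g f = f)}"

definition SV_inv :: "nat \<Rightarrow> 'a::field mat set \<Rightarrow> 'a mpoly set" where
  "SV_inv n G = {s. poly_in n s \<and> (\<forall>g\<in>G. actV n g s = s)}"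

definition SVs_chi :: "nat \<Rightarrow> 'a::field mat set \<Rightarrow> ('a mat \<Rightarrow> 'a) \<Rightarrow> 'a mpoly set" where
  "SVs_chi n G \<chi> = {f. poly_in n f \<and> (\<forall>g\<in>G. actVs n G g f = pconst (\<chi> g) * f)}"

definition ideal_I :: "nat \<Rightarrow> 'a::field mat set \<Rightarrow> 'a mpoly set" where
  "ideal_I n G = {(\<Sum>k<N. a k * h k) | (N::nat) a h. \<forall>k<N. poly_in n (a k) \<and> h k \<in> SV_inv n G \<and>
        (\<exists>d>0. homogeneous d (h k))}"

definition ideal_Istar :: "nat \<Rightarrow> 'a::field mat set \<Rightarrow> 'a mpoly set" where
  "ideal_Istar n G = {(\<Sum>k<N. a k * h k) | (N::nat) a h. \<forall>k<N. poly_in n (a k) \<and> h k \<in> SVs_inv n G \<and>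
        (\<exists>d>0. homogeneous d (h k))}"

definition pairing :: "'a::field mpoly \<Rightarrow> 'a mpoly \<Rightarrow> 'a" where
  "pairing f s = (\<Sum>m\<in>Poly_Mapping.keys f. Poly_Mapping.lookup f m * Poly_Mapping.lookup s m *
       of_nat (\<Prod>i\<in>Poly_Mapping.keys m. fact (Poly_Mapping.lookup m i)))"

definition harmonics :: "nat \<Rightarrow> 'a::field mat set \<Rightarrow> 'a mpoly set" where
  "harmonics n G = {f. poly_in n f \<and> (\<forall>s\<in>ideal_I n G. pairing f s = 0)}"

text \<open>vectors of r polynomials (coefficients of m_j, resp. mu_j)\<close>
definition tens_ok :: "nat \<Rightarrow> nat \<Rightarrow> (nat \<Rightarrow> 'a::zero mpoly) \<Rightarrow> bool" where
  "tens_ok n r w \<longleftrightarrow> (\<forall>j<r. poly_in n (w j)) \<and> (\<forall>j\<ge>r. w j = 0)"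

definition actSM :: "nat \<Rightarrow> nat \<Rightarrow> 'a::field mat set \<Rightarrow> ('a mat \<Rightarrow> 'a mat) \<Rightarrow> 'a mat
    \<Rightarrow> (nat \<Rightarrow> 'a mpoly) \<Rightarrow> (nat \<Rightarrow> 'a mpoly)" where
  "actSM n r G \<rho> g w = (\<lambda>i. if i < r then (\<Sum>j<r. pconst (\<rho> g $$ (i, j)) * actVs n G g (w j)) else 0)"

definition actSMs :: "nat \<Rightarrow> nat \<Rightarrow> 'a::field mat set \<Rightarrow> ('a mat \<Rightarrow> 'a mat) \<Rightarrow> 'a mat
    \<Rightarrow> (nat \<Rightarrow> 'a mpoly) \<Rightarrow> (nat \<Rightarrow> 'a mpoly)" where
  "actSMs n r G \<rho> g w = (\<lambda>k. if k < r then (\<Sum>j<r. pconst (\<rho> (ginv n G g) $$ (j, k)) * actV n g (w j)) else 0)"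

definition SM_inv :: "nat \<Rightarrow> nat \<Rightarrow> 'a::field mat set \<Rightarrow> ('a mat \<Rightarrow> 'a mat) \<Rightarrow> (nat \<Rightarrow> 'a mpoly) set" where
  "SM_inv n r G \<rho> = {w. tens_ok n r w \<and> (\<forall>g\<in>G. actSM n r G \<rho> g w = w)}"

definition SMs_inv :: "nat \<Rightarrow> nat \<Rightarrow> 'a::field mat set \<Rightarrow> ('a mat \<Rightarrow> 'a mat) \<Rightarrow> (nat \<Rightarrow> 'a mpoly) set" where
  "SMs_inv n r G \<rho> = {w. tens_ok n r w \<and> (\<forall>g\<in>G. actSMs n r G \<rho> g w = w)}"

definition homogeneous_free_basis :: "nat \<Rightarrow> 'a::field mpoly set \<Rightarrow> (nat \<Rightarrow> 'a mpoly) set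
    \<Rightarrow> (nat \<Rightarrow> nat \<Rightarrow> 'a mpoly) \<Rightarrow> bool" where
  "homogeneous_free_basis r R W \<omega> \<longleftrightarrow>
     (\<forall>i<r. \<omega> i \<in> W \<and> (\<exists>d. \<forall>j. homogeneous d (\<omega> i j))) \<and>
     (\<forall>w\<in>W. \<exists>a. (\<forall>i<r. a i \<in> R) \<and> w = (\<lambda>j. \<Sum>i<r. a i * \<omega> i j)) \<and>
     (\<forall>a. (\<forall>i<r. a i \<in> R) \<and> (\<lambda>j. \<Sum>i<r. a i * \<omega> i j) = (\<lambda>j. 0) \<longrightarrow> (\<forall>i<r. a i = 0))"

text \<open>J_{M^*} = det(J_ij) where omega_i = sum_j J_ij (x) m_j\<close>
definition jacobian :: "nat \<Rightarrow> (nat \<Rightarrow> nat \<Rightarrow> 'a::field mpoly) \<Rightarrow> 'a mpoly" where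
  "jacobian r \<omega> = det (mat r r (\<lambda>(i, j). \<omega> i j))"

subsection \<open>Exterior algebra \<And>M^* (coefficients of mu_S, S a subset of {0..<r})\<close>

text \<open>left exterior multiplication by mu_i\<close>
definition eps :: "nat \<Rightarrow> (nat set \<Rightarrow> 'b::comm_ring_1) \<Rightarrow> (nat set \<Rightarrow> 'b)" where
  "eps i E = (\<lambda>T. if i \<in> T then (- 1) ^ card {s\<in>T. s < i} * E (T - {i}) else 0)"

definition eps_lin :: "nat \<Rightarrow> (nat \<Rightarrow> 'b::comm_ring_1) \<Rightarrow> (nat set \<Rightarrow> 'b) \<Rightarrow> (nat set \<Rightarrow> 'b)" where
  "eps_lin r c E = (\<lambda>T. \<Sum>i<r. c i * eps i E T)"

definition ext_one :: "nat set \<Rightarrow> 'b::{zero,one}" where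
  "ext_one = (\<lambda>T. if T = {} then 1 else 0)"

text \<open>g.mu_S = (g.mu_s1) ^ ... ^ (g.mu_sk), where g.mu_i = sum_j (rho(g^-1))_ij mu_j\<close>
definition act_wedge :: "nat \<Rightarrow> nat \<Rightarrow> 'a::field mat set \<Rightarrow> ('a mat \<Rightarrow> 'a mat) \<Rightarrow> 'a mat
    \<Rightarrow> nat set \<Rightarrow> (nat set \<Rightarrow> 'a)" where
  "act_wedge n r G \<rho> g S = foldr (\<lambda>s E. eps_lin r (\<lambda>j. \<rho> (ginv n G g) $$ (s, j)) E)
       (sorted_list_of_set S) ext_one"

definition SE_ok :: "nat \<Rightarrow> nat \<Rightarrow> (nat set \<Rightarrow> 'a::zero mpoly) \<Rightarrow> bool" where
  "SE_ok n r w \<longleftrightarrow> (\<forall>S. S \<subseteq> {..<r} \<longrightarrow> poly_in n (w S)) \<and> (\<forall>S. \<not> S \<subseteq> {..<r} \<longrightarrow> w S = 0)"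

definition actSE :: "nat \<Rightarrow> nat \<Rightarrow> 'a::field mat set \<Rightarrow> ('a mat \<Rightarrow> 'a mat) \<Rightarrow> 'a mat
    \<Rightarrow> (nat set \<Rightarrow> 'a mpoly) \<Rightarrow> (nat set \<Rightarrow> 'a mpoly)" where
  "actSE n r G \<rho> g w = (\<lambda>T. \<Sum>S\<in>Pow {..<r}. actVs n G g (w S) * pconst (act_wedge n r G \<rho> g S T))"

definition HE_chi :: "nat \<Rightarrow> nat \<Rightarrow> 'a::field mat set \<Rightarrow> ('a mat \<Rightarrow> 'a mat) \<Rightarrow> ('a mat \<Rightarrow> 'a)
    \<Rightarrow> (nat set \<Rightarrow> 'a mpoly) set" where
  "HE_chi n r G \<rho> \<chi> = {w. SE_ok n r w \<and> (\<forall>S. w S \<in> harmonics n G) \<and>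
      (\<forall>g\<in>G. actSE n r G \<rho> g w = (\<lambda>T. pconst (\<chi> g) * w T))}"

text \<open>classes in (S(V^*)/I^* (x) \<And>M^*)^chi, represented by elements of S(V^*) (x) \<And>M^*\<close>
definition in_IE :: "nat \<Rightarrow> 'a::field mat set \<Rightarrow> (nat set \<Rightarrow> 'a mpoly) \<Rightarrow> bool" where
  "in_IE n G w \<longleftrightarrow> (\<forall>T. w T \<in> ideal_Istar n G)"

definition quot_chi :: "nat \<Rightarrow> nat \<Rightarrow> 'a::field mat set \<Rightarrow> ('a mat \<Rightarrow> 'a mat) \<Rightarrow> ('a mat \<Rightarrow> 'a)
    \<Rightarrow> (nat set \<Rightarrow> 'a mpoly) \<Rightarrow> bool" where
  "quot_chi n r G \<rho> \<chi> w \<longleftrightarrow> SE_ok n r w \<and>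
      (\<forall>g\<in>G. in_IE n G (\<lambda>T. actSE n r G \<rho> g w T - pconst (\<chi> g) * w T))"

definition pderiv_var :: "nat \<Rightarrow> 'a::comm_ring_1 mpoly \<Rightarrow> 'a mpoly" where
  "pderiv_var i p = (\<Sum>m\<in>Poly_Mapping.keys p.
      pconst (Poly_Mapping.lookup p m * of_nat (Poly_Mapping.lookup m i)) * pmonom (m - Poly_Mapping.single i 1))"

definition diff_monom :: "(nat \<Rightarrow>\<^sub>0 nat) \<Rightarrow> 'a::comm_ring_1 mpoly \<Rightarrow> 'a mpoly" where
  "diff_monom b p = foldr (\<lambda>i q. (pderiv_var i ^^ Poly_Mapping.lookup b i) q) (sorted_list_of_set (Poly_Mapping.keys b)) p"

definition diff_op :: "'a::comm_ring_1 mpoly \<Rightarrow> 'a mpoly \<Rightarrow> 'a mpoly" where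
  "diff_op s p = (\<Sum>b\<in>Poly_Mapping.keys s. pconst (Poly_Mapping.lookup s b) * diff_monom b p)"

text \<open>d_i^* = sum_j partial_{s_j} (x) eps_{mu_j}, where tomega_i = sum_j s_j (x) mu_j\<close>
definition d_star :: "nat \<Rightarrow> (nat \<Rightarrow> nat \<Rightarrow> 'a::comm_ring_1 mpoly) \<Rightarrow> nat
    \<Rightarrow> (nat set \<Rightarrow> 'a mpoly) \<Rightarrow> (nat set \<Rightarrow> 'a mpoly)" where
  "d_star r t\<omega> i w = (\<lambda>T. \<Sum>j<r. eps j (\<lambda>S. diff_op (t\<omega> i j) (w S)) T)"

definition basis_elem :: "nat \<Rightarrow> (nat \<Rightarrow> nat \<Rightarrow> 'a::comm_ring_1 mpoly) \<Rightarrow> 'a mpoly \<Rightarrow> nat set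
    \<Rightarrow> (nat set \<Rightarrow> 'a mpoly)" where
  "basis_elem r t\<omega> \<Delta> I = foldr (d_star r t\<omega>) (sorted_list_of_set I) (\<lambda>T. if T = {} then \<Delta> else 0)"

definition lin_comb :: "nat \<Rightarrow> (nat set \<Rightarrow> 'a::comm_ring_1) \<Rightarrow> (nat set \<Rightarrow> nat set \<Rightarrow> 'a mpoly)
    \<Rightarrow> (nat set \<Rightarrow> 'a mpoly)" where
  "lin_comb r c e = (\<lambda>T. \<Sum>I\<in>Pow {..<r}. pconst (c I) * e I T)"

end

theory Submission
  imports Defs "HOL-Library.Nat_Bijection" "HOL-Library.Function_Algebras"
begin

text \<open>By Chevalley's divided-difference argument, homogeneous elements of \<open>(S(V\<^sup>*) \<otimes> \<And>M\<^sup>*)\<^sup>\<chi>\<close> that are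
  linearly independent modulo the ideal \<open>I\<^sup>*\<close> are independent over the invariants; being semi-invariants
  they are then independent over \<open>S(V\<^sup>*)\<close>, so that there are at most \<open>2\<^sup>r\<close> of them.

  Conversely \<open>\<partial>\<^sub>s\<close> is adjoint to multiplication by \<open>s\<close> under the pairing, \<open>\<Delta>\<close> is harmonic and the \<open>d\<^sub>i\<^sup>*\<close>
  anticommute, so the independence of the \<open>2\<^sup>r\<close> elements reduces to \<open>\<partial>\<^sub>T \<Delta> \<noteq> 0\<close> for the determinant \<open>T\<close> of the
  dual basis. Write \<open>\<Delta> = J k\<close>. The \<open>G\<close>-invariant pairing provides a semi-invariant \<open>q\<close> in \<open>S(V)\<close> of the
  degree of \<open>k\<close> with the inverse character. As \<open>T\<close> has the degree of \<open>J\<close>, the product \<open>T q\<close> lies in the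
  component dual to the line spanned by \<open>\<Delta>\<close>, hence it pairs nontrivially with \<open>\<Delta>\<close>.

  Both parts, and the equality of the degrees of \<open>T\<close> and \<open>J\<close>, use that harmonics and \<open>I\<^sup>*\<close> meet only in \<open>0\<close>.
  Over \<open>\<complex>\<close> this is positivity of a Hermitian form; over an arbitrary field of characteristic \<open>0\<close> it is
  reduced to a permutation module, which has a rational structure.\<close>

subsection \<open>Polynomials\<close>

text \<open>The factor \<open>q\<close> is forced by characters: \<open>jacobian r t\<close> has the
  character det \<rho>, a partner of \<Delta> under the invariant pairing must have the inverse of
  \<chi>, and the discrepancy is exactly the inverse of the character of the cofactor
  \<open>k\<close>. Dualising \<open>k\<close> thus supplies it, in the degree of \<open>k\<close>;
  the total degree is right once both determinants have equal degree. For the degrees, the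
  \<open>t j\<close> of one degree are independent modulo the ideal of \<open>S(V)\<close>.
  Functionals that separate them and vanish on the ideal become, after averaging, invariant harmonic
  vectors in \<open>SM.vinv\<close>, and there are at most as many independent ones as there are
  \<open>\<omega> i\<close> of that degree. Both families have \<open>r\<close> members, so equality
  holds in every degree. A field of characteristic 0 need carry neither an order nor a conjugation,
  and the matrices in \<open>G\<close> need not be rational, so \<open>V\<close> itself offers no
  positive form. The columns of all group elements are therefore replaced by independent variables,
  which \<open>G\<close> merely permutes.\<close>

lemma poly_mapping_add_induct [case_names zero single add]:
  assumes "P 0" "\<And>m c. P (Poly_Mapping.single m c)" "\<And>p q. P p \<Longrightarrow> P q \<Longrightarrow> P (p + q)"
  shows "P (p :: 'k \<Rightarrow>\<^sub>0 'b::comm_monoid_add)"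
proof -
  have sum: "P (\<Sum>m\<in>A. Poly_Mapping.single m (f m))" if "finite A" for A f
    using that by (induction A) (auto intro: assms)
  have "p = (\<Sum>m\<in>Poly_Mapping.keys p. Poly_Mapping.single m (Poly_Mapping.lookup p m))"
    by (rule poly_mapping_eqI)
       (simp add: lookup_sum lookup_single when_def not_in_keys_iff_lookup_eq_zero)
  then show ?thesis using sum[of "Poly_Mapping.keys p"] by (metis finite_keys)
qed

lemma lookup_pconst_mult [simp]:
  "Poly_Mapping.lookup (pconst c * p) m = c * Poly_Mapping.lookup p m"
proof (induction p rule: poly_mapping_add_induct)
  case zero show ?case by simp
next
  case (single m c) show ?case
    by (simp add: pconst_def mult_single lookup_single when_def)
next
  case (add p q) then show ?case by (simp add: lookup_add algebra_simps)
qed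

lemma pconst_0 [simp]: "pconst 0 = 0"
  and pconst_1 [simp]: "pconst 1 = 1"
  and pconst_add: "pconst (a + b) = pconst a + pconst b"
  by (simp_all add: pconst_def single_add)

lemma pconst_mult: "pconst (a * b) = pconst a * pconst (b::'a::comm_semiring_1)"
  by (simp add: pconst_def mult_single)

lemma pconst_minus: "pconst (- a) = - pconst (a::'a::ab_group_add)"
  by (simp add: pconst_def single_uminus)

lemma pconst_diff: "pconst (a - b) = pconst a - pconst (b::'a::ab_group_add)"
  by (simp add: pconst_def single_diff)

lemma pconst_sum: "pconst (sum f A) = (\<Sum>i\<in>A. pconst (f i))"
  by (induction A rule: infinite_finite_induct) (auto simp: pconst_add)

lemma pconst_of_nat: "pconst (of_nat k) = (of_nat k :: 'a::comm_semiring_1 mpoly)"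
  by (induction k) (simp_all add: pconst_add)

lemma pconst_eq_iff [simp]: "pconst a = pconst b \<longleftrightarrow> a = b"
  by (metis lookup_single_eq pconst_def)

lemma pconst_eq_0_iff [simp]: "pconst a = 0 \<longleftrightarrow> a = 0"
  by (metis pconst_0 pconst_eq_iff)

lemma lookup_pconst: "Poly_Mapping.lookup (pconst c) m = (if m = 0 then c else 0)"
  by (simp add: pconst_def lookup_single when_def)

lemma pmonom_add: "pmonom (a + b) = pmonom a * (pmonom b :: 'a::comm_semiring_1 mpoly)"
  by (simp add: pmonom_def mult_single)

lemma pmonom_0 [simp]: "pmonom 0 = 1"
  by (simp add: pmonom_def)

lemma lookup_pmonom: "Poly_Mapping.lookup (pmonom m) k = (if m = k then 1 else 0)"
  by (simp add: pmonom_def lookup_single when_def)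

lemma pmonom_neq_0 [simp]: "pmonom m \<noteq> (0 :: 'a::comm_semiring_1 mpoly)"
  by (metis lookup_pmonom lookup_zero zero_neq_one)

lemma pvar_eq_pmonom: "pvar i = pmonom (Poly_Mapping.single i 1)"
  by (simp add: pvar_def pmonom_def)

lemma lookup_pmonom_mult_0:
  fixes p :: "'a::comm_semiring_1 mpoly"
  assumes "\<And>m'. m \<noteq> a + m'"
  shows "Poly_Mapping.lookup (pmonom a * p) m = 0"
  using assms by (induction p rule: poly_mapping_add_induct)
     (auto simp: pmonom_def mult_single lookup_single when_def lookup_add algebra_simps)

lemma tdeg_eq: "finite A \<Longrightarrow> Poly_Mapping.keys m \<subseteq> A \<Longrightarrow> tdeg m = (\<Sum>i\<in>A. Poly_Mapping.lookup m i)"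
  unfolding tdeg_def by (rule sum.mono_neutral_left) (auto simp: in_keys_iff)

lemma tdeg_0 [simp]: "tdeg 0 = 0"
  by (simp add: tdeg_def)

lemma tdeg_single [simp]: "tdeg (Poly_Mapping.single i k) = k"
  by (simp add: tdeg_def)

lemma tdeg_add: "tdeg (a + b) = tdeg a + tdeg b"
proof -
  let ?A = "Poly_Mapping.keys a \<union> Poly_Mapping.keys b"
  have "tdeg (a + b) = (\<Sum>i\<in>?A. Poly_Mapping.lookup (a + b) i)"
    by (rule tdeg_eq) (auto dest: subsetD[OF keys_add])
  also have "\<dots> = tdeg a + tdeg b"
    by (simp add: lookup_add sum.distrib tdeg_eq[of ?A a] tdeg_eq[of ?A b])
  finally show ?thesis .
qed

lemma tdeg_eq_0_iff: "tdeg m = 0 \<longleftrightarrow> m = 0"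
  by (auto simp: tdeg_def in_keys_iff simp flip: keys_eq_empty)

lemma keys_add_nat: "Poly_Mapping.keys (a + b) = Poly_Mapping.keys a \<union> Poly_Mapping.keys (b :: nat \<Rightarrow>\<^sub>0 nat)"
  by (auto simp: in_keys_iff lookup_add)

lemma split_var:
  assumes "i \<in> Poly_Mapping.keys (m :: nat \<Rightarrow>\<^sub>0 nat)"
  obtains m' where "m = Poly_Mapping.single i 1 + m'"
proof
  show "m = Poly_Mapping.single i 1 + (m - Poly_Mapping.single i 1)"
    using assms by (intro poly_mapping_eqI) (auto simp: lookup_add lookup_minus lookup_single when_def in_keys_iff)
qed

lemma monom_induct [consumes 1, case_names zero add]:
  assumes "Poly_Mapping.keys (m :: nat \<Rightarrow>\<^sub>0 nat) \<subseteq> A"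
    and "P 0" and "\<And>i m. i \<in> A \<Longrightarrow> Poly_Mapping.keys m \<subseteq> A \<Longrightarrow> P m \<Longrightarrow> P (Poly_Mapping.single i 1 + m)"
  shows "P m"
  using assms(1)
proof (induction "tdeg m" arbitrary: m)
  case 0 then show ?case using assms(2) by (simp add: tdeg_eq_0_iff)
next
  case (Suc d)
  then have "m \<noteq> 0" by auto
  then obtain i where i: "i \<in> Poly_Mapping.keys m" by (metis ex_in_conv keys_eq_empty in_keys_iff lookup_zero poly_mapping_eqI)
  then obtain m' where m': "m = Poly_Mapping.single i 1 + m'" using split_var by blast
  have "P m'" using Suc m' by (intro Suc) (auto simp: tdeg_add keys_add_nat)
  then show ?case using assms(3)[of i m'] i Suc.prems m' by (auto simp: keys_add_nat)
qed

text \<open>The set of variables is arbitrary because \<open>harmonics_Istar_0\<close> works with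
  variables that code pairs of a group element and an index; these need not form an initial
  segment.\<close>

definition vars_in :: "nat set \<Rightarrow> 'a::zero mpoly \<Rightarrow> bool" where
  "vars_in A p \<longleftrightarrow> (\<forall>m\<in>Poly_Mapping.keys p. Poly_Mapping.keys m \<subseteq> A)"

lemma poly_in_vars_in: "poly_in n = vars_in {..<n}"
  by (rule ext) (simp add: poly_in_def vars_in_def)

lemma vars_in_UNIV [simp]: "vars_in UNIV p"
  by (simp add: vars_in_def)

lemma vars_in_induct [consumes 1, case_names const var add]:
  fixes p :: "'a::comm_semiring_1 mpoly"
  assumes "vars_in A p" "\<And>c. P (pconst c)"
    "\<And>i p. i \<in> A \<Longrightarrow> vars_in A p \<Longrightarrow> P p \<Longrightarrow> P (pvar i * p)" "\<And>p q. P p \<Longrightarrow> P q \<Longrightarrow> P (p + q)"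
  shows "P p"
proof -
  have mon: "P (Poly_Mapping.single m c)" if "Poly_Mapping.keys m \<subseteq> A" for m c
    using that
  proof (induction m rule: monom_induct)
    case zero show ?case using assms(2) by (simp add: pconst_def)
  next
    case (add i m)
    have "vars_in A (Poly_Mapping.single m c)" using add by (simp add: vars_in_def)
    then show ?case using assms(3)[OF add(1) _ add(3)] by (simp add: pvar_def mult_single)
  qed
  have sum: "P (\<Sum>m\<in>B. Poly_Mapping.single m (f m))"
    if "finite B" "\<And>m. m \<in> B \<Longrightarrow> Poly_Mapping.keys m \<subseteq> A" for B f
    using that assms(2)[of 0] by (induction B) (auto intro: assms mon)
  have "p = (\<Sum>m\<in>Poly_Mapping.keys p. Poly_Mapping.single m (Poly_Mapping.lookup p m))"
    by (rule poly_mapping_eqI)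
       (simp add: lookup_sum lookup_single when_def not_in_keys_iff_lookup_eq_zero)
  moreover have "P \<dots>" using assms(1) by (intro sum) (auto simp: vars_in_def)
  ultimately show ?thesis by simp
qed

lemmas mpoly_induct = vars_in_induct[OF vars_in_UNIV, case_names const var add]

lemma vars_in_0 [simp]: "vars_in A 0"
  by (simp add: vars_in_def)

lemma vars_in_pconst [simp]: "vars_in A (pconst c)"
  by (simp add: vars_in_def pconst_def)

lemma vars_in_1 [simp]: "vars_in A (1 :: 'a::zero_neq_one mpoly)"
  by (simp add: vars_in_def)

lemma vars_in_pvar: "i \<in> A \<Longrightarrow> vars_in A (pvar i :: 'a::zero_neq_one mpoly)"
  by (simp add: vars_in_def pvar_def)

lemma vars_in_add: "vars_in A p \<Longrightarrow> vars_in A q \<Longrightarrow> vars_in A (p + q)"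
  unfolding vars_in_def using keys_add[of p q] by blast

lemma vars_in_minus: "vars_in A (p :: 'a::ab_group_add mpoly) \<Longrightarrow> vars_in A (- p)"
  by (simp add: vars_in_def in_keys_iff)

lemma vars_in_diff: "vars_in A p \<Longrightarrow> vars_in A q \<Longrightarrow> vars_in A (p - q :: 'a::ab_group_add mpoly)"
  using vars_in_add[of A p "- q"] vars_in_minus[of A q] by simp

lemma vars_in_mult: "vars_in A p \<Longrightarrow> vars_in A q \<Longrightarrow> vars_in A (p * q :: 'a::semiring_0 mpoly)"
  unfolding vars_in_def using keys_mult[of p q] by (force simp: keys_add_nat)

lemma vars_in_sum: "(\<And>i. i \<in> I \<Longrightarrow> vars_in A (f i)) \<Longrightarrow> vars_in A (sum f I)"
  by (induction I rule: infinite_finite_induct) (auto intro: vars_in_add)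

lemma vars_in_prod: "(\<And>i. i \<in> I \<Longrightarrow> vars_in A (f i)) \<Longrightarrow> vars_in A (prod f I :: 'a::comm_semiring_1 mpoly)"
  by (induction I rule: infinite_finite_induct) (auto intro: vars_in_mult)

lemma vars_in_pmonom: "Poly_Mapping.keys m \<subseteq> A \<Longrightarrow> vars_in A (pmonom m :: 'a::comm_semiring_1 mpoly)"
  by (simp add: vars_in_def pmonom_def)

lemmas poly_in_0 [simp] = vars_in_0[of "{..<n}", folded poly_in_vars_in] for n
lemmas poly_in_1 [simp] = vars_in_1[of "{..<n}", folded poly_in_vars_in] for n
lemmas poly_in_pconst [simp] = vars_in_pconst[of "{..<n}", folded poly_in_vars_in] for n
lemmas poly_in_add = vars_in_add[of "{..<n}", folded poly_in_vars_in] for n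
lemmas poly_in_minus = vars_in_minus[of "{..<n}", folded poly_in_vars_in] for n
lemmas poly_in_diff = vars_in_diff[of "{..<n}", folded poly_in_vars_in] for n
lemmas poly_in_mult = vars_in_mult[of "{..<n}", folded poly_in_vars_in] for n
lemmas poly_in_sum = vars_in_sum[of _ "{..<n}", folded poly_in_vars_in] for n
lemmas poly_in_prod = vars_in_prod[of _ "{..<n}", folded poly_in_vars_in] for n
lemmas poly_in_pmonom = vars_in_pmonom[of _ "{..<n}", folded poly_in_vars_in] for n

section \<open>Homogeneous polynomials and homogeneous components\<close>

lemma homogeneous_0 [simp]: "homogeneous d 0"
  by (simp add: homogeneous_def)

lemma homogeneous_pconst [simp]: "homogeneous 0 (pconst c)"
  by (simp add: homogeneous_def pconst_def)

lemma homogeneous_1 [simp]: "homogeneous 0 (1 :: 'a::zero_neq_one mpoly)"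
  by (simp add: homogeneous_def)

lemma homogeneous_pvar [simp]: "homogeneous 1 (pvar i :: 'a::zero_neq_one mpoly)"
  by (simp add: homogeneous_def pvar_def)

lemma homogeneous_add: "homogeneous d p \<Longrightarrow> homogeneous d q \<Longrightarrow> homogeneous d (p + q)"
  unfolding homogeneous_def using keys_add[of p q] by blast

lemma homogeneous_minus: "homogeneous d (p :: 'a::ab_group_add mpoly) \<Longrightarrow> homogeneous d (- p)"
  by (simp add: homogeneous_def in_keys_iff)

lemma homogeneous_diff: "homogeneous d p \<Longrightarrow> homogeneous d q \<Longrightarrow> homogeneous d (p - q :: 'a::ab_group_add mpoly)"
  using homogeneous_add[of d p "- q"] homogeneous_minus[of d q] by simp

lemma homogeneous_mult:
  "homogeneous d p \<Longrightarrow> homogeneous e q \<Longrightarrow> homogeneous (d + e) (p * q :: 'a::semiring_0 mpoly)"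
  unfolding homogeneous_def using keys_mult[of p q] by (force simp: tdeg_add)

lemma homogeneous_pconst_mult: "homogeneous d p \<Longrightarrow> homogeneous d (pconst c * p :: 'a::semiring_0 mpoly)"
  using homogeneous_mult[of 0 "pconst c" d p] by simp

lemma homogeneous_sum: "(\<And>i. i \<in> I \<Longrightarrow> homogeneous d (f i)) \<Longrightarrow> homogeneous d (sum f I)"
  by (induction I rule: infinite_finite_induct) (auto intro: homogeneous_add)

lemma homogeneous_pmonom: "homogeneous (tdeg m) (pmonom m :: 'a::comm_semiring_1 mpoly)"
  by (simp add: homogeneous_def pmonom_def)

lemma homogeneous_0_const: "homogeneous 0 p \<Longrightarrow> p = pconst (Poly_Mapping.lookup p 0)"
  by (rule poly_mapping_eqI) (auto simp: homogeneous_def lookup_pconst tdeg_eq_0_iff in_keys_iff)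

definition hcomp :: "nat \<Rightarrow> 'a::comm_monoid_add mpoly \<Rightarrow> 'a mpoly" where
  "hcomp d p = (\<Sum>m | m \<in> Poly_Mapping.keys p \<and> tdeg m = d. Poly_Mapping.single m (Poly_Mapping.lookup p m))"

lemma lookup_hcomp: "Poly_Mapping.lookup (hcomp d p) m = (if tdeg m = d then Poly_Mapping.lookup p m else 0)"
  by (auto simp: hcomp_def lookup_sum lookup_single when_def in_keys_iff)

lemma hcomp_add: "hcomp d (p + q) = hcomp d p + hcomp d q"
  by (rule poly_mapping_eqI) (simp add: lookup_hcomp lookup_add)

lemma hcomp_0 [simp]: "hcomp d 0 = 0"
  by (simp add: hcomp_def)

lemma hcomp_sum: "hcomp d (sum f I) = (\<Sum>i\<in>I. hcomp d (f i))"
  by (induction I rule: infinite_finite_induct) (auto simp: hcomp_add)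

lemma homogeneous_hcomp: "homogeneous d (hcomp d p)"
  by (auto simp: homogeneous_def in_keys_iff lookup_hcomp split: if_splits)

lemma hcomp_homogeneous: "homogeneous e p \<Longrightarrow> hcomp d p = (if d = e then p else 0)"
  by (rule poly_mapping_eqI) (auto simp: lookup_hcomp homogeneous_def in_keys_iff)

lemma vars_in_hcomp: "vars_in A p \<Longrightarrow> vars_in A (hcomp d p)"
  by (auto simp: vars_in_def in_keys_iff lookup_hcomp split: if_splits)

lemmas poly_in_hcomp = vars_in_hcomp[of "{..<n}", folded poly_in_vars_in] for n

lemma hcomp_decomp: "p = (\<Sum>d\<in>tdeg ` Poly_Mapping.keys p. hcomp d p)"
  by (rule poly_mapping_eqI) (auto simp: lookup_sum lookup_hcomp in_keys_iff sum.If_cases)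

lemma hcomp_eqI: "(\<And>d. hcomp d p = hcomp d q) \<Longrightarrow> p = q"
  by (metis lookup_hcomp poly_mapping_eqI)

text \<open>Multiplication by \<open>q\<close> raises degrees by \<open>e\<close>. The case
  distinction keeps the truncated \<open>d - e\<close> from picking up the constant term when
  \<open>d < e\<close>.\<close>

lemma hcomp_mult_homogeneous:
  fixes p q :: "'a::comm_semiring_1 mpoly"
  assumes "homogeneous e q"
  shows "hcomp d (p * q) = (if e \<le> d then hcomp (d - e) p * q else 0)"
proof (induction p rule: poly_mapping_add_induct)
  case zero show ?case by simp
next
  case (single m c)
  have s: "homogeneous (tdeg m) (Poly_Mapping.single m c)" by (simp add: homogeneous_def)
  show ?case
    using hcomp_homogeneous[OF homogeneous_mult[OF s assms], of d] hcomp_homogeneous[OF s, of "d - e"] by auto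
next
  case (add p q) then show ?case by (simp add: hcomp_add algebra_simps)
qed

lemma hcomp_homogeneous_mult:
  fixes p q :: "'a::comm_semiring_1 mpoly"
  assumes "homogeneous e q"
  shows "hcomp d (q * p) = (if e \<le> d then q * hcomp (d - e) p else 0)"
  using hcomp_mult_homogeneous[OF assms, of d p] by (simp add: mult.commute)

text \<open>Compare components of degree \<open>d\<close> and cancel \<open>p\<close>. This
  determines the degree of a divided difference and of the cofactor of the Jacobian in
  \<Delta>.\<close>

lemma homogeneous_factor:
  fixes p q :: "'a::idom mpoly"
  assumes "homogeneous e p" "homogeneous d (p * q)" "p \<noteq> 0" "e \<le> d"
  shows "homogeneous (d - e) q"
proof -
  have "p * q = p * hcomp (d - e) q"
    using hcomp_homogeneous_mult[OF assms(1), of d q] hcomp_homogeneous[OF assms(2), of d] assms(4) by simp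
  then have "q = hcomp (d - e) q" using assms(3) by simp
  then show ?thesis by (metis homogeneous_hcomp)
qed

subsection \<open>Substitution\<close>

definition monom_subst :: "(nat \<Rightarrow> 'a::comm_ring_1 mpoly) \<Rightarrow> (nat \<Rightarrow>\<^sub>0 nat) \<Rightarrow> 'a mpoly" where
  "monom_subst L m = (\<Prod>i\<in>Poly_Mapping.keys m. L i ^ Poly_Mapping.lookup m i)"

lemma monom_subst_eq:
  "finite A \<Longrightarrow> Poly_Mapping.keys m \<subseteq> A \<Longrightarrow> monom_subst L m = (\<Prod>i\<in>A. L i ^ Poly_Mapping.lookup m i)"
  unfolding monom_subst_def by (rule prod.mono_neutral_left) (auto simp: in_keys_iff)

lemma monom_subst_add: "monom_subst L (a + b) = monom_subst L a * monom_subst L b"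
proof -
  let ?A = "Poly_Mapping.keys a \<union> Poly_Mapping.keys b"
  show ?thesis
    by (simp add: monom_subst_eq[of ?A] keys_add_nat lookup_add power_add prod.distrib)
qed

lemma subst_eq:
  assumes "finite K" "Poly_Mapping.keys p \<subseteq> K"
  shows "subst L p = (\<Sum>m\<in>K. pconst (Poly_Mapping.lookup p m) * monom_subst L m)"
  unfolding subst_def monom_subst_def using assms
  by (intro sum.mono_neutral_left) (auto simp: in_keys_iff)

lemma subst_add: "subst L (p + q) = subst L p + subst L q"
proof -
  let ?K = "Poly_Mapping.keys p \<union> Poly_Mapping.keys q"
  have "Poly_Mapping.keys (p + q) \<subseteq> ?K" using keys_add .
  then show ?thesis
    by (simp add: subst_eq[of ?K] lookup_add pconst_add distrib_right sum.distrib)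
qed

lemma subst_single: "subst L (Poly_Mapping.single m c) = pconst c * monom_subst L m"
  by (simp add: subst_eq[of "{m}"])

lemma subst_0 [simp]: "subst L 0 = 0"
  by (simp add: subst_def)

lemma subst_mult: "subst L (p * q) = subst L p * subst L q"
proof (induction p rule: poly_mapping_add_induct)
  case zero show ?case by simp
next
  case (add p p') then show ?case by (simp add: subst_add distrib_right)
next
  case p: (single m c)
  show ?case
  proof (induction q rule: poly_mapping_add_induct)
    case (single m' c')
    then show ?case by (simp add: mult_single subst_single monom_subst_add pconst_mult)
  qed (simp_all add: subst_add distrib_left)
qed

lemma subst_pconst [simp]: "subst L (pconst c) = pconst c"
  using subst_single[of L 0 c] by (simp add: pconst_def monom_subst_def)

lemma subst_1 [simp]: "subst L 1 = 1"
  using subst_pconst[of L 1] by simp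

lemma subst_pvar [simp]: "subst L (pvar i) = L i"
  by (simp add: pvar_def subst_single monom_subst_def)

lemma subst_pmonom: "subst L (pmonom m) = monom_subst L m"
  by (simp add: pmonom_def subst_single)

lemma subst_sum: "subst L (sum f I) = (\<Sum>i\<in>I. subst L (f i))"
  by (induction I rule: infinite_finite_induct) (auto simp: subst_add)

lemma subst_subst:
  assumes "vars_in A p" "\<And>i. i \<in> A \<Longrightarrow> subst L (L' i) = L'' i"
  shows "subst L (subst L' p) = subst L'' p"
  using assms(1) by (induction p rule: vars_in_induct) (simp_all add: subst_mult subst_add assms)

lemma subst_ident: "vars_in A p \<Longrightarrow> (\<And>i. i \<in> A \<Longrightarrow> L i = pvar i) \<Longrightarrow> subst L p = p"
  by (induction p rule: vars_in_induct) (simp_all add: subst_mult subst_add)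

lemma vars_in_subst:
  "vars_in A p \<Longrightarrow> (\<And>i. i \<in> A \<Longrightarrow> vars_in B (L i)) \<Longrightarrow> vars_in B (subst L p)"
  by (induction p rule: vars_in_induct) (auto simp: subst_mult subst_add intro: vars_in_mult vars_in_add)

lemma homogeneous_subst:
  assumes "vars_in A p" "homogeneous d p" "\<And>i. i \<in> A \<Longrightarrow> homogeneous 1 (L i)"
  shows "homogeneous d (subst L p)"
proof -
  have mon: "homogeneous (tdeg m) (monom_subst L m)" if "Poly_Mapping.keys m \<subseteq> A" for m
    using that
  proof (induction m rule: monom_induct)
    case zero then show ?case by (simp add: monom_subst_def)
  next
    case (add i m)
    then show ?case
      using homogeneous_mult[OF assms(3)[OF add(1)] add(3)]
      by (simp add: monom_subst_add tdeg_add) (simp add: monom_subst_def)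
  qed
  show ?thesis
    using assms(1,2) unfolding subst_eq[OF finite_keys order.refl]
    by (intro homogeneous_sum homogeneous_pconst_mult) (metis mon homogeneous_def vars_in_def)
qed

lemma subst_hcomp:
  assumes "vars_in A p" "\<And>i. i \<in> A \<Longrightarrow> homogeneous 1 (L i)"
  shows "hcomp d (subst L p) = subst L (hcomp d p)"
proof -
  have "hcomp d (subst L p) = (\<Sum>e\<in>tdeg ` Poly_Mapping.keys p. hcomp d (subst L (hcomp e p)))"
    by (subst hcomp_decomp[of p]) (simp add: subst_sum hcomp_sum)
  also have "\<dots> = (\<Sum>e\<in>tdeg ` Poly_Mapping.keys p. subst L (hcomp d (hcomp e p)))"
    using assms by (intro sum.cong refl)
      (subst hcomp_homogeneous[OF homogeneous_subst, OF vars_in_hcomp homogeneous_hcomp],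
       auto simp: hcomp_homogeneous[OF homogeneous_hcomp])
  also have "\<dots> = subst L (hcomp d p)"
    by (subst (2) hcomp_decomp[of p]) (simp add: subst_sum hcomp_sum)
  finally show ?thesis .
qed

lemma vars_in_lin_form: "(\<And>j. j < n \<Longrightarrow> j \<in> A) \<Longrightarrow> vars_in A (lin_form n c)"
  unfolding lin_form_def by (intro vars_in_sum vars_in_mult vars_in_pconst vars_in_pvar) auto

lemma homogeneous_lin_form: "homogeneous 1 (lin_form n c)"
  unfolding lin_form_def by (intro homogeneous_sum homogeneous_pconst_mult homogeneous_pvar)

lemma subst_lin_form: "subst L (lin_form n c) = (\<Sum>j<n. pconst (c j) * L j)"
  by (simp add: lin_form_def subst_sum subst_mult)

subsection \<open>The pairing and its adjoints\<close>

text \<open>The norm of a monomial: distinct monomials are orthogonal for \<open>pairing\<close>,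
  and \<open>pmonom m\<close> paired with itself gives \<open>mfact m\<close>. In characteristic 0
  it is nonzero, which makes the pairing nondegenerate.\<close>

definition mfact :: "(nat \<Rightarrow>\<^sub>0 nat) \<Rightarrow> 'a::field" where
  "mfact m = of_nat (\<Prod>i\<in>Poly_Mapping.keys m. fact (Poly_Mapping.lookup m i))"

lemma mfact_neq_0 [simp]: "mfact m \<noteq> (0 :: 'a::field_char_0)"
  by (simp add: mfact_def)

lemma mfact_Suc: "mfact (Poly_Mapping.single i 1 + m) = of_nat (Suc (Poly_Mapping.lookup m i)) * (mfact m :: 'a::field)"
proof -
  have eq: "mfact k = (of_nat (\<Prod>j\<in>insert i (Poly_Mapping.keys m). fact (Poly_Mapping.lookup k j)) :: 'a)"
    if "Poly_Mapping.keys k \<subseteq> insert i (Poly_Mapping.keys m)" for k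
    unfolding mfact_def using that
    by (intro arg_cong[where f = of_nat] prod.mono_neutral_left) (auto simp: in_keys_iff)
  have "(\<Prod>j\<in>insert i (Poly_Mapping.keys m). fact (Poly_Mapping.lookup (Poly_Mapping.single i 1 + m) j))
     = Suc (Poly_Mapping.lookup m i) * (\<Prod>j\<in>insert i (Poly_Mapping.keys m). fact (Poly_Mapping.lookup m j))"
    by (simp add: prod.insert_remove lookup_add lookup_single algebra_simps)
  moreover have "mfact (Poly_Mapping.single i 1 + m) = (of_nat (\<Prod>j\<in>insert i (Poly_Mapping.keys m).
      fact (Poly_Mapping.lookup (Poly_Mapping.single i 1 + m) j)) :: 'a)"
    by (rule eq) (auto simp: keys_add_nat)
  moreover have "mfact m = (of_nat (\<Prod>j\<in>insert i (Poly_Mapping.keys m). fact (Poly_Mapping.lookup m j)) :: 'a)"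
    by (rule eq) auto
  ultimately show ?thesis by (simp only: of_nat_mult)
qed

lemma pairing_eq:
  assumes "finite K" "Poly_Mapping.keys f \<subseteq> K"
  shows "pairing f s = (\<Sum>m\<in>K. Poly_Mapping.lookup f m * Poly_Mapping.lookup s m * mfact m)"
  unfolding pairing_def mfact_def using assms
  by (intro sum.mono_neutral_left) (auto simp: in_keys_iff)

lemma pairing_commute: "pairing f s = pairing s f"
proof -
  let ?K = "Poly_Mapping.keys f \<union> Poly_Mapping.keys s"
  show ?thesis by (simp add: pairing_eq[of ?K] mult.commute)
qed

lemma pairing_add_left: "pairing (f + g) s = pairing f s + pairing g s"
proof -
  let ?K = "Poly_Mapping.keys f \<union> Poly_Mapping.keys g"
  have "Poly_Mapping.keys (f + g) \<subseteq> ?K" by (rule keys_add)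
  then show ?thesis by (simp add: pairing_eq[of ?K] lookup_add distrib_right sum.distrib)
qed

lemma pairing_add_right: "pairing s (f + g) = pairing s f + pairing s g"
  by (metis pairing_add_left pairing_commute)

lemma pairing_0_left [simp]: "pairing 0 s = 0"
  by (simp add: pairing_def)

lemma pairing_0_right [simp]: "pairing s 0 = 0"
  by (simp add: pairing_def)

lemma pairing_pconst_mult_left: "pairing (pconst c * f) s = c * pairing f s"
proof -
  have "Poly_Mapping.keys (pconst c * f) \<subseteq> Poly_Mapping.keys f" by (auto simp: in_keys_iff)
  then show ?thesis
    by (simp add: pairing_eq[of "Poly_Mapping.keys f"] sum_distrib_left mult.assoc)
qed

lemma pairing_pconst_mult_right: "pairing s (pconst c * f) = c * pairing s f"
  by (metis pairing_pconst_mult_left pairing_commute)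

lemma pairing_sum_left: "pairing (sum f I) s = (\<Sum>i\<in>I. pairing (f i) s)"
  by (induction I rule: infinite_finite_induct) (auto simp: pairing_add_left)

lemma pairing_sum_right: "pairing s (sum f I) = (\<Sum>i\<in>I. pairing s (f i))"
  by (induction I rule: infinite_finite_induct) (auto simp: pairing_add_right)

lemma pairing_pmonom_left: "pairing (pmonom m) s = Poly_Mapping.lookup s m * mfact m"
  by (simp add: pairing_eq[of "{m}"] pmonom_def)

lemma pairing_pmonom_right: "pairing s (pmonom m) = Poly_Mapping.lookup s m * mfact m"
  by (metis pairing_pmonom_left pairing_commute)

lemma pairing_eqI:
  fixes f g :: "'a::field_char_0 mpoly"
  assumes "\<And>m. pairing f (pmonom m) = pairing g (pmonom m)"
  shows "f = g"
  using assms by (intro poly_mapping_eqI) (simp add: pairing_pmonom_right)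

lemma pairing_neq_0_ex:
  fixes f :: "'a::field_char_0 mpoly"
  assumes "f \<noteq> 0" "vars_in A f" "homogeneous d f"
  obtains m where "pairing f (pmonom m) \<noteq> 0" "Poly_Mapping.keys m \<subseteq> A" "tdeg m = d"
proof -
  obtain m where "Poly_Mapping.lookup f m \<noteq> 0"
    using assms(1) by (metis lookup_zero poly_mapping_eqI)
  then show ?thesis using that[of m] assms
    by (auto simp: pairing_pmonom_right vars_in_def homogeneous_def in_keys_iff)
qed

lemma pairing_hcomp:
  assumes "homogeneous d f"
  shows "pairing f (hcomp d s) = pairing f s"
  unfolding pairing_eq[OF finite_keys order.refl] using assms
  by (intro sum.cong) (auto simp: lookup_hcomp homogeneous_def)

section \<open>Differential operators as adjoints of multiplication\<close>

lemma pderiv_var_eq: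
  assumes "finite K" "Poly_Mapping.keys p \<subseteq> K"
  shows "pderiv_var i p = (\<Sum>m\<in>K.
      pconst (Poly_Mapping.lookup p m * of_nat (Poly_Mapping.lookup m i)) * pmonom (m - Poly_Mapping.single i 1))"
  unfolding pderiv_var_def using assms by (intro sum.mono_neutral_left) (auto simp: in_keys_iff)

lemma pderiv_var_add: "pderiv_var i (p + q) = pderiv_var i p + pderiv_var i q"
proof -
  let ?K = "Poly_Mapping.keys p \<union> Poly_Mapping.keys q"
  have "Poly_Mapping.keys (p + q) \<subseteq> ?K" by (rule keys_add)
  then show ?thesis
    by (simp add: pderiv_var_eq[of ?K] lookup_add distrib_right sum.distrib pconst_add)
qed

lemma pderiv_var_0 [simp]: "pderiv_var i 0 = 0"
  by (simp add: pderiv_var_def)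

lemma pderiv_var_single: "pderiv_var i (Poly_Mapping.single m c) =
    Poly_Mapping.single (m - Poly_Mapping.single i 1) (c * of_nat (Poly_Mapping.lookup m i))"
  by (subst pderiv_var_eq[of "{m}"]) (simp_all add: pconst_def pmonom_def mult_single)

lemma pderiv_var_sum: "pderiv_var i (sum f I) = (\<Sum>j\<in>I. pderiv_var i (f j))"
  by (induction I rule: infinite_finite_induct) (auto simp: pderiv_var_add)

lemma pderiv_var_pconst [simp]: "pderiv_var i (pconst c) = 0"
  by (simp add: pconst_def pderiv_var_single)

lemma pderiv_var_pconst_mult: "pderiv_var i (pconst c * p) = pconst c * pderiv_var i p"
proof (induction p rule: poly_mapping_add_induct)
  case (single m d) then show ?case by (simp add: pconst_def mult_single pderiv_var_single mult.assoc)
qed (simp_all add: pderiv_var_add distrib_left)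

lemma pairing_single_single:
  "pairing (Poly_Mapping.single m c) (Poly_Mapping.single m' c') = (if m = m' then c * c' * mfact m else 0)"
  by (auto simp: pairing_eq[of "{m}"] lookup_single when_def)

lemma keys_diff_nat: "Poly_Mapping.keys (m - k) \<subseteq> Poly_Mapping.keys (m :: nat \<Rightarrow>\<^sub>0 nat)"
  by (auto simp: in_keys_iff lookup_minus)

text \<open>On monomials both sides vanish unless the first is \<open>pvar i\<close> times the
  second; then the exponent brought down by the derivative is the quotient of the two factorial
  norms.\<close>

lemma pairing_pderiv_var: "pairing (pderiv_var i p) s = pairing p (pvar i * s)"
proof (induction p rule: poly_mapping_add_induct)
  case (single m c)
  show ?case
  proof (induction s rule: poly_mapping_add_induct)
    case (single m' c')
    show ?case
    proof (cases "i \<in> Poly_Mapping.keys m")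
      case True
      then obtain m'' where m'': "m = Poly_Mapping.single i 1 + m''" by (rule split_var)
      then have "m - Poly_Mapping.single i 1 = m''" by simp
      then show ?thesis
        using m'' by (simp add: pderiv_var_single pvar_def mult_single pairing_single_single lookup_add
            mfact_Suc[unfolded One_nat_def])
    next
      case False
      then have "m \<noteq> Poly_Mapping.single i (Suc 0) + m'" by (auto simp: keys_add_nat)
      moreover have "Poly_Mapping.lookup m i = 0" using False by (simp add: in_keys_iff)
      ultimately show ?thesis
        by (simp add: pderiv_var_single pvar_def mult_single pairing_single_single)
    qed
  qed (simp_all add: pairing_add_right distrib_left)
qed (simp_all add: pairing_add_left pderiv_var_add)

lemma pairing_diff_monom:
  fixes p :: "'a::field mpoly"
  shows "pairing (diff_monom b p) s = pairing p (pmonom b * s)"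
proof -
  have pow: "pairing ((pderiv_var i ^^ k) p) s = pairing p (pvar i ^ k * s)" for i k and p s :: "'a mpoly"
    by (induction k arbitrary: s) (simp_all add: pairing_pderiv_var algebra_simps)
  have fold: "pairing (foldr (\<lambda>i q. (pderiv_var i ^^ k i) q) xs p) s
      = pairing p ((\<Prod>i\<leftarrow>xs. pvar i ^ k i) * s)" for xs s k
    by (induction xs arbitrary: s) (simp_all add: pow algebra_simps)
  have "(\<Prod>i\<leftarrow>sorted_list_of_set (Poly_Mapping.keys b). (pvar i :: 'a mpoly) ^ Poly_Mapping.lookup b i)
      = monom_subst pvar b"
    unfolding monom_subst_def by (subst prod.distinct_set_conv_list[symmetric]) auto
  also have "\<dots> = pmonom b" by (metis subst_ident subst_pmonom vars_in_UNIV)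
  finally show ?thesis unfolding diff_monom_def fold by simp
qed

lemma mpoly_sum_monomials:
  "p = (\<Sum>b\<in>Poly_Mapping.keys p. pconst (Poly_Mapping.lookup p b) * pmonom b :: 'a::comm_semiring_1 mpoly)"
  by (rule poly_mapping_eqI) (auto simp: lookup_sum lookup_pmonom in_keys_iff if_distrib cong: if_cong)

text \<open>As the pairing is nondegenerate, this adjunction determines \<open>diff_op\<close>. The
  algebraic identities that follow are checked by pairing with monomials instead of computing
  iterated derivatives.\<close>

lemma pairing_diff_op: "pairing (diff_op s p) t = pairing p (s * t)"
proof -
  have "s * t = (\<Sum>b\<in>Poly_Mapping.keys s. pconst (Poly_Mapping.lookup s b) * (pmonom b * t))"
    by (subst mpoly_sum_monomials[of s]) (simp add: sum_distrib_right mult.assoc)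
  then show ?thesis
    unfolding diff_op_def
    by (simp add: pairing_sum_left pairing_sum_right pairing_pconst_mult_left pairing_pconst_mult_right
        pairing_diff_monom)
qed

context
  fixes p q :: "'a::field_char_0 mpoly"
begin

lemma diff_op_mult: "diff_op (s * t) p = diff_op s (diff_op t p)"
  by (rule pairing_eqI) (simp add: pairing_diff_op algebra_simps)

lemma diff_op_pconst_mult: "diff_op (pconst c * s) p = pconst c * diff_op s p"
  by (rule pairing_eqI) (simp add: pairing_diff_op pairing_pconst_mult_left pairing_pconst_mult_right mult.assoc)

lemma diff_op_0 [simp]: "diff_op 0 p = 0"
  by (rule pairing_eqI) (simp add: pairing_diff_op)

lemma diff_op_1 [simp]: "diff_op 1 p = p"
  by (rule pairing_eqI) (simp add: pairing_diff_op)

lemma diff_op_sum: "diff_op (sum f I) p = (\<Sum>i\<in>I. diff_op (f i) p)"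
  by (rule pairing_eqI) (simp add: pairing_diff_op pairing_sum_left pairing_sum_right sum_distrib_right)

lemma diff_op_pconst_mult_right: "diff_op s (pconst c * p) = pconst c * diff_op s p"
  by (rule pairing_eqI) (simp add: pairing_diff_op pairing_pconst_mult_left)

lemma diff_op_0_right [simp]: "diff_op s (0 :: 'a mpoly) = 0"
  by (rule pairing_eqI) (simp add: pairing_diff_op)

text \<open>Up to the factor \<open>mfact m\<close>, the coefficient of \<open>pmonom m\<close> in
  \<open>diff_op s p\<close> is the pairing of \<open>p\<close> with \<open>s * pmonom m\<close>.
  This controls both the variables and the degree of the result.\<close>

lemma lookup_diff_op_ex:
  assumes "m \<in> Poly_Mapping.keys (diff_op s p)"
  obtains a where "a \<in> Poly_Mapping.keys s" "a + m \<in> Poly_Mapping.keys p"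
proof -
  have "pairing p (s * pmonom m) \<noteq> 0"
    using assms by (simp add: pairing_pmonom_right in_keys_iff flip: pairing_diff_op)
  then obtain m' where m': "m' \<in> Poly_Mapping.keys p" "Poly_Mapping.lookup (s * pmonom m) m' \<noteq> 0"
    unfolding pairing_eq[OF finite_keys order.refl]
    by (metis (no_types, lifting) mult_eq_0_iff sum.neutral)
  then obtain a where "a \<in> Poly_Mapping.keys s" "m' = a + m"
    using keys_mult[of s "pmonom m"] by (auto simp: pmonom_def in_keys_iff subset_iff)
  then show ?thesis using that m' by blast
qed

lemma vars_in_diff_op: "vars_in A p \<Longrightarrow> vars_in A (diff_op s p)"
  unfolding vars_in_def by (metis keys_add_nat le_sup_iff lookup_diff_op_ex)

text \<open>The truncated \<open>d - e\<close> is harmless: for \<open>d < e\<close> the result is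
  \<open>0\<close> by \<open>diff_op_eq_0\<close>.\<close>

lemma homogeneous_diff_op:
  "homogeneous d p \<Longrightarrow> homogeneous e s \<Longrightarrow> homogeneous (d - e) (diff_op s p)"
  by (force simp: homogeneous_def tdeg_add elim!: lookup_diff_op_ex)

lemma diff_op_eq_0:
  assumes "homogeneous d p" "homogeneous e s" "d < e"
  shows "diff_op s p = 0"
proof -
  have "m \<notin> Poly_Mapping.keys (diff_op s p)" for m
    using assms by (auto simp: homogeneous_def tdeg_add elim!: lookup_diff_op_ex)
  then show ?thesis by (metis ex_in_conv keys_eq_empty in_keys_iff lookup_zero poly_mapping_eqI)
qed

end

lemma pderiv_var_pvar_mult:
  "pderiv_var i (pvar c * s) = (if i = c then s else 0) + pvar c * pderiv_var i s"
proof (induction s rule: poly_mapping_add_induct)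
  case (single m k)
  show ?case
  proof (cases "i \<in> Poly_Mapping.keys m")
    case True
    then obtain m' where m': "m = Poly_Mapping.single i 1 + m'" by (rule split_var)
    have "Poly_Mapping.single c 1 + m - Poly_Mapping.single i 1 = Poly_Mapping.single c 1 + m'"
      unfolding m' by (rule poly_mapping_eqI) (simp add: lookup_add lookup_minus)
    moreover have "m - Poly_Mapping.single i 1 = m'" using m' by simp
    ultimately show ?thesis
      using m' by (auto simp: pvar_def mult_single pderiv_var_single lookup_add lookup_single single_add[symmetric] distrib_left)
  next
    case False
    then have "Poly_Mapping.lookup m i = 0" by (simp add: in_keys_iff)
    then show ?thesis
      by (auto simp: pvar_def mult_single pderiv_var_single lookup_add lookup_single when_def)
  qed
qed (auto simp: pderiv_var_add distrib_left)

lemma lookup_0_pvar_mult: "Poly_Mapping.lookup (pvar i * p) 0 = (0 :: 'a::comm_semiring_1)"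
proof -
  have "(0 :: nat \<Rightarrow>\<^sub>0 nat) \<noteq> Poly_Mapping.single i 1 + m" for m
    by (metis add_is_0 lookup_add lookup_single_eq lookup_zero one_neq_zero)
  then show ?thesis unfolding pvar_eq_pmonom by (rule lookup_pmonom_mult_0)
qed

section \<open>Adjoint of a linear substitution\<close>

context
  fixes A C :: "nat set" and l :: "nat \<Rightarrow> nat \<Rightarrow> 'a::field" and L L'
  assumes fin: "finite A" "finite C"
    and L_def: "\<And>i. L i = (\<Sum>c\<in>C. pconst (l i c) * pvar c)"
    and L'_def: "\<And>c. L' c = (\<Sum>i\<in>A. pconst (l i c) * pvar i)"
begin

lemma lookup_0_subst_transpose: "Poly_Mapping.lookup (subst L' s) 0 = Poly_Mapping.lookup s 0"
  by (induction s rule: mpoly_induct)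
     (simp_all add: subst_mult subst_add L'_def sum_distrib_right lookup_sum lookup_add mult.assoc
       lookup_0_pvar_mult)

lemma pderiv_var_subst_transpose:
  assumes "i \<in> A" "vars_in C s"
  shows "pderiv_var i (subst L' s) = (\<Sum>c\<in>C. pconst (l i c) * subst L' (pderiv_var c s))"
  using assms(2)
proof (induction s rule: vars_in_induct)
  case (var c s)
  have "pderiv_var i (subst L' (pvar c * s))
      = (\<Sum>j\<in>A. (if i = j then pconst (l j c) * subst L' s else 0)
          + pconst (l j c) * (pvar j * pderiv_var i (subst L' s)))"
    by (simp add: subst_mult)
       (auto simp: L'_def sum_distrib_right pderiv_var_sum mult.assoc pderiv_var_pconst_mult
        pderiv_var_pvar_mult distrib_left intro!: sum.cong)
  also have "\<dots> = pconst (l i c) * subst L' s + L' c * pderiv_var i (subst L' s)"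
    using assms(1) fin by (simp add: sum.distrib) (simp add: L'_def sum_distrib_right mult.assoc)
  also have "\<dots> = (\<Sum>c'\<in>C. pconst (l i c') * subst L' (pderiv_var c' (pvar c * s)))"
    using var fin by (simp add: pderiv_var_pvar_mult subst_add subst_mult distrib_left sum.distrib
        sum_distrib_left if_distrib[of "subst L'"] if_distrib[of "\<lambda>x. _ * x"] mult.left_commute cong: if_cong)
  finally show ?case .
qed (simp_all add: subst_add pderiv_var_add distrib_left sum.distrib)

text \<open>\<open>L\<close> and \<open>L'\<close> have mutually transposed matrices. A variable
  crosses the pairing as a derivative, to which the chain rule
  \<open>pderiv_var_subst_transpose\<close> applies. The square case serves the group elements, the
  rectangular case the embedding into the permutation module.\<close>

lemma pairing_subst:
  assumes "vars_in A f" "vars_in C s"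
  shows "pairing (subst L f) s = pairing f (subst L' s)"
  using assms
proof (induction f arbitrary: s rule: vars_in_induct)
  case (const a)
  have "pairing (pconst a) t = a * Poly_Mapping.lookup t 0" for t
    by (simp add: pairing_eq[of "{0}"] pconst_def mfact_def)
  then show ?case by (simp add: lookup_0_subst_transpose)
next
  case (var i f)
  have vd: "vars_in C (pderiv_var c s)" for c
    using var.prems unfolding pderiv_var_def
    by (intro vars_in_sum vars_in_mult vars_in_pconst vars_in_pmonom)
       (meson keys_diff_nat order_trans vars_in_def)
  have "pairing (subst L (pvar i * f)) s = (\<Sum>c\<in>C. l i c * pairing (pvar c * subst L f) s)"
    by (simp add: subst_mult L_def sum_distrib_right pairing_sum_left mult.assoc pairing_pconst_mult_left)
  also have "\<dots> = (\<Sum>c\<in>C. l i c * pairing (subst L f) (pderiv_var c s))"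
    by (metis pairing_commute pairing_pderiv_var)
  also have "\<dots> = pairing f (pderiv_var i (subst L' s))"
    using var vd by (simp add: pderiv_var_subst_transpose pairing_sum_right pairing_pconst_mult_right)
  also have "\<dots> = pairing (pvar i * f) (subst L' s)" by (metis pairing_commute pairing_pderiv_var)
  finally show ?case .
qed (simp add: subst_add pairing_add_left)

end

section \<open>Positivity over the rationals\<close>

lemma ex_rat_functional:
  fixes x :: "'a::field_char_0"
  assumes "x \<noteq> 0"
  obtains \<phi> :: "'a \<Rightarrow> rat"
  where "\<And>a b. \<phi> (a + b) = \<phi> a + \<phi> b" "\<And>q a. \<phi> (of_rat q * a) = q * \<phi> a" "\<phi> x \<noteq> 0"
proof -
  interpret vector_space_pair "\<lambda>q (a::'a). of_rat q * a" "(*) :: rat \<Rightarrow> _"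
    by unfold_locales (simp_all add: algebra_simps of_rat_add of_rat_mult)
  have "vs1.independent {x}" using assms by simp
  then obtain g where g: "Vector_Spaces.linear (\<lambda>q (a::'a). of_rat q * a) ((*) :: rat \<Rightarrow> _) g" "g x = 1"
    using linear_independent_extend[of "{x}" "\<lambda>_. 1"] by auto
  interpret g: Vector_Spaces.linear "\<lambda>q (a::'a). of_rat q * a" "(*) :: rat \<Rightarrow> _" g by fact
  show ?thesis by (rule that[of g]) (simp_all add: g.add g.scale g(2))
qed

text \<open>The pairing is anisotropic over \<open>\<rat>\<close>; a \<open>\<rat>\<close>-linear functional on the field transfers this to
  all spans of rational polynomials.\<close>

lemma rational_span_anisotropic:
  fixes f :: "'a::field_char_0 mpoly"
  assumes K: "finite K" and u: "\<And>k m. k \<in> K \<Longrightarrow> Poly_Mapping.lookup (u k) m \<in> \<rat>"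
    and f: "f = (\<Sum>k\<in>K. pconst (c k) * u k)" and orth: "\<And>k. k \<in> K \<Longrightarrow> pairing f (u k) = 0"
  shows "f = 0"
proof (rule ccontr)
  assume "f \<noteq> 0"
  then obtain m0 where m0: "Poly_Mapping.lookup f m0 \<noteq> 0" by (metis lookup_zero poly_mapping_eqI)
  obtain \<phi> :: "'a \<Rightarrow> rat" where \<phi>: "\<And>a b. \<phi> (a + b) = \<phi> a + \<phi> b" "\<And>q a. \<phi> (of_rat q * a) = q * \<phi> a"
    "\<phi> (Poly_Mapping.lookup f m0) \<noteq> 0"
    using ex_rat_functional[OF m0] by blast
  interpret \<phi>: additive \<phi> by unfold_locales (rule \<phi>(1))
  obtain r where r: "\<And>k m. k \<in> K \<Longrightarrow> Poly_Mapping.lookup (u k) m = of_rat (r k m)"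
    using u unfolding Rats_def image_iff by metis
  let ?M = "Poly_Mapping.keys f"
  let ?w = "\<lambda>m :: nat \<Rightarrow>\<^sub>0 nat. rat_of_nat (\<Prod>i\<in>Poly_Mapping.keys m. fact (Poly_Mapping.lookup m i))"
  let ?g = "\<lambda>m. \<phi> (Poly_Mapping.lookup f m)"
  \<comment> \<open>Applying \<phi> to the coefficients of \<open>f\<close> again gives a
    combination of the \<open>u k\<close>, now with the rational scalars
    \<open>\<phi> (c k)\<close>.\<close>
  have g: "?g m = (\<Sum>k\<in>K. \<phi> (c k) * r k m)" for m
  proof -
    have "\<phi> (c k * of_rat q) = \<phi> (c k) * q" for k q using \<phi>(2)[of q "c k"] by (simp add: mult.commute)
    then show ?thesis by (subst f) (simp add: lookup_sum \<phi>.sum r)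
  qed
  have orth': "(\<Sum>m\<in>?M. ?g m * r k m * ?w m) = 0" if "k \<in> K" for k
  proof -
    have "pairing f (u k) = (\<Sum>m\<in>?M. of_rat (r k m * ?w m) * Poly_Mapping.lookup f m)"
      unfolding pairing_def of_rat_mult of_rat_of_nat_eq r[OF that] by (simp only: mult_ac)
    then have "0 = \<phi> (\<Sum>m\<in>?M. of_rat (r k m * ?w m) * Poly_Mapping.lookup f m)"
      using orth[OF that] \<phi>.zero by simp
    also have "\<dots> = (\<Sum>m\<in>?M. ?g m * r k m * ?w m)"
      unfolding \<phi>.sum \<phi>(2) by (simp add: mult_ac)
    finally show ?thesis by simp
  qed
  \<comment> \<open>The norm of that image: a sum of squares with positive weights, and zero because
    the image is orthogonal to every \<open>u k\<close>.\<close>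
  have "(\<Sum>m\<in>?M. ?g m * ?g m * ?w m) = (\<Sum>m\<in>?M. \<Sum>k\<in>K. \<phi> (c k) * (?g m * r k m * ?w m))"
    by (intro sum.cong refl, subst (2) g) (simp add: sum_distrib_left sum_distrib_right mult_ac)
  also have "\<dots> = (\<Sum>k\<in>K. \<phi> (c k) * (\<Sum>m\<in>?M. ?g m * r k m * ?w m))"
    by (subst sum.swap) (simp add: sum_distrib_left)
  also have "\<dots> = 0" using orth' by (intro sum.neutral ballI) (simp only: mult_zero_right)
  finally have "\<forall>m\<in>?M. ?g m * ?g m * ?w m = 0"
    by (subst (asm) sum_nonneg_eq_0_iff) (auto intro!: mult_nonneg_nonneg zero_le_square prod_nonneg)
  moreover have "?w m0 \<noteq> 0" by simp
  ultimately show False using \<phi>(3) m0 by (auto simp: in_keys_iff)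
qed

subsection \<open>Linear relations over domains\<close>

text \<open>Gaussian elimination without division: for a pivot \<open>w p j\<close>, the vector
  \<open>w i\<close> is replaced by \<open>w p j\<close> times itself minus \<open>w i j\<close>
  times \<open>w p\<close>. Staying inside \<open>R\<close> keeps the coefficients among the
  polynomials in the first \<open>n\<close> variables; over the field, \<open>R\<close> is
  everything.\<close>

lemma ex_linear_relation:
  fixes w :: "'i \<Rightarrow> 'j \<Rightarrow> 'b::idom"
  assumes R: "1 \<in> R" "\<And>a b. a \<in> R \<Longrightarrow> b \<in> R \<Longrightarrow> a + b \<in> R" "\<And>a. a \<in> R \<Longrightarrow> - a \<in> R"
      "\<And>a b. a \<in> R \<Longrightarrow> b \<in> R \<Longrightarrow> a * b \<in> R"
    and "finite J" "finite I" "card J < card I" "\<And>i j. i \<in> I \<Longrightarrow> j \<in> J \<Longrightarrow> w i j \<in> R"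
  shows "\<exists>a. (\<forall>i\<in>I. a i \<in> R) \<and> (\<exists>i\<in>I. a i \<noteq> 0) \<and> (\<forall>j\<in>J. (\<Sum>i\<in>I. a i * w i j) = 0)"
  using assms(5-)
proof (induction J arbitrary: I w rule: finite_induct)
  case empty
  then have "I \<noteq> {}" by auto
  then show ?case using R(1) by (intro exI[of _ "\<lambda>_. 1"]) auto
next
  case (insert j J)
  have zero: "0 \<in> R" using R(2)[OF R(1) R(3)[OF R(1)]] by simp
  have sum: "sum f A \<in> R" if "\<And>i. i \<in> A \<Longrightarrow> f i \<in> R" for f :: "'i \<Rightarrow> 'b" and A
    using that by (induction A rule: infinite_finite_induct) (auto intro: zero R(2))
  have diff: "a - b \<in> R" if "a \<in> R" "b \<in> R" for a b
    using R(2)[OF that(1) R(3)[OF that(2)]] by simp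
  show ?case
  proof (cases "\<forall>i\<in>I. w i j = 0")
    case True
    have "\<exists>a. (\<forall>i\<in>I. a i \<in> R) \<and> (\<exists>i\<in>I. a i \<noteq> 0) \<and> (\<forall>j\<in>J. (\<Sum>i\<in>I. a i * w i j) = 0)"
      using insert by (intro insert.IH) auto
    then show ?thesis using True by auto
  next
    case False
    then obtain p where p: "p \<in> I" "w p j \<noteq> 0" by auto
    let ?I = "I - {p}"
    have "\<exists>b. (\<forall>i\<in>?I. b i \<in> R) \<and> (\<exists>i\<in>?I. b i \<noteq> 0) \<and>
        (\<forall>k\<in>J. (\<Sum>i\<in>?I. b i * (w p j * w i k - w i j * w p k)) = 0)"
      using insert.prems p insert.hyps by (intro insert.IH) (auto intro!: diff R(4))
    then obtain b where b: "\<And>i. i \<in> ?I \<Longrightarrow> b i \<in> R" "\<exists>i\<in>?I. b i \<noteq> 0"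
        "\<And>k. k \<in> J \<Longrightarrow> (\<Sum>i\<in>?I. b i * (w p j * w i k - w i j * w p k)) = 0"
      by auto
    let ?a = "\<lambda>i. if i = p then - (\<Sum>i\<in>?I. b i * w i j) else w p j * b i"
    have split: "(\<Sum>i\<in>I. ?a i * w i k) = - (\<Sum>i\<in>?I. b i * w i j) * w p k + (\<Sum>i\<in>?I. w p j * b i * w i k)" for k
      using p insert.prems by (subst sum.remove[of I p]) auto
    have "(\<Sum>i\<in>I. ?a i * w i k) = (\<Sum>i\<in>?I. b i * (w p j * w i k - w i j * w p k))" for k
      unfolding split by (simp add: sum_distrib_right sum_subtractf right_diff_distrib sum_distrib_left mult_ac)
    then have "\<forall>k\<in>insert j J. (\<Sum>i\<in>I. ?a i * w i k) = 0"
      using b(3) by (auto simp: mult.commute)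
    moreover have "\<forall>i\<in>I. ?a i \<in> R"
      using b(1) insert.prems p by (auto intro!: R(3) sum R(4))
    moreover have "\<exists>i\<in>I. ?a i \<noteq> 0" using b(2) p by auto
    ultimately show ?thesis by (intro exI[of _ ?a] conjI)
  qed
qed

subsection \<open>Finite matrix groups acting on polynomials\<close>

locale matrix_group =
  fixes n :: nat and G :: "'a::field_char_0 mat set"
  assumes mat_group: "mat_group n G"
begin

lemma finite_G [simp]: "finite G"
  and carrier_G: "g \<in> G \<Longrightarrow> g \<in> carrier_mat n n"
  and one_G [simp]: "1\<^sub>m n \<in> G"
  and mult_G [simp]: "g \<in> G \<Longrightarrow> h \<in> G \<Longrightarrow> g * h \<in> G"
  using mat_group by (auto simp: mat_group_def)

lemma G_nonempty [simp]: "G \<noteq> {}"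
  using one_G by blast

lemma card_G [simp]: "of_nat (card G) \<noteq> (0 :: 'b::field_char_0)"
  by (metis card_0_eq empty_iff finite_G of_nat_eq_0_iff one_G)

lemma dim_G [simp]: "g \<in> G \<Longrightarrow> dim_row g = n" "g \<in> G \<Longrightarrow> dim_col g = n"
  using carrier_G by auto

lemma right_inverse_imp_left_inverse:
  assumes "g \<in> G" "h \<in> G" "g * h = 1\<^sub>m n" shows "h * g = 1\<^sub>m n"
  using assms carrier_G mat_mult_left_right_inverse by blast

lemma ginv: assumes "g \<in> G"
  shows ginv_G [simp]: "ginv n G g \<in> G" and right_ginv [simp]: "g * ginv n G g = 1\<^sub>m n"
    and left_ginv [simp]: "ginv n G g * g = 1\<^sub>m n"
proof -
  obtain h where h: "h \<in> G" "g * h = 1\<^sub>m n" using mat_group assms by (auto simp: mat_group_def)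
  have "h' = h" if "h' \<in> G" "g * h' = 1\<^sub>m n" for h'
  proof -
    have "h' = (h * g) * h'" using right_inverse_imp_left_inverse[OF assms h] carrier_G that by simp
    also have "\<dots> = h * (g * h')" using that h assms carrier_G by (simp add: assoc_mult_mat[of _ n n _ n _ n])
    also have "\<dots> = h" using that h carrier_G by simp
    finally show ?thesis .
  qed
  then have "ginv n G g = h" unfolding ginv_def using h by blast
  then show "ginv n G g \<in> G" "g * ginv n G g = 1\<^sub>m n" "ginv n G g * g = 1\<^sub>m n"
    using h right_inverse_imp_left_inverse[OF assms] by auto
qed

lemma assoc_G: "a \<in> G \<Longrightarrow> b \<in> G \<Longrightarrow> c \<in> G \<Longrightarrow> a * b * c = a * (b * c)"
  using carrier_G by (simp add: assoc_mult_mat[of _ n n _ n _ n])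

lemma one_mult_G [simp]: "a \<in> G \<Longrightarrow> 1\<^sub>m n * a = a" "a \<in> G \<Longrightarrow> a * 1\<^sub>m n = a"
  using carrier_G by auto

lemma ginv_unique: "g \<in> G \<Longrightarrow> h \<in> G \<Longrightarrow> g * h = 1\<^sub>m n \<Longrightarrow> ginv n G g = h"
  by (metis assoc_G ginv_G left_ginv one_mult_G)

lemma ginv_one [simp]: "ginv n G (1\<^sub>m n) = 1\<^sub>m n"
  by (rule ginv_unique) auto

lemma ginv_ginv [simp]: "g \<in> G \<Longrightarrow> ginv n G (ginv n G g) = g"
  by (rule ginv_unique) auto

lemma ginv_mult: "g \<in> G \<Longrightarrow> h \<in> G \<Longrightarrow> ginv n G (g * h) = ginv n G h * ginv n G g"
  by (rule ginv_unique) (auto simp: assoc_G simp flip: assoc_G[of h])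

lemma bij_betw_mult_left: assumes "g \<in> G" shows "bij_betw (\<lambda>h. g * h) G G"
  using assms by (intro bij_betw_byWitness[where f' = "\<lambda>h. ginv n G g * h"])
    (auto simp flip: assoc_G)

lemma sum_mult_left: "g \<in> G \<Longrightarrow> (\<Sum>h\<in>G. f (g * h)) = (\<Sum>h\<in>G. f h)"
  by (rule sum.reindex_bij_betw[OF bij_betw_mult_left])

lemma prod_mult_left: "g \<in> G \<Longrightarrow> (\<Prod>h\<in>G. f (g * h)) = (\<Prod>h\<in>G. f h)"
  by (rule prod.reindex_bij_betw[OF bij_betw_mult_left])

lemma index_mult_G:
  "g \<in> G \<Longrightarrow> h \<in> G \<Longrightarrow> i < n \<Longrightarrow> j < n \<Longrightarrow> (g * h) $$ (i, j) = (\<Sum>k<n. g $$ (i, k) * h $$ (k, j))"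
  using carrier_G by (simp add: scalar_prod_def lessThan_atLeast0)

end

text \<open>What the actions on \<open>S(V)\<close> and on its dual counterpart share, so that
  invariants, their ideal and averaging are developed once. The group law is asked only of
  polynomials in the first \<open>n\<close> variables, since beyond them the substitutions read
  matrix entries out of range.\<close>

locale poly_action = matrix_group n G
  for n :: nat and G :: "'a::field_char_0 mat set" +
  fixes act :: "'a mat \<Rightarrow> 'a mpoly \<Rightarrow> 'a mpoly"
  assumes act_add: "act g (p + q) = act g p + act g q"
    and act_mult: "act g (p * q) = act g p * act g q"
    and act_pconst [simp]: "act g (pconst c) = pconst c"
    and poly_in_act: "g \<in> G \<Longrightarrow> poly_in n p \<Longrightarrow> poly_in n (act g p)"
    and hcomp_act: "g \<in> G \<Longrightarrow> poly_in n p \<Longrightarrow> hcomp d (act g p) = act g (hcomp d p)"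
    and act_act: "g \<in> G \<Longrightarrow> h \<in> G \<Longrightarrow> poly_in n p \<Longrightarrow> act g (act h p) = act (g * h) p"
    and act_one: "poly_in n p \<Longrightarrow> act (1\<^sub>m n) p = p"
begin

lemma act_0 [simp]: "act g 0 = 0"
  using act_pconst[of g 0] by simp

lemma act_1 [simp]: "act g 1 = 1"
  using act_pconst[of g 1] by simp

lemma act_minus: "act g (- p) = - act g p"
  using act_add[of g p "- p"] by (simp add: eq_neg_iff_add_eq_0 add.commute)

lemma act_diff: "act g (p - q) = act g p - act g q"
  using act_add[of g p "- q"] by (simp add: act_minus)

lemma act_sum: "act g (sum f I) = (\<Sum>i\<in>I. act g (f i))"
  by (induction I rule: infinite_finite_induct) (auto simp: act_add)

lemma act_prod: "act g (prod f I) = (\<Prod>i\<in>I. act g (f i))"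
  by (induction I rule: infinite_finite_induct) (auto simp: act_mult)

lemma act_ginv_act: "g \<in> G \<Longrightarrow> poly_in n p \<Longrightarrow> act (ginv n G g) (act g p) = p"
  by (simp add: act_act act_one)

lemma act_eq_0: "g \<in> G \<Longrightarrow> poly_in n p \<Longrightarrow> act g p = 0 \<Longrightarrow> p = 0"
  by (metis act_ginv_act act_0)

lemma homogeneous_act: "g \<in> G \<Longrightarrow> poly_in n p \<Longrightarrow> homogeneous d p \<Longrightarrow> homogeneous d (act g p)"
  by (metis hcomp_act hcomp_homogeneous homogeneous_hcomp)

definition pinv :: "'a mpoly set" where
  "pinv = {f. poly_in n f \<and> (\<forall>g\<in>G. act g f = f)}"

definition pideal :: "'a mpoly set" where
  "pideal = {(\<Sum>k<N. a k * h k) | (N::nat) a h. \<forall>k<N. poly_in n (a k) \<and> h k \<in> pinv \<and>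
        (\<exists>d>0. homogeneous d (h k))}"

lemma pinv_poly_in: "f \<in> pinv \<Longrightarrow> poly_in n f"
  by (simp add: pinv_def)

lemma pinv_act: "f \<in> pinv \<Longrightarrow> g \<in> G \<Longrightarrow> act g f = f"
  by (simp add: pinv_def)

lemma pinv_pconst [simp]: "pconst c \<in> pinv"
  by (simp add: pinv_def)

lemma pinv_0 [simp]: "0 \<in> pinv" and pinv_1 [simp]: "1 \<in> pinv"
  by (simp_all add: pinv_def)

lemma pinv_add: "f \<in> pinv \<Longrightarrow> h \<in> pinv \<Longrightarrow> f + h \<in> pinv"
  by (simp add: pinv_def act_add poly_in_add)

lemma pinv_diff: "f \<in> pinv \<Longrightarrow> h \<in> pinv \<Longrightarrow> f - h \<in> pinv"
  by (simp add: pinv_def act_diff poly_in_diff)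

lemma pinv_mult: "f \<in> pinv \<Longrightarrow> h \<in> pinv \<Longrightarrow> f * h \<in> pinv"
  by (simp add: pinv_def act_mult poly_in_mult)

lemma pinv_sum: "(\<And>i. i \<in> I \<Longrightarrow> f i \<in> pinv) \<Longrightarrow> sum f I \<in> pinv"
  by (induction I rule: infinite_finite_induct) (auto intro: pinv_add)

lemma pinv_hcomp: "f \<in> pinv \<Longrightarrow> hcomp d f \<in> pinv"
  by (auto simp: pinv_def poly_in_hcomp simp flip: hcomp_act)

lemma sum_act_pinv: "poly_in n f \<Longrightarrow> (\<Sum>g\<in>G. act g f) \<in> pinv"
  by (auto simp: pinv_def act_sum act_act sum_mult_left[where f = "\<lambda>g. act g f"]
      intro!: poly_in_sum poly_in_act)

lemma prod_act_pinv: "poly_in n f \<Longrightarrow> (\<Prod>g\<in>G. act g f) \<in> pinv"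
  by (auto simp: pinv_def act_prod act_act prod_mult_left[where f = "\<lambda>g. act g f"]
      intro!: poly_in_prod poly_in_act)

lemma pidealE:
  assumes "f \<in> pideal"
  obtains N :: nat and a h where "f = (\<Sum>k<N. a k * h k)"
    "\<forall>k<N. poly_in n (a k) \<and> h k \<in> pinv \<and> (\<exists>d>0. homogeneous d (h k))"
  using assms unfolding pideal_def by (elim CollectE exE conjE) (rule that)

lemma pideal_poly_in: "f \<in> pideal \<Longrightarrow> poly_in n f"
  by (auto simp: pideal_def intro!: poly_in_sum poly_in_mult dest: pinv_poly_in)

lemma pidealI: "poly_in n a \<Longrightarrow> h \<in> pinv \<Longrightarrow> homogeneous d h \<Longrightarrow> 0 < d \<Longrightarrow> a * h \<in> pideal"
  unfolding pideal_def by (intro CollectI exI[of _ "Suc 0"] exI[of _ "\<lambda>_. a"] exI[of _ "\<lambda>_. h"]) auto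

lemma pideal_0 [simp]: "0 \<in> pideal"
  unfolding pideal_def by (intro CollectI exI[of _ 0]) auto

lemma pideal_add:
  assumes "f \<in> pideal" "f' \<in> pideal" shows "f + f' \<in> pideal"
proof -
  obtain N :: nat and a h where f: "f = (\<Sum>k<N. a k * h k)"
      "\<forall>k<N. poly_in n (a k) \<and> h k \<in> pinv \<and> (\<exists>d>0. homogeneous d (h k))"
    by (rule pidealE[OF assms(1)])
  obtain N' :: nat and a' h' where f': "f' = (\<Sum>k<N'. a' k * h' k)"
      "\<forall>k<N'. poly_in n (a' k) \<and> h' k \<in> pinv \<and> (\<exists>d>0. homogeneous d (h' k))"
    by (rule pidealE[OF assms(2)])
  let ?c = "\<lambda>a a' k. if k < N then a k else a' (k - N)"
  have "(\<Sum>k<N + N'. ?c a a' k * ?c h h' k) = (\<Sum>k<N. ?c a a' k * ?c h h' k) + (\<Sum>k=N..<N + N'. ?c a a' k * ?c h h' k)"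
    by (subst sum.atLeastLessThan_concat[symmetric, of 0 N "N + N'", unfolded atLeast0LessThan]) auto
  also have "(\<Sum>k=N..<N + N'. ?c a a' k * ?c h h' k) = (\<Sum>k<N'. a' k * h' k)"
    by (rule sum.reindex_bij_witness[of _ "\<lambda>k. k + N" "\<lambda>k. k - N"]) auto
  finally have "f + f' = (\<Sum>k<N + N'. ?c a a' k * ?c h h' k)" using f f' by simp
  then show ?thesis
    using f(2) f'(2) unfolding pideal_def
    by (intro CollectI exI[of _ "N + N'"] exI[of _ "?c a a'"] exI[of _ "?c h h'"]) auto
qed

lemma pideal_sum: "(\<And>i. i \<in> I \<Longrightarrow> f i \<in> pideal) \<Longrightarrow> sum f I \<in> pideal"
  by (induction I rule: infinite_finite_induct) (auto intro: pideal_add)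

lemma pideal_induct [consumes 1, case_names base add]:
  assumes "f \<in> pideal" "\<And>a h d. poly_in n a \<Longrightarrow> h \<in> pinv \<Longrightarrow> homogeneous d h \<Longrightarrow> 0 < d \<Longrightarrow> P (a * h)"
    "\<And>f f'. P f \<Longrightarrow> P f' \<Longrightarrow> P (f + f')"
  shows "P f"
proof -
  obtain N :: nat and a h where f: "f = (\<Sum>k<N. a k * h k)"
      "\<forall>k<N. poly_in n (a k) \<and> h k \<in> pinv \<and> (\<exists>d>0. homogeneous d (h k))"
    by (rule pidealE[OF assms(1)])
  have "P 0" using assms(2)[of 0 0 1] by simp
  then have "P (\<Sum>k<M. a k * h k)" if "M \<le> N" for M
    using that
  proof (induction M)
    case (Suc M)
    then obtain d where "poly_in n (a M)" "h M \<in> pinv" "homogeneous d (h M)" "0 < d" using f(2) by (meson Suc_le_lessD)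
    then show ?case using Suc assms(2)[of "a M" "h M" d] by (auto intro: assms(3))
  qed simp
  then show ?thesis using f by auto
qed

lemma pideal_mult: "f \<in> pideal \<Longrightarrow> poly_in n b \<Longrightarrow> b * f \<in> pideal"
  by (induction f rule: pideal_induct)
     (auto simp: distrib_left mult.assoc[symmetric] intro: pideal_add pidealI poly_in_mult)

lemma pideal_pconst_mult: "f \<in> pideal \<Longrightarrow> pconst c * f \<in> pideal"
  by (simp add: pideal_mult)

lemma pideal_minus: "f \<in> pideal \<Longrightarrow> - f \<in> pideal"
  using pideal_pconst_mult[of f "- 1"] by (simp add: pconst_minus)

lemma pideal_diff: "f \<in> pideal \<Longrightarrow> f' \<in> pideal \<Longrightarrow> f - f' \<in> pideal"
  using pideal_add[of f "- f'"] pideal_minus[of f'] by simp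

lemma pideal_act: "f \<in> pideal \<Longrightarrow> g \<in> G \<Longrightarrow> act g f \<in> pideal"
  by (induction f rule: pideal_induct)
     (auto simp: act_add act_mult pinv_act intro: pideal_add pidealI poly_in_act)

text \<open>The ideal is graded because its generators are homogeneous.\<close>

lemma pideal_hcomp: "f \<in> pideal \<Longrightarrow> hcomp d f \<in> pideal"
  by (induction f rule: pideal_induct)
     (auto simp: hcomp_add hcomp_mult_homogeneous intro: pideal_add pidealI poly_in_hcomp)

lemma lookup_0_mult_homogeneous: 
  assumes "homogeneous d h" "0 < d" shows "Poly_Mapping.lookup (a * h :: 'a mpoly) 0 = 0"
proof -
  have "Poly_Mapping.lookup (a * h) 0 = Poly_Mapping.lookup (hcomp 0 (a * h)) 0" by (simp add: lookup_hcomp)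
  also have "\<dots> = 0" using hcomp_mult_homogeneous[OF assms(1), of 0 a] assms(2) by simp
  finally show ?thesis .
qed

lemma pideal_lookup_0: "f \<in> pideal \<Longrightarrow> Poly_Mapping.lookup f 0 = 0"
  by (induction f rule: pideal_induct) (auto simp: lookup_add intro: lookup_0_mult_homogeneous)

lemma pinv_homogeneous_pideal: "f \<in> pinv \<Longrightarrow> homogeneous d f \<Longrightarrow> 0 < d \<Longrightarrow> f \<in> pideal"
  using pidealI[of 1 f d] by simp

end

text \<open>The matrix of \<open>g\<close> with respect to the basis \<open>J\<close> is \<open>R g\<close>, acting on row vectors.\<close>

locale vec_action = poly_action n G act
  for n :: nat and G :: "'a::field_char_0 mat set" and act +
  fixes J :: "'j set" and R :: "'a mat \<Rightarrow> 'j \<Rightarrow> 'j \<Rightarrow> 'a"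
  assumes finite_J [simp]: "finite J"
    and R_mult: "g \<in> G \<Longrightarrow> h \<in> G \<Longrightarrow> j \<in> J \<Longrightarrow> k \<in> J \<Longrightarrow> R (g * h) j k = (\<Sum>l\<in>J. R h j l * R g l k)"
    and R_one: "j \<in> J \<Longrightarrow> k \<in> J \<Longrightarrow> R (1\<^sub>m n) j k = (if j = k then 1 else 0)"
    and R_outside: "g \<in> G \<Longrightarrow> j \<in> J \<Longrightarrow> k \<notin> J \<Longrightarrow> R g j k = 0"
begin

definition vact :: "'a mat \<Rightarrow> ('j \<Rightarrow> 'a mpoly) \<Rightarrow> 'j \<Rightarrow> 'a mpoly" where
  "vact g w = (\<lambda>k. \<Sum>j\<in>J. pconst (R g j k) * act g (w j))"

definition vok :: "('j \<Rightarrow> 'a mpoly) \<Rightarrow> bool" where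
  "vok w \<longleftrightarrow> (\<forall>j\<in>J. poly_in n (w j)) \<and> (\<forall>j. j \<notin> J \<longrightarrow> w j = 0)"

definition vinv :: "('j \<Rightarrow> 'a mpoly) set" where
  "vinv = {w. vok w \<and> (\<forall>g\<in>G. vact g w = w)}"

definition vavg :: "('j \<Rightarrow> 'a mpoly) \<Rightarrow> 'j \<Rightarrow> 'a mpoly" where
  "vavg w = (\<lambda>k. pconst (1 / of_nat (card G)) * (\<Sum>g\<in>G. vact g w k))"

lemma vok_poly_in: "vok w \<Longrightarrow> poly_in n (w j)"
  by (cases "j \<in> J") (auto simp: vok_def)

lemma vact_outside: "g \<in> G \<Longrightarrow> k \<notin> J \<Longrightarrow> vact g w k = 0"
  by (simp add: vact_def R_outside)

lemma vok_vact: "vok w \<Longrightarrow> g \<in> G \<Longrightarrow> vok (vact g w)"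
  unfolding vok_def by (auto simp: vact_outside) (auto simp: vact_def intro!: poly_in_sum poly_in_mult poly_in_act)

lemma vact_add: "vact g (\<lambda>j. w j + w' j) k = vact g w k + vact g w' k"
  by (simp add: vact_def act_add distrib_left sum.distrib)

lemma vact_mult: "vact g (\<lambda>j. a * w j) k = act g a * vact g w k"
  by (simp add: vact_def act_mult sum_distrib_left mult.left_commute)

lemma vact_sum: "vact g (\<lambda>j. \<Sum>i\<in>I. w i j) k = (\<Sum>i\<in>I. vact g (w i) k)"
  unfolding vact_def act_sum sum_distrib_left by (rule sum.swap)

lemma vact_vact: 
  assumes "g \<in> G" "h \<in> G" "vok w" shows "vact g (vact h w) = vact (g * h) w"
proof
  fix k
  show "vact g (vact h w) k = vact (g * h) w k"
  proof (cases "k \<in> J")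
    case True
    have "vact g (vact h w) k = (\<Sum>l\<in>J. \<Sum>j\<in>J. pconst (R h j l * R g l k) * act (g * h) (w j))"
      unfolding vact_def using assms
      by (simp add: act_sum act_mult act_act vok_poly_in sum_distrib_left pconst_mult mult_ac)
    also have "\<dots> = vact (g * h) w k"
      using assms True by (subst sum.swap) (simp add: vact_def R_mult pconst_sum sum_distrib_right)
    finally show ?thesis .
  qed (simp add: vact_outside assms)
qed

lemma vinv_vok: "w \<in> vinv \<Longrightarrow> vok w"
  by (simp add: vinv_def)

lemma vinv_vact: "w \<in> vinv \<Longrightarrow> g \<in> G \<Longrightarrow> vact g w = w"
  by (simp add: vinv_def)

lemma vinv_mult: "a \<in> pinv \<Longrightarrow> w \<in> vinv \<Longrightarrow> (\<lambda>j. a * w j) \<in> vinv"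
  by (auto simp: vinv_def vok_def vact_mult pinv_act intro!: poly_in_mult dest: pinv_poly_in)

lemma vinv_sum: "(\<And>i. i \<in> I \<Longrightarrow> w i \<in> vinv) \<Longrightarrow> (\<lambda>j. \<Sum>i\<in>I. w i j) \<in> vinv"
  by (auto simp: vinv_def vok_def vact_sum intro!: poly_in_sum sum.neutral)

lemma vinv_hcomp: assumes "w \<in> vinv" shows "(\<lambda>j. hcomp d (w j)) \<in> vinv"
proof -
  have "vact g (\<lambda>j. hcomp d (w j)) k = hcomp d (vact g w k)" if "g \<in> G" for g k
    unfolding vact_def hcomp_sum
    using that assms by (intro sum.cong refl)
      (simp add: hcomp_homogeneous_mult[OF homogeneous_pconst] hcomp_act vok_poly_in[OF vinv_vok])
  then show ?thesis using assms by (auto simp: vinv_def vok_def intro: poly_in_hcomp)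
qed

lemma vavg_vinv: assumes "vok w" shows "vavg w \<in> vinv"
proof -
  have "vact h (vavg w) k = vavg w k" if "h \<in> G" for h k
    unfolding vavg_def using that assms
    by (simp add: vact_mult vact_sum vact_vact sum_mult_left[where f = "\<lambda>g. vact g w k"])
  then show ?thesis
    using vok_vact[OF assms] by (auto simp: vinv_def) (auto simp: vok_def vavg_def intro!: poly_in_mult poly_in_sum)
qed

lemma vavg_vinv_eq: "w \<in> vinv \<Longrightarrow> vavg w = w"
  by (rule ext) (simp add: vavg_def vinv_vact mult.assoc[symmetric] pconst_mult[symmetric]
      flip: pconst_of_nat)

lemma vavg_sum: "vavg (\<lambda>j. \<Sum>i\<in>I. w i j) k = (\<Sum>i\<in>I. vavg (w i) k)"
  unfolding vavg_def vact_sum by (subst sum.swap) (simp add: sum_distrib_left)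

lemma vavg_mult: "a \<in> pinv \<Longrightarrow> vavg (\<lambda>j. a * w j) k = a * vavg w k"
  by (simp add: vavg_def vact_mult pinv_act sum_distrib_left mult.left_commute)

lemma vact_pideal: "(\<And>j. w j \<in> pideal) \<Longrightarrow> g \<in> G \<Longrightarrow> vact g w k \<in> pideal"
  unfolding vact_def by (intro pideal_sum pideal_pconst_mult pideal_act) auto

text \<open>A relation with \<open>a i0 \<noteq> 0\<close> becomes a relation with invariant coefficients after multiplication by
  the remaining factors of the norm of \<open>a i0\<close> and averaging.\<close>

lemma vinv_independent:
  assumes w: "\<And>i. i \<in> I \<Longrightarrow> w i \<in> vinv"
    and indep: "\<And>h. (\<And>i. i \<in> I \<Longrightarrow> h i \<in> pinv) \<Longrightarrow> (\<And>j. (\<Sum>i\<in>I. h i * w i j) = 0) \<Longrightarrow> \<forall>i\<in>I. h i = 0"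
    and a: "\<And>i. i \<in> I \<Longrightarrow> poly_in n (a i)" and rel: "\<And>j. j \<in> J \<Longrightarrow> (\<Sum>i\<in>I. a i * w i j) = 0"
  shows "\<forall>i\<in>I. a i = 0"
proof (rule ccontr)
  assume "\<not> ?thesis"
  then obtain i0 where i0: "i0 \<in> I" "a i0 \<noteq> 0" by auto
  define b where "b = (\<Prod>g\<in>G - {1\<^sub>m n}. act g (a i0))"
  define N where "N = (\<Prod>g\<in>G. act g (a i0))"
  have b: "poly_in n b" unfolding b_def using a[OF i0(1)] by (auto intro!: poly_in_prod poly_in_act)
  have N: "N = b * a i0"
    unfolding N_def b_def using a[OF i0(1)] by (subst prod.remove[of G "1\<^sub>m n"]) (auto simp: act_one)
  have Ninv: "N \<in> pinv" unfolding N_def by (rule prod_act_pinv[OF a[OF i0(1)]])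
  have "N \<noteq> 0" unfolding N_def using act_eq_0[OF _ a[OF i0(1)]] i0(2) by auto
  let ?h = "\<lambda>i. \<Sum>g\<in>G. act g (b * a i)"
  have rel': "(\<Sum>i\<in>I. a i * w i j) = 0" for j
    using rel[of j] w by (cases "j \<in> J") (auto simp: vinv_def vok_def)
  have "(\<Sum>i\<in>I. act g (b * a i) * w i j) = 0" if "g \<in> G" for g j
  proof -
    have "(\<Sum>i\<in>I. act g (b * a i) * w i j) = (\<Sum>i\<in>I. vact g (\<lambda>j. (b * a i) * w i j) j)"
      using w that by (simp add: vact_mult vinv_vact)
    also have "\<dots> = vact g (\<lambda>j. b * (\<Sum>i\<in>I. a i * w i j)) j"
      by (simp add: vact_sum[symmetric] sum_distrib_left mult.assoc)
    also have "\<dots> = 0" by (simp add: rel' vact_def)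
    finally show ?thesis .
  qed
  then have "(\<Sum>i\<in>I. ?h i * w i j) = 0" for j
    by (simp add: sum_distrib_right) (subst sum.swap, simp)
  then have "?h i0 = 0" using indep[of ?h] i0 a b by (auto intro!: sum_act_pinv poly_in_mult)
  moreover have "?h i0 = of_nat (card G) * N"
    using pinv_act[OF Ninv] by (simp add: N[symmetric])
  ultimately show False using \<open>N \<noteq> 0\<close> by simp
qed

text \<open>More than \<open>card J\<close> vectors indexed by \<open>J\<close> are dependent over
  the polynomials, and \<open>vinv_independent\<close> excludes this for invariant vectors that are
  independent over the invariants.\<close>

lemma card_le_vinv_independent:
  assumes "finite I" and w: "\<And>i. i \<in> I \<Longrightarrow> w i \<in> vinv"
    and indep: "\<And>h. (\<And>i. i \<in> I \<Longrightarrow> h i \<in> pinv) \<Longrightarrow> (\<And>j. (\<Sum>i\<in>I. h i * w i j) = 0) \<Longrightarrow> \<forall>i\<in>I. h i = 0"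
  shows "card I \<le> card J"
proof (rule ccontr)
  assume "\<not> ?thesis"
  then have "\<exists>a. (\<forall>i\<in>I. a i \<in> Collect (poly_in n)) \<and> (\<exists>i\<in>I. a i \<noteq> 0) \<and> (\<forall>j\<in>J. (\<Sum>i\<in>I. a i * w i j) = 0)"
    using assms(1) w by (intro ex_linear_relation)
      (auto intro: poly_in_add poly_in_mult poly_in_minus vok_poly_in vinv_vok)
  then obtain a where a: "\<And>i. i \<in> I \<Longrightarrow> poly_in n (a i)" "\<exists>i\<in>I. a i \<noteq> 0"
      "\<And>j. j \<in> J \<Longrightarrow> (\<Sum>i\<in>I. a i * w i j) = 0" by auto
  then show False using vinv_independent[where I = I and w = w and a = a] w indep by blast
qed

end

text \<open>By the product rule for differences, divisibility by \<open>p\<close> has to be checked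
  on the variables only. With the identity and a pseudo-reflection as the two substitutions this
  produces divided differences.\<close>

lemma subst_diff_factor:
  assumes "vars_in A f"
    and "\<And>i. i \<in> A \<Longrightarrow> vars_in A (L i)" "\<And>i. i \<in> A \<Longrightarrow> vars_in A (L' i)"
    and "\<And>i. i \<in> A \<Longrightarrow> \<exists>q. vars_in A q \<and> L i - L' i = p * q"
  shows "\<exists>q. vars_in A q \<and> subst L f - subst L' f = p * q"
  using assms(1)
proof (induction f rule: vars_in_induct)
  case (const c)
  show ?case by (intro exI[of _ 0]) simp
next
  case (var i f)
  obtain q q' where q: "vars_in A q" "L i - L' i = p * q" "vars_in A q'" "subst L f - subst L' f = p * q'"
    using assms(4)[OF var(1)] var(3) by blast
  have "L i * subst L f - L' i * subst L' f
      = (L i - L' i) * subst L f + L' i * (subst L f - subst L' f)" by (simp add: algebra_simps)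
  also have "\<dots> = p * (q * subst L f + L' i * q')" by (simp add: q algebra_simps)
  finally have "subst L (pvar i * f) - subst L' (pvar i * f) = p * (q * subst L f + L' i * q')"
    by (simp add: subst_mult)
  moreover have "vars_in A (q * subst L f + L' i * q')"
    using q assms(2,3) var by (intro vars_in_add vars_in_mult vars_in_subst[OF var(2)]) auto
  ultimately show ?case by blast
next
  case (add f g)
  then obtain q q' where q: "vars_in A q" "subst L f - subst L' f = p * q" "vars_in A q'" "subst L g - subst L' g = p * q'"
    by blast
  have "subst L (f + g) - subst L' (f + g)
      = (subst L f - subst L' f) + (subst L g - subst L' g)" by (simp add: subst_add)
  also have "\<dots> = p * (q + q')" by (simp add: q distrib_left)
  finally show ?case using q by (blast intro: vars_in_add)
qed

lemma lin_form_sum: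
  "(\<Sum>j<n. pconst (c j) * lin_form n (d j)) = lin_form n (\<lambda>k. \<Sum>j<n. c j * d j k)"
  unfolding lin_form_def
  by (simp add: sum_distrib_left sum_distrib_right pconst_sum pconst_mult mult.assoc) (rule sum.swap)

lemma lin_form_cong: "(\<And>k. k < n \<Longrightarrow> c k = d k) \<Longrightarrow> lin_form n c = lin_form n d"
  unfolding lin_form_def by (rule sum.cong) auto

lemma lin_form_unit:
  assumes "i < n" "\<And>k. k < n \<Longrightarrow> c k = (if k = i then 1 else 0)"
  shows "lin_form n c = pvar i"
proof -
  have "lin_form n c = (\<Sum>k<n. if k = i then pvar i else 0)"
    unfolding lin_form_def by (intro sum.cong refl) (simp add: assms(2))
  then show ?thesis using assms(1) by simp
qed

subsection \<open>The actions on \<open>S(V)\<close> and \<open>S(V\<^sup>*)\<close>\<close>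

context matrix_group
begin

sublocale V: poly_action n G "actV n"
proof
  fix g h :: "'a mat" and p q :: "'a mpoly" and c d
  show "actV n g (p + q) = actV n g p + actV n g q" by (simp add: actV_def subst_add)
  show "actV n g (p * q) = actV n g p * actV n g q" by (simp add: actV_def subst_mult)
  show "actV n g (pconst c) = pconst c" by (simp add: actV_def)
  show "poly_in n (actV n g p)" if "poly_in n p"
    using that unfolding actV_def poly_in_vars_in by (rule vars_in_subst) (auto intro: vars_in_lin_form)
  show "hcomp d (actV n g p) = actV n g (hcomp d p)" if "poly_in n p"
    using that unfolding actV_def poly_in_vars_in by (rule subst_hcomp) (rule homogeneous_lin_form)
  show "actV n g (actV n h p) = actV n (g * h) p" if "g \<in> G" "h \<in> G" "poly_in n p"
    using that(3) unfolding actV_def poly_in_vars_in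
  proof (rule subst_subst)
    fix j assume j: "j \<in> {..<n}"
    show "subst (\<lambda>j. lin_form n (\<lambda>i. g $$ (i, j))) (lin_form n (\<lambda>i. h $$ (i, j))) = lin_form n (\<lambda>i. (g * h) $$ (i, j))"
      unfolding subst_lin_form lin_form_sum
    proof (rule lin_form_cong)
      fix k assume "k < n"
      then show "(\<Sum>l<n. h $$ (l, j) * g $$ (k, l)) = (g * h) $$ (k, j)"
        using that j by (simp only: index_mult_G lessThan_iff mult.commute)
    qed
  qed
  show "actV n (1\<^sub>m n) p = p" if "poly_in n p"
    using that unfolding actV_def poly_in_vars_in by (rule subst_ident) (auto intro!: lin_form_unit)
qed

sublocale Vs: poly_action n G "actVs n G"
proof
  fix g h :: "'a mat" and p q :: "'a mpoly" and c d
  show "actVs n G g (p + q) = actVs n G g p + actVs n G g q" by (simp add: actVs_def subst_add)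
  show "actVs n G g (p * q) = actVs n G g p * actVs n G g q" by (simp add: actVs_def subst_mult)
  show "actVs n G g (pconst c) = pconst c" by (simp add: actVs_def)
  show "poly_in n (actVs n G g p)" if "poly_in n p"
    using that unfolding actVs_def poly_in_vars_in by (rule vars_in_subst) (auto intro: vars_in_lin_form)
  show "hcomp d (actVs n G g p) = actVs n G g (hcomp d p)" if "poly_in n p"
    using that unfolding actVs_def poly_in_vars_in by (rule subst_hcomp) (rule homogeneous_lin_form)
  show "actVs n G g (actVs n G h p) = actVs n G (g * h) p" if "g \<in> G" "h \<in> G" "poly_in n p"
    using that(3) unfolding actVs_def poly_in_vars_in
  proof (rule subst_subst)
    fix i assume i: "i \<in> {..<n}"
    show "subst (\<lambda>i. lin_form n (\<lambda>j. ginv n G g $$ (i, j))) (lin_form n (\<lambda>j. ginv n G h $$ (i, j)))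
        = lin_form n (\<lambda>j. ginv n G (g * h) $$ (i, j))"
      unfolding subst_lin_form lin_form_sum
    proof (rule lin_form_cong)
      fix k assume "k < n"
      then show "(\<Sum>l<n. ginv n G h $$ (i, l) * ginv n G g $$ (l, k)) = ginv n G (g * h) $$ (i, k)"
        using that i by (simp only: index_mult_G ginv_mult ginv_G lessThan_iff)
    qed
  qed
  show "actVs n G (1\<^sub>m n) p = p" if "poly_in n p"
    using that unfolding actVs_def poly_in_vars_in by (rule subst_ident) (auto intro!: lin_form_unit)
qed

lemma ginv_mult_cancel: "g \<in> G \<Longrightarrow> h \<in> G \<Longrightarrow> ginv n G g * (g * h) = h"
  by (simp flip: assoc_G)

lemma SV_inv_eq: "SV_inv n G = V.pinv"
  by (simp add: SV_inv_def V.pinv_def)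

lemma SVs_inv_eq: "SVs_inv n G = Vs.pinv"
  by (simp add: SVs_inv_def Vs.pinv_def)

lemma ideal_I_eq: "ideal_I n G = V.pideal"
  by (simp add: ideal_I_def V.pideal_def SV_inv_eq)

lemma ideal_Istar_eq: "ideal_Istar n G = Vs.pideal"
  by (simp add: ideal_Istar_def Vs.pideal_def SVs_inv_eq)

text \<open>The matrix by which \<open>g\<close> acts on coordinates is the transpose of the one by
  which its inverse acts on vectors, so this is an instance of \<open>pairing_subst\<close>.\<close>

lemma pairing_actVs:
  assumes "g \<in> G" "poly_in n f" "poly_in n s"
  shows "pairing (actVs n G g f) s = pairing f (actV n (ginv n G g) s)"
  using assms(2,3) unfolding actVs_def actV_def poly_in_vars_in
  by (intro pairing_subst[where A = "{..<n}" and C = "{..<n}" and l = "\<lambda>i c. ginv n G g $$ (i, c)"])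
     (simp_all add: lin_form_def)

lemma harmonics_poly_in: "f \<in> harmonics n G \<Longrightarrow> poly_in n f"
  by (simp add: harmonics_def)

lemma harmonics_pairing: "f \<in> harmonics n G \<Longrightarrow> s \<in> V.pideal \<Longrightarrow> pairing f s = 0"
  by (simp add: harmonics_def ideal_I_eq)

lemma harmonics_0 [simp]: "0 \<in> harmonics n G"
  by (simp add: harmonics_def)

lemma harmonics_add: "f \<in> harmonics n G \<Longrightarrow> f' \<in> harmonics n G \<Longrightarrow> f + f' \<in> harmonics n G"
  by (simp add: harmonics_def poly_in_add pairing_add_left)

lemma harmonics_pconst_mult: "f \<in> harmonics n G \<Longrightarrow> pconst c * f \<in> harmonics n G"
  by (simp add: harmonics_def poly_in_mult pairing_pconst_mult_left)

lemma harmonics_sum: "(\<And>i. i \<in> I \<Longrightarrow> f i \<in> harmonics n G) \<Longrightarrow> sum f I \<in> harmonics n G"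
  by (induction I rule: infinite_finite_induct) (auto intro: harmonics_add)

lemma harmonics_diff: "f \<in> harmonics n G \<Longrightarrow> f' \<in> harmonics n G \<Longrightarrow> f - f' \<in> harmonics n G"
  using harmonics_add[of f "pconst (- 1) * f'"] harmonics_pconst_mult[of f' "- 1"]
  by (simp add: pconst_minus)

text \<open>By adjunction, \<open>diff_op s f\<close> pairs with an element of the ideal as
  \<open>f\<close> does with its multiple by \<open>s\<close>, which is again in the ideal.\<close>

lemma harmonics_diff_op: "f \<in> harmonics n G \<Longrightarrow> poly_in n s \<Longrightarrow> diff_op s f \<in> harmonics n G"
  by (auto simp: harmonics_def ideal_I_eq pairing_diff_op V.pideal_mult)
     (simp add: poly_in_vars_in vars_in_diff_op)

text \<open>\<open>V\<^sup>*\<close> embeds equivariantly into a permutation module with basis \<open>z\<^sub>(\<^sub>g\<^sub>,\<^sub>j\<^sub>)\<close> via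
  \<open>x\<^sub>i \<mapsto> \<Sum> g\<^sub>i\<^sub>j z\<^sub>(\<^sub>g\<^sub>,\<^sub>j\<^sub>)\<close>; there the ideal generated by the invariants is spanned by rational
  polynomials, so that harmonics and ideal meet in \<open>0\<close> by positivity.\<close>

lemma harmonics_Istar_0:
  assumes harm: "f \<in> harmonics n G" and ideal: "f \<in> Vs.pideal"
  shows "f = 0"
proof -
  interpret mp: vector_space "\<lambda>c (p :: 'a mpoly). pconst c * p"
    by unfold_locales (simp_all add: pconst_add pconst_mult algebra_simps)
  obtain e :: "'a mat \<Rightarrow> nat" where e: "inj_on e G"
    using finite_imp_inj_to_nat_seg[OF finite_G] by blast
  \<comment> \<open>Variables are natural numbers, so the basis vector belonging to \<open>g\<close>
    and \<open>j\<close> is coded as a number; \<open>\<gamma>\<close> and \<open>jj\<close> decode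
    it.\<close>
  define idx where "idx g j = prod_encode (e g, j)" for g and j :: nat
  define \<gamma> where "\<gamma> c = the_inv_into G e (fst (prod_decode c))" for c :: nat
  define jj where "jj c = snd (prod_decode c)" for c :: nat
  have \<gamma> [simp]: "\<gamma> (idx g j) = g" if "g \<in> G" for g j
    using that e by (simp add: \<gamma>_def idx_def the_inv_into_f_f)
  have jj [simp]: "jj (idx g j) = j" for g j by (simp add: jj_def idx_def)
  define C where "C = (\<lambda>(g, j). idx g j) ` (G \<times> {..<n})"
  have finC: "finite C" by (simp add: C_def)
  have idx_C: "idx g j \<in> C" if "g \<in> G" "j < n" for g j using that by (auto simp: C_def)
  have C_E: "\<exists>g j. c = idx g j \<and> g \<in> G \<and> j < n" if "c \<in> C" for c using that by (auto simp: C_def)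
  have inj: "inj_on (\<lambda>(g, j). idx g j) (G \<times> {..<n})"
    by (auto simp: inj_on_def idx_def dest: inj_onD[OF e])
  have sumC: "(\<Sum>c\<in>C. F c) = (\<Sum>g\<in>G. \<Sum>j<n. F (idx g j))" for F :: "nat \<Rightarrow> 'a mpoly"
    unfolding C_def sum.reindex[OF inj] by (simp add: sum.cartesian_product case_prod_unfold comp_def)
  \<comment> \<open>Matrix of the embedding \<open>L\<close>. Its transpose \<open>L'\<close> sends
    the variable coded by \<open>g\<close> and \<open>j\<close> to column \<open>j\<close> of
    \<open>g\<close>, that is, to the image of a basis vector of \<open>V\<close>.\<close>
  define l where "l i c = \<gamma> c $$ (i, jj c)" for i c
  define L where "L i = (\<Sum>c\<in>C. pconst (l i c) * pvar c)" for i
  define L' where "L' c = (\<Sum>i<n. pconst (l i c) * pvar i)" for c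
  \<comment> \<open>The permutation action: left multiplication on the group component, with the
    column index fixed.\<close>
  define pm where "pm g = (\<lambda>c. pvar (idx (g * \<gamma> c) (jj c)) :: 'a mpoly)" for g
  have L: "L i = (\<Sum>h\<in>G. \<Sum>j<n. pconst (h $$ (i, j)) * pvar (idx h j))" for i
    by (simp add: L_def sumC l_def)
  have L'_idx: "L' (idx g j) = lin_form n (\<lambda>i. g $$ (i, j))" if "g \<in> G" for g j
    using that by (simp add: L'_def l_def lin_form_def)
  have vL: "vars_in C (L i)" for i
    unfolding L_def by (intro vars_in_sum vars_in_mult vars_in_pconst vars_in_pvar)
  have vL': "vars_in {..<n} (L' c)" for c
    unfolding L'_def by (intro vars_in_sum vars_in_mult vars_in_pconst vars_in_pvar)
  have vpm: "vars_in C (pm g c)" if "g \<in> G" "c \<in> C" for g c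
    using C_E[OF that(2)] that(1) by (auto simp: pm_def intro!: vars_in_pvar idx_C)
  have hL: "homogeneous 1 (L i)" for i
    unfolding L_def by (intro homogeneous_sum homogeneous_pconst_mult homogeneous_pvar)
  have hL': "homogeneous 1 (L' i)" for i
    unfolding L'_def by (intro homogeneous_sum homogeneous_pconst_mult homogeneous_pvar)
  have pm_L: "subst (pm g) (subst L p) = subst L (actVs n G g p)" if g: "g \<in> G" and p: "poly_in n p" for g p
  proof -
    have eq: "subst L (lin_form n (\<lambda>j. ginv n G g $$ (i, j))) = subst (pm g) (L i)" if i: "i \<in> {..<n}" for i
    proof -
      have "subst L (lin_form n (\<lambda>j. ginv n G g $$ (i, j)))
          = (\<Sum>k<n. \<Sum>h\<in>G. \<Sum>j<n. pconst (ginv n G g $$ (i, k) * h $$ (k, j)) * pvar (idx h j))"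
        unfolding subst_lin_form L sum_distrib_left by (intro sum.cong refl) (simp only: pconst_mult mult.assoc)
      also have "\<dots> = (\<Sum>h\<in>G. \<Sum>k<n. \<Sum>j<n. pconst (ginv n G g $$ (i, k) * h $$ (k, j)) * pvar (idx h j))"
        by (rule sum.swap)
      also have "\<dots> = (\<Sum>h\<in>G. \<Sum>j<n. \<Sum>k<n. pconst (ginv n G g $$ (i, k) * h $$ (k, j)) * pvar (idx h j))"
        by (rule sum.cong[OF refl], rule sum.swap)
      also have "\<dots> = (\<Sum>h\<in>G. \<Sum>j<n. pconst ((ginv n G g * h) $$ (i, j)) * pvar (idx h j))"
      proof (intro sum.cong[OF refl])
        fix h j assume "h \<in> G" "j \<in> {..<n}"
        then show "(\<Sum>k<n. pconst (ginv n G g $$ (i, k) * h $$ (k, j)) * pvar (idx h j))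
            = pconst ((ginv n G g * h) $$ (i, j)) * pvar (idx h j)"
          using i by (simp only: index_mult_G ginv_G g pconst_sum sum_distrib_right lessThan_iff)
      qed
      also have "\<dots> = (\<Sum>h\<in>G. \<Sum>j<n. pconst (h $$ (i, j)) * pvar (idx (g * h) j))"
        by (subst sum_mult_left[OF g, symmetric]) (intro sum.cong refl, simp only: ginv_mult_cancel[OF g])
      also have "\<dots> = subst (pm g) (L i)"
        using g by (simp add: L subst_sum subst_mult pm_def)
      finally show ?thesis .
    qed
    have "subst L (subst (\<lambda>i. lin_form n (\<lambda>j. ginv n G g $$ (i, j))) p) = subst (\<lambda>i. subst (pm g) (L i)) p"
      by (rule subst_subst[OF p[unfolded poly_in_vars_in] eq])
    moreover have "subst (pm g) (subst L p) = subst (\<lambda>i. subst (pm g) (L i)) p"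
      by (rule subst_subst[OF vars_in_UNIV]) simp
    ultimately show ?thesis by (simp add: actVs_def)
  qed
  have L'_pm: "subst L' (subst (pm g) s) = actV n g (subst L' s)" if g: "g \<in> G" and s: "vars_in C s" for g s
  proof -
    have c: "actV n g (L' c) = L' (idx (g * \<gamma> c) (jj c))" if cC: "c \<in> C" for c
    proof -
      obtain h j where c: "c = idx h j" "h \<in> G" "j < n" using C_E[OF cC] by blast
      have "actV n g (L' c) = (\<Sum>k<n. pconst (h $$ (k, j)) * lin_form n (\<lambda>i. g $$ (i, k)))"
        by (simp only: c L'_idx actV_def subst_lin_form)
      also have "\<dots> = lin_form n (\<lambda>i. (g * h) $$ (i, j))"
        unfolding lin_form_sum
        by (rule lin_form_cong) (simp only: index_mult_G[OF g c(2) _ c(3)], simp add: mult.commute)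
      also have "\<dots> = L' (idx (g * \<gamma> c) (jj c))"
        using g c by (simp only: \<gamma> jj L'_idx mult_G)
      finally show ?thesis .
    qed
    have "subst L' (subst (pm g) s) = subst (\<lambda>c. L' (idx (g * \<gamma> c) (jj c))) s"
      by (rule subst_subst[OF vars_in_UNIV]) (simp add: pm_def)
    moreover have "actV n g (subst L' s) = subst (\<lambda>c. L' (idx (g * \<gamma> c) (jj c))) s"
      unfolding actV_def by (rule subst_subst[OF s]) (simp add: c[unfolded actV_def])
    ultimately show ?thesis by simp
  qed
  \<comment> \<open>A monomial times the sum over \<open>G\<close> of the translates of a monomial.
    Only variables are permuted, so the coefficients are rational.\<close>
  define u :: "(nat \<Rightarrow>\<^sub>0 nat) \<Rightarrow> (nat \<Rightarrow>\<^sub>0 nat) \<Rightarrow> 'a mpoly"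
    where "u m m' = pmonom m * (\<Sum>g\<in>G. subst (pm g) (pmonom m'))" for m m'
  define U where "U = {u m m' | m m'. Poly_Mapping.keys m \<subseteq> C \<and> Poly_Mapping.keys m' \<subseteq> C \<and> 0 < tdeg m'}"
  have rat: "Poly_Mapping.lookup p k \<in> \<rat>" if pU: "p \<in> U" for p k
  proof -
    obtain m m' where p: "p = u m m'" using pU by (auto simp: U_def)
    have "\<exists>m''. subst (pm g) (pmonom m') = pmonom m''" for g
    proof (induction m' rule: monom_induct[OF subset_UNIV])
      case 1 show ?case by (intro exI[of _ 0]) simp
    next
      case (2 i m)
      then obtain m'' where m'': "subst (pm g) (pmonom m) = pmonom m''" by blast
      have "subst (pm g) (pmonom (Poly_Mapping.single i 1 + m)) = pvar (idx (g * \<gamma> i) (jj i)) * pmonom m''"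
        by (simp only: pmonom_add subst_mult pvar_eq_pmonom[symmetric] subst_pvar m'') (simp only: pm_def)
      then show ?case by (metis pmonom_add pvar_eq_pmonom)
    qed
    then obtain q where "\<And>g. subst (pm g) (pmonom m') = pmonom (q g)" by metis
    then have "p = (\<Sum>g\<in>G. pmonom (m + q g))" by (simp add: p u_def sum_distrib_left pmonom_add)
    then show ?thesis by (auto simp: lookup_sum lookup_pmonom intro!: Rats_sum)
  qed
  have span: "subst L f \<in> mp.span U"
    using ideal
  proof (induction f rule: Vs.pideal_induct)
    case (base a h d)
    let ?a = "subst L a" and ?h = "subst L h"
    have va: "vars_in C ?a" and vh: "vars_in C ?h"
      using base vL Vs.pinv_poly_in by (auto intro!: vars_in_subst[where A = "{..<n}"] simp: poly_in_vars_in)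
    have hh: "homogeneous d ?h"
      using base hL Vs.pinv_poly_in by (intro homogeneous_subst[where A = "{..<n}"]) (auto simp: poly_in_vars_in)
    have inv: "subst (pm g) ?h = ?h" if "g \<in> G" for g
      using that base by (simp add: pm_L Vs.pinv_poly_in Vs.pinv_act)
    \<comment> \<open>The image of an invariant is fixed by the permutations, hence is a multiple of
      its own group sum; expanding it into monomials exhibits the elements
      \<open>u m m'\<close>.\<close>
    have "of_nat (card G) * ?h = (\<Sum>g\<in>G. subst (pm g) ?h)" by (simp add: inv)
    also have "\<dots> = (\<Sum>m'\<in>Poly_Mapping.keys ?h. pconst (Poly_Mapping.lookup ?h m') * (\<Sum>g\<in>G. subst (pm g) (pmonom m')))"
      by (subst (1) mpoly_sum_monomials[of ?h])
         (simp add: subst_sum subst_mult sum.swap[of _ _ G] sum_distrib_left)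
    finally have h: "?a * (of_nat (card G) * ?h) = (\<Sum>m\<in>Poly_Mapping.keys ?a. \<Sum>m'\<in>Poly_Mapping.keys ?h.
        pconst (Poly_Mapping.lookup ?a m * Poly_Mapping.lookup ?h m') * u m m')"
      by (subst mpoly_sum_monomials[of ?a])
         (simp add: sum_distrib_left sum_distrib_right u_def pconst_mult mult_ac, rule sum.swap)
    have "?a * (of_nat (card G) * ?h) \<in> mp.span U" unfolding h
    proof (intro mp.span_sum mp.span_scale mp.span_base)
      fix m m' assume "m \<in> Poly_Mapping.keys ?a" "m' \<in> Poly_Mapping.keys ?h"
      then show "u m m' \<in> U" using va vh hh \<open>0 < d\<close> unfolding U_def vars_in_def homogeneous_def
        by (intro CollectI exI[of _ m] exI[of _ m']) auto
    qed
    from mp.span_scale[OF this, of "1 / of_nat (card G)"]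
    have "pconst (1 / of_nat (card G)) * (?a * (of_nat (card G) * ?h)) \<in> mp.span U" .
    also have "pconst (1 / of_nat (card G)) * (?a * (of_nat (card G) * ?h)) = ?a * ?h"
      by (simp add: mult.left_commute mult.assoc[symmetric] flip: pconst_of_nat pconst_mult)
    finally show ?case by (simp add: subst_mult)
  next
    case (add f f') then show ?case by (simp add: subst_add mp.span_add)
  qed
  \<comment> \<open>Under the adjoint \<open>L'\<close> the group sum in \<open>u m m'\<close>
    becomes an invariant of \<open>S(V)\<close>, of positive degree because \<open>m'\<close> is not
    constant; so \<open>L'\<close> carries \<open>U\<close> into the ideal to which \<open>f\<close>
    is orthogonal.\<close>
  have orth: "pairing (subst L f) p = 0" if "p \<in> U" for p
  proof -
    obtain m m' where p: "p = u m m'" "Poly_Mapping.keys m \<subseteq> C" "Poly_Mapping.keys m' \<subseteq> C" "0 < tdeg m'"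
      using \<open>p \<in> U\<close> by (auto simp: U_def)
    have vm: "vars_in C (pmonom m :: 'a mpoly)" "vars_in C (pmonom m' :: 'a mpoly)" using p(2,3) by (simp_all add: vars_in_pmonom)
    have vp: "vars_in C p"
      unfolding p u_def by (intro vars_in_mult vars_in_sum vars_in_subst[OF vm(2)] vm vpm) 
    have "pairing (subst L f) p = pairing f (subst L' p)"
      by (rule pairing_subst[OF _ finC L_def L'_def _ vp])
         (use harm in \<open>auto simp: harmonics_def poly_in_vars_in\<close>)
    moreover have "subst L' p \<in> V.pideal"
    proof -
      have "subst L' p = subst L' (pmonom m) * (\<Sum>g\<in>G. actV n g (subst L' (pmonom m')))"
        by (simp add: p u_def subst_mult subst_sum L'_pm vm)
      moreover have pin: "poly_in n (subst L' (pmonom m'))" "poly_in n (subst L' (pmonom m))"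
        unfolding poly_in_vars_in using vars_in_subst[OF vm(1)] vars_in_subst[OF vm(2)] vL' by blast+
      moreover have "homogeneous (tdeg m') (subst L' (pmonom m'))"
        by (rule homogeneous_subst[OF vm(2) homogeneous_pmonom hL'])
      ultimately show ?thesis using p(4)
        by (auto intro!: V.pidealI[of _ _ "tdeg m'"] V.sum_act_pinv homogeneous_sum V.homogeneous_act)
    qed
    ultimately show ?thesis using harmonics_pairing[OF harm] by simp
  qed
  have "subst L f = 0"
  proof -
    obtain K c where K: "finite K" "K \<subseteq> U" "subst L f = (\<Sum>k\<in>K. pconst (c k) * k)"
      using span unfolding mp.span_explicit by blast
    show ?thesis
      using K rat orth by (intro rational_span_anisotropic[OF K(1) _ K(3)]) auto
  qed
  \<comment> \<open>\<open>L\<close> has a left inverse: keep the variables coded with the identity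
    matrix and set all others to \<open>0\<close>.\<close>
  moreover have "subst (\<lambda>c. if \<gamma> c = 1\<^sub>m n then pvar (jj c) else 0) (subst L f) = f"
  proof -
    have i: "subst (\<lambda>c. if \<gamma> c = 1\<^sub>m n then pvar (jj c) else 0) (L i) = pvar i" if "i \<in> {..<n}" for i
    proof -
      have "subst (\<lambda>c. if \<gamma> c = 1\<^sub>m n then pvar (jj c) else 0) (L i)
          = (\<Sum>h\<in>G. if h = 1\<^sub>m n then lin_form n (\<lambda>j. h $$ (i, j)) else 0)"
        unfolding L subst_sum by (intro sum.cong refl) (simp add: subst_mult lin_form_def)
      also have "\<dots> = lin_form n (\<lambda>j. 1\<^sub>m n $$ (i, j))" by simp
      also have "\<dots> = pvar i" using that by (intro lin_form_unit) auto
      finally show ?thesis .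
    qed
    have f: "vars_in {..<n} f" using harm by (simp add: harmonics_def poly_in_vars_in)
    have "subst (\<lambda>c. if \<gamma> c = 1\<^sub>m n then pvar (jj c) else 0) (subst L f) = subst pvar f"
      by (rule subst_subst[OF f i])
    also have "\<dots> = f" by (rule subst_ident[OF f]) simp
    finally show ?thesis .
  qed
  ultimately show ?thesis by simp
qed

end

subsection \<open>Groups generated by pseudo-reflections\<close>

text \<open>The hypothesis says that \<open>A\<close> has rank one. Its row echelon form has a
  single nonzero row, and undoing the row operations by \<open>Q\<close> multiplies that row by a
  column of \<open>Q\<close>.\<close>

lemma rank_one_decomp:
  fixes A :: "'a::field mat"
  assumes A: "A \<in> carrier_mat n n" and ker: "kernel_dim A + 1 = n"
  obtains v \<alpha> where "\<And>i j. i < n \<Longrightarrow> j < n \<Longrightarrow> A $$ (i, j) = v i * \<alpha> j"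
proof -
  let ?B = "gauss_jordan_single A"
  note gj = gauss_jordan_single[OF A refl]
  obtain P Q where PQ: "?B = P * A" "P \<in> carrier_mat n n" "Q \<in> carrier_mat n n" "Q * P = 1\<^sub>m n"
    using gj(4) by auto
  obtain p where p: "pivot_fun ?B p n" using gj(2,3) by (auto simp: row_echelon_form_def)
  have "n - card {i. i < n \<and> row ?B i \<noteq> 0\<^sub>v n} + 1 = n"
    using ker carrier_matD(2)[OF A] unfolding kernel_dim_code pivot_positions(4)[OF gj(2) p] by (simp only:)
  \<comment> \<open>This bound removes the truncation in the preceding subtraction, so that the rank
    is exactly 1.\<close>
  moreover have "card {i. i < n \<and> row ?B i \<noteq> 0\<^sub>v n} \<le> card {..<n}" by (rule card_mono) auto
  ultimately have "card {i. i < n \<and> row ?B i \<noteq> 0\<^sub>v n} = 1" unfolding card_lessThan by arith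
  then obtain i0 where i0: "{i. i < n \<and> row ?B i \<noteq> 0\<^sub>v n} = {i0}" unfolding One_nat_def card_1_singleton_iff by blast
  have B0: "?B $$ (i, j) = 0" if "i < n" "j < n" "i \<noteq> i0" for i j
  proof -
    have "row ?B i = 0\<^sub>v n" using i0 that by blast
    then have "row ?B i $ j = 0" using that(2) by (simp only: index_zero_vec)
    then show ?thesis using that gj(2) by (metis carrier_matD index_row(1))
  qed
  have AQ: "A = Q * ?B"
    unfolding PQ(1) assoc_mult_mat[OF PQ(3,2) A, symmetric] PQ(4) using A by simp
  have "A $$ (i, j) = Q $$ (i, i0) * ?B $$ (i0, j)" if "i < n" "j < n" for i j
  proof -
    have "i0 < n" using i0 by auto
    have "A $$ (i, j) = (\<Sum>k<n. Q $$ (i, k) * ?B $$ (k, j))"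
      unfolding arg_cong[OF AQ, of "\<lambda>A. A $$ (i, j)"]
      using that PQ(3) gj(2) by (simp add: scalar_prod_def lessThan_atLeast0)
    also have "\<dots> = (\<Sum>k<n. if k = i0 then Q $$ (i, i0) * ?B $$ (i0, j) else 0)"
      using B0 that by (intro sum.cong) auto
    finally show ?thesis using \<open>i0 < n\<close> by simp
  qed
  then show ?thesis by (rule that)
qed

locale reflection_group = matrix_group n G for n :: nat and G :: "'a::field_char_0 mat set" +
  assumes refl_gen: "generated_by_pseudo_reflections n G"
begin

text \<open>If \<open>g - 1\<close> is the outer product of \<open>v\<close> and \<open>a\<close>,
  then the inverse of \<open>g\<close> is 1 minus the outer product of \<open>w\<close> and the same
  \<open>a\<close>. Every variable thus changes by a multiple of one linear form, and
  \<open>subst_diff_factor\<close> extends this to all polynomials.\<close>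

lemma divided_difference:
  assumes g: "g \<in> G" "pseudo_reflection n g"
  shows "\<exists>\<alpha>. homogeneous 1 \<alpha> \<and> poly_in n \<alpha> \<and>
    (\<forall>f. poly_in n f \<longrightarrow> (\<exists>D. poly_in n D \<and> f - actVs n G g f = \<alpha> * D))"
proof -
  have gc: "g \<in> carrier_mat n n" using g carrier_G by auto
  then have "g - 1\<^sub>m n \<in> carrier_mat n n" by auto
  then obtain v a where va: "\<And>i j. i < n \<Longrightarrow> j < n \<Longrightarrow> (g - 1\<^sub>m n) $$ (i, j) = v i * a j"
    using rank_one_decomp[of "g - 1\<^sub>m n" n] g(2) unfolding pseudo_reflection_def by metis
  let ?h = "ginv n G g" and ?\<alpha> = "lin_form n a"
  define w where "w i = (\<Sum>k<n. ?h $$ (i, k) * v k)" for i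
  have h: "?h $$ (i, j) = (if j = i then 1 else 0) - w i * a j" if "i < n" "j < n" for i j
  proof -
    have g_entry: "g $$ (k, j) = (if k = j then 1 else 0) + v k * a j" if "k < n" for k
      using va[OF that \<open>j < n\<close>] that \<open>j < n\<close> gc by (auto simp: algebra_simps)
    have "(if j = i then 1 else 0) = (?h * g) $$ (i, j)" using that g by auto
    also have "\<dots> = (\<Sum>k<n. ?h $$ (i, k) * ((if k = j then 1 else 0) + v k * a j))"
      unfolding index_mult_G[OF ginv_G[OF g(1)] g(1) that] by (intro sum.cong refl) (simp add: g_entry)
    also have "\<dots> = (\<Sum>k<n. if k = j then ?h $$ (i, j) else 0) + w i * a j"
      unfolding w_def sum_distrib_right sum.distrib[symmetric]
      by (intro sum.cong refl) (simp add: distrib_left mult.assoc)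
    also have "\<dots> = ?h $$ (i, j) + w i * a j" using that by simp
    finally show ?thesis by (simp add: eq_diff_eq)
  qed
  have "\<exists>q. vars_in {..<n} q \<and> pvar i - lin_form n (\<lambda>j. ?h $$ (i, j)) = ?\<alpha> * q" if "i < n" for i
  proof (intro exI conjI)
    have "lin_form n (\<lambda>j. ?h $$ (i, j)) = lin_form n (\<lambda>j. if j = i then 1 else 0) - ?\<alpha> * pconst (w i)"
      unfolding lin_form_def sum_distrib_right sum_subtractf[symmetric]
      using that by (intro sum.cong refl) (simp add: h pconst_diff pconst_mult algebra_simps)
    also have "lin_form n (\<lambda>j. if j = i then 1 else 0) = pvar i" using that by (intro lin_form_unit) auto
    finally show "pvar i - lin_form n (\<lambda>j. ?h $$ (i, j)) = ?\<alpha> * pconst (w i)" by simp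
  qed simp
  then have "\<exists>D. vars_in {..<n} D \<and> subst pvar f - subst (\<lambda>i. lin_form n (\<lambda>j. ?h $$ (i, j))) f = ?\<alpha> * D"
    if "poly_in n f" for f
    using that unfolding poly_in_vars_in
    by (intro subst_diff_factor) (auto intro!: vars_in_pvar vars_in_lin_form)
  moreover have "subst pvar f = f" for f :: "'a mpoly" by (metis subst_ident vars_in_UNIV)
  ultimately have "\<exists>D. poly_in n D \<and> f - actVs n G g f = ?\<alpha> * D" if "poly_in n f" for f
    using that by (simp add: poly_in_vars_in actVs_def)
  moreover have "poly_in n ?\<alpha>" unfolding poly_in_vars_in by (rule vars_in_lin_form) auto
  ultimately show ?thesis using homogeneous_lin_form by blast
qed

text \<open>The elements of \<open>G\<close> that fix \<open>f\<close> modulo the ideal form a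
  subgroup, because the ideal is stable under \<open>G\<close>. This is where generation by
  pseudo-reflections enters.\<close>

lemma diff_act_pideal:
  assumes f: "poly_in n f" and refl: "\<And>g. g \<in> G \<Longrightarrow> pseudo_reflection n g \<Longrightarrow> f - actVs n G g f \<in> Vs.pideal"
    and "g \<in> G"
  shows "f - actVs n G g f \<in> Vs.pideal"
proof -
  let ?H = "{g \<in> G. f - actVs n G g f \<in> Vs.pideal}"
  have "a * b \<in> ?H" if "a \<in> ?H" "b \<in> ?H" for a b
  proof -
    have "f - actVs n G (a * b) f = (f - actVs n G a f) + actVs n G a (f - actVs n G b f)"
      using that f by (simp add: Vs.act_diff Vs.act_act)
    moreover have "\<dots> \<in> Vs.pideal" using that by (intro Vs.pideal_add Vs.pideal_act) auto
    ultimately show ?thesis using that by (metis (no_types, lifting) mem_Collect_eq mult_G)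
  qed
  moreover have "ginv n G a \<in> ?H" if "a \<in> ?H" for a
  proof -
    have "f - actVs n G (ginv n G a) f = - actVs n G (ginv n G a) (f - actVs n G a f)"
      using that f by (simp add: Vs.act_diff Vs.act_ginv_act)
    moreover have "\<dots> \<in> Vs.pideal" using that by (intro Vs.pideal_minus Vs.pideal_act) auto
    ultimately show ?thesis using that by (metis (no_types, lifting) mem_Collect_eq ginv_G)
  qed
  moreover have "1\<^sub>m n \<in> ?H" using f by (simp add: Vs.act_one)
  ultimately have "?H = G"
    using refl by (intro refl_gen[unfolded generated_by_pseudo_reflections_def, rule_format, of ?H]) blast
  then show ?thesis using \<open>g \<in> G\<close> by blast
qed

text \<open>Induction on the degree of \<open>f i0\<close>. Divided differences of a relation give a
  relation of smaller degree, so by induction pseudo-reflections, and then all of \<open>G\<close>,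
  fix \<open>f i0\<close> modulo the ideal. Hence it agrees there with its average, which is an
  invariant of positive degree and so lies in the ideal. In degree 0 a nonzero constant would
  express \<open>h i0\<close> through the other \<open>h i\<close>.\<close>

lemma chevalley:
  assumes I: "finite I" "i0 \<notin> I"
    and h: "\<And>i. i \<in> insert i0 I \<Longrightarrow> h i \<in> Vs.pinv"
    and notin: "\<And>g. (\<And>i. i \<in> I \<Longrightarrow> g i \<in> Vs.pinv) \<Longrightarrow> h i0 \<noteq> (\<Sum>i\<in>I. g i * h i)"
    and f: "\<And>i. i \<in> insert i0 I \<Longrightarrow> poly_in n (f i)" "homogeneous d (f i0)"
    and rel: "h i0 * f i0 + (\<Sum>i\<in>I. h i * f i) = 0"
  shows "f i0 \<in> Vs.pideal"
  using f rel
proof (induction d arbitrary: f)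
  case 0
  define c where "c = Poly_Mapping.lookup (f i0) 0"
  have c: "f i0 = pconst c" unfolding c_def by (rule homogeneous_0_const[OF 0(2)])
  show ?case
  proof (cases "c = 0")
    case False
    let ?s = "\<lambda>i. \<Sum>g\<in>G. actVs n G g (f i)"
    \<comment> \<open>Averaging makes the coefficients of the other \<open>h i\<close> invariant and
      leaves the constant \<open>c\<close> alone.\<close>
    have "(\<Sum>g\<in>G. actVs n G g (h i0 * f i0 + (\<Sum>i\<in>I. h i * f i)))
        = (\<Sum>g\<in>G. h i0 * pconst c + (\<Sum>i\<in>I. h i * actVs n G g (f i)))"
      using h by (intro sum.cong refl) (simp add: Vs.act_add Vs.act_sum Vs.act_mult Vs.pinv_act c)
    also have "\<dots> = of_nat (card G) * (h i0 * pconst c) + (\<Sum>i\<in>I. h i * ?s i)"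
      unfolding sum.distrib sum.swap[of _ I G] sum_distrib_left by simp
    finally have eq: "of_nat (card G) * (h i0 * pconst c) = - (\<Sum>i\<in>I. h i * ?s i)"
      unfolding 0(3) by (simp add: eq_neg_iff_add_eq_0)
    let ?k = "1 / (of_nat (card G) * c)"
    have "h i0 = pconst ?k * (of_nat (card G) * (h i0 * pconst c))"
      using False by (simp add: mult_ac flip: pconst_of_nat pconst_mult)
    also have "\<dots> = (\<Sum>i\<in>I. (pconst (- ?k) * ?s i) * h i)"
      unfolding eq by (simp add: sum_negf[symmetric] sum_distrib_left pconst_minus mult_ac)
    finally have "h i0 = (\<Sum>i\<in>I. (pconst (- ?k) * ?s i) * h i)" .
    moreover have "pconst (- ?k) * ?s i \<in> Vs.pinv" if "i \<in> I" for i
      by (intro Vs.pinv_mult Vs.sum_act_pinv Vs.pinv_pconst 0(1) insertI2 that)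
    ultimately show ?thesis using notin[of "\<lambda>i. pconst (- ?k) * ?s i"] by blast
  qed (simp add: c)
next
  case (Suc d)
  have refl: "f i0 - actVs n G g (f i0) \<in> Vs.pideal" if g: "g \<in> G" "pseudo_reflection n g" for g
  proof -
    obtain \<alpha> where \<alpha>: "homogeneous 1 \<alpha>" "poly_in n \<alpha>"
      "\<And>f. poly_in n f \<Longrightarrow> \<exists>D. poly_in n D \<and> f - actVs n G g f = \<alpha> * D"
      using divided_difference[OF g] by blast
    show ?thesis
    proof (cases "\<alpha> = 0")
      case True then show ?thesis using \<alpha>(3)[of "f i0"] Suc.prems by auto
    next
      case False
      have "\<exists>D. \<forall>i\<in>insert i0 I. poly_in n (D i) \<and> f i - actVs n G g (f i) = \<alpha> * D i"
      proof (intro bchoice ballI)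
        fix i assume "i \<in> insert i0 I"
        from \<alpha>(3)[OF Suc.prems(1)[OF this]]
        show "\<exists>D. poly_in n D \<and> f i - actVs n G g (f i) = \<alpha> * D" .
      qed
      then obtain D where D: "\<And>i. i \<in> insert i0 I \<Longrightarrow> poly_in n (D i)"
        "\<And>i. i \<in> insert i0 I \<Longrightarrow> f i - actVs n G g (f i) = \<alpha> * D i" by blast
      have "homogeneous (Suc d) (f i0 - actVs n G g (f i0))"
        by (intro homogeneous_diff Vs.homogeneous_act Suc.prems g insertI1)
      then have "homogeneous (Suc d) (\<alpha> * D i0)" by (simp only: D(2)[OF insertI1])
      then have "homogeneous d (D i0)" using homogeneous_factor[OF \<alpha>(1) _ False, of "Suc d"] by auto
      \<comment> \<open>Subtract from the relation its image under \<open>g\<close>: the invariants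
        \<open>h i\<close> factor out, and the common factor \<open>\<alpha>\<close>
        cancels.\<close>
      moreover have "h i0 * D i0 + (\<Sum>i\<in>I. h i * D i) = 0"
      proof -
        have "\<alpha> * (h i0 * D i0 + (\<Sum>i\<in>I. h i * D i)) = h i0 * (\<alpha> * D i0) + (\<Sum>i\<in>I. h i * (\<alpha> * D i))"
          by (simp add: distrib_left sum_distrib_left mult.left_commute)
        also have "\<dots> = h i0 * (f i0 - actVs n G g (f i0)) + (\<Sum>i\<in>I. h i * (f i - actVs n G g (f i)))"
          by (intro arg_cong2[where f = "(+)"] sum.cong refl arg_cong2[where f = "(*)"] D(2)[symmetric]) auto
        also have "\<dots> = (h i0 * f i0 + (\<Sum>i\<in>I. h i * f i)) - actVs n G g (h i0 * f i0 + (\<Sum>i\<in>I. h i * f i))"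
          using Vs.pinv_act[OF h g(1)]
          by (simp add: Vs.act_add Vs.act_sum Vs.act_mult right_diff_distrib sum_subtractf)
        also have "\<dots> = 0" unfolding Suc.prems(3) by simp
        finally show ?thesis using False by simp
      qed
      ultimately have "D i0 \<in> Vs.pideal" using D(1) by (intro Suc.IH)
      then show ?thesis unfolding D(2)[OF insertI1] by (rule Vs.pideal_mult[OF _ \<alpha>(2)])
    qed
  qed
  have diff: "f i0 - actVs n G g (f i0) \<in> Vs.pideal" if "g \<in> G" for g
    by (rule diff_act_pideal[OF Suc.prems(1)[OF insertI1] refl that])
  let ?s = "\<Sum>g\<in>G. actVs n G g (f i0)"
  have "?s \<in> Vs.pideal"
    by (rule Vs.pinv_homogeneous_pideal[of _ "Suc d"])
       (auto intro!: Vs.sum_act_pinv homogeneous_sum Vs.homogeneous_act Suc.prems(1,2))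
  moreover have "(\<Sum>g\<in>G. f i0 - actVs n G g (f i0)) \<in> Vs.pideal" by (intro Vs.pideal_sum diff)
  ultimately have "of_nat (card G) * f i0 \<in> Vs.pideal"
    using Vs.pideal_add[of ?s "\<Sum>g\<in>G. f i0 - actVs n G g (f i0)"] by (simp add: sum_subtractf)
  from Vs.pideal_pconst_mult[OF this, of "1 / of_nat (card G)"]
  show ?case by (simp add: mult.assoc[symmetric] flip: pconst_of_nat pconst_mult)
qed

text \<open>Induction on the index set. If \<open>h i0\<close> were not a combination of the other
  \<open>h i\<close> with invariant coefficients, \<open>chevalley\<close>, applied in each
  coordinate \<open>j\<close>, would put \<open>w i0\<close> into the ideal. So \<open>h i0\<close>
  can be eliminated, at the price of changing the remaining vectors by multiples of
  \<open>w i0\<close>. The common degree \<open>D\<close> of the terms keeps those vectors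
  homogeneous.\<close>

lemma homogeneous_independent_aux:
  assumes "finite I"
    and "\<And>i j. i \<in> I \<Longrightarrow> poly_in n (w i j)" "\<And>i j. i \<in> I \<Longrightarrow> homogeneous (d i) (w i j)"
    and "\<And>c. (\<And>j. (\<Sum>i\<in>I. pconst (c i) * w i j) \<in> Vs.pideal) \<Longrightarrow> \<forall>i\<in>I. c i = 0"
    and "\<And>i. i \<in> I \<Longrightarrow> h i \<in> Vs.pinv"
    and "\<And>i. i \<in> I \<Longrightarrow> h i = 0 \<or> (\<exists>e. homogeneous e (h i) \<and> e + d i = D)"
    and "\<And>j. (\<Sum>i\<in>I. h i * w i j) = 0"
  shows "\<forall>i\<in>I. h i = 0"
  using assms
proof (induction I arbitrary: w rule: finite_induct)
  case empty show ?case by simp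
next
  case (insert i0 I)
  note w = insert.prems(1,2) and ind = insert.prems(3) and h = insert.prems(4,5)
  have rel: "h i0 * w i0 j + (\<Sum>i\<in>I. h i * w i j) = 0" for j
    using insert.prems(6)[of j] insert.hyps by simp
  show ?case
  proof (cases "h i0 = 0")
    case True
    have "\<forall>i\<in>I. h i = 0"
    proof (rule insert.IH[of w])
      fix c assume "\<And>j. (\<Sum>i\<in>I. pconst (c i) * w i j) \<in> Vs.pideal"
      moreover have "(\<Sum>i\<in>insert i0 I. pconst ((c(i0 := 0)) i) * w i j) = (\<Sum>i\<in>I. pconst (c i) * w i j)" for j
        unfolding sum.insert[OF insert.hyps] using insert.hyps by (auto intro!: sum.cong)
      ultimately have "(\<Sum>i\<in>insert i0 I. pconst ((c(i0 := 0)) i) * w i j) \<in> Vs.pideal" for j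
        by simp
      then have "\<forall>i\<in>insert i0 I. (c(i0 := 0)) i = 0" by (rule ind)
      then show "\<forall>i\<in>I. c i = 0" using insert.hyps(2) by (metis fun_upd_apply insertI2)
    qed (use w h rel True in auto)
    then show ?thesis using True by simp
  next
    case False
    then obtain e0 where e0: "homogeneous e0 (h i0)" "e0 + d i0 = D" using h(2)[of i0] by auto
    have "\<exists>g. (\<forall>i\<in>I. g i \<in> Vs.pinv) \<and> h i0 = (\<Sum>i\<in>I. g i * h i)"
    proof (rule ccontr)
      assume *: "\<not> ?thesis"
      have "w i0 j \<in> Vs.pideal" for j
      proof (rule chevalley[OF insert.hyps h(1) _ w(1) w(2)[OF insertI1] rel])
        fix g assume "\<And>i. i \<in> I \<Longrightarrow> g i \<in> Vs.pinv"
        then show "h i0 \<noteq> (\<Sum>i\<in>I. g i * h i)" using * by blast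
      qed
      moreover have "(\<Sum>i\<in>insert i0 I. pconst (if i = i0 then 1 else 0) * w i j) = w i0 j" for j
        unfolding sum.insert[OF insert.hyps] using insert.hyps by (auto intro!: sum.neutral)
      ultimately have "\<forall>i\<in>insert i0 I. (if i = i0 then 1 else 0 :: 'a) = 0"
        by (intro ind) simp
      then show False by simp
    qed
    then obtain g where g: "\<And>i. i \<in> I \<Longrightarrow> g i \<in> Vs.pinv" "h i0 = (\<Sum>i\<in>I. g i * h i)" by blast
    \<comment> \<open>Only this component of \<open>g i\<close> has the degree that lets multiples
      of \<open>w i0\<close> be added to \<open>w i\<close>; the \<open>0\<close> covers the case
      where that degree would be negative.\<close>
    define g' where "g' i = (if d i0 \<le> d i then hcomp (d i - d i0) (g i) else 0)" for i
    have g'inv: "g' i \<in> Vs.pinv" if "i \<in> I" for i using g(1)[OF that] by (simp add: g'_def Vs.pinv_hcomp)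
    have "hcomp e0 (g i * h i) = g' i * h i" if "i \<in> I" for i
    proof (cases "h i = 0")
      case False
      then obtain e where e: "homogeneous e (h i)" "e + d i = D" using h(2)[of i] \<open>i \<in> I\<close> by auto
      have "e \<le> e0 \<longleftrightarrow> d i0 \<le> d i" "e0 - e = d i - d i0" using e e0 by auto
      then show ?thesis by (simp add: hcomp_mult_homogeneous[OF e(1)] g'_def)
    qed simp
    then have g': "h i0 = (\<Sum>i\<in>I. g' i * h i)"
      using arg_cong[OF g(2), of "hcomp e0"] hcomp_homogeneous[OF e0(1), of e0] by (simp add: hcomp_sum)
    define w' where "w' i j = w i j + g' i * w i0 j" for i j
    have "\<forall>i\<in>I. h i = 0"
    proof (rule insert.IH[of w'])
      fix i j assume "i \<in> I"
      then show "poly_in n (w' i j)" unfolding w'_def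
        using w \<open>i \<in> I\<close> Vs.pinv_poly_in[OF g'inv] by (intro poly_in_add poly_in_mult) auto
      have "homogeneous (d i) (g' i * w i0 j)"
        using homogeneous_mult[OF homogeneous_hcomp w(2), of i0 "d i - d i0" "g i" j]
        by (cases "d i0 \<le> d i") (simp_all add: g'_def)
      then show "homogeneous (d i) (w' i j)" unfolding w'_def using w(2) \<open>i \<in> I\<close> by (intro homogeneous_add) auto
    next
      fix c assume c: "\<And>j. (\<Sum>i\<in>I. pconst (c i) * w' i j) \<in> Vs.pideal"
      \<comment> \<open>\<open>g' i\<close> is an invariant, so modulo the ideal only its constant
        term survives: \<open>w' i\<close> is congruent to \<open>w i\<close> plus a scalar multiple
        of \<open>w i0\<close>, and independence modulo the ideal is inherited.\<close>
      define k where "k i = Poly_Mapping.lookup (g' i) 0" for i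
      have k: "g' i - pconst (k i) \<in> Vs.pideal" if "i \<in> I" for i
      proof -
        obtain e where e: "homogeneous e (g' i)" unfolding g'_def by (metis homogeneous_0 homogeneous_hcomp)
        show ?thesis
        proof (cases "e = 0")
          case True
          then show ?thesis using homogeneous_0_const[of "g' i"] e by (simp add: k_def)
        next
          case False
          then have "g' i \<in> Vs.pideal" using Vs.pinv_homogeneous_pideal[OF g'inv[OF that] e] by simp
          then show ?thesis using Vs.pideal_lookup_0 by (simp add: k_def)
        qed
      qed
      let ?c = "\<lambda>i. if i = i0 then (\<Sum>i\<in>I. c i * k i) else c i"
      have "(\<Sum>i\<in>insert i0 I. pconst (?c i) * w i j) \<in> Vs.pideal" for j
      proof -
        have ne: "i \<noteq> i0" if "i \<in> I" for i using that insert.hyps by auto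
        have "(\<Sum>i\<in>insert i0 I. pconst (?c i) * w i j) = pconst (\<Sum>i\<in>I. c i * k i) * w i0 j + (\<Sum>i\<in>I. pconst (c i) * w i j)"
          unfolding sum.insert[OF insert.hyps] using ne by (auto intro!: sum.cong)
        also have "\<dots> = (\<Sum>i\<in>I. pconst (c i) * w' i j) - (\<Sum>i\<in>I. (pconst (c i) * w i0 j) * (g' i - pconst (k i)))"
          unfolding w'_def pconst_sum
          by (simp add: sum_distrib_right sum_distrib_left sum.distrib sum_subtractf pconst_mult algebra_simps)
        also have "\<dots> \<in> Vs.pideal"
          by (rule Vs.pideal_diff[OF c Vs.pideal_sum], rule Vs.pideal_mult[OF k])
             (auto intro!: poly_in_mult w)
        finally show ?thesis .
      qed
      then have "\<forall>i\<in>insert i0 I. ?c i = 0" by (rule ind)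
      then show "\<forall>i\<in>I. c i = 0" using insert.hyps(2) by (metis insertI2)
    next
      fix j
      have "(\<Sum>i\<in>I. h i * w' i j) = (\<Sum>i\<in>I. h i * w i j) + (\<Sum>i\<in>I. g' i * h i) * w i0 j"
        by (simp add: w'_def distrib_left sum.distrib sum_distrib_left sum_distrib_right mult_ac)
      then show "(\<Sum>i\<in>I. h i * w' i j) = 0" using rel[of j] g' by (simp add: add.commute)
    qed (use h in auto)
    then show ?thesis using g' by simp
  qed
qed

text \<open>A relation splits into its components of fixed total degree, and each of them satisfies
  the degree condition of \<open>homogeneous_independent_aux\<close>.\<close>

lemma homogeneous_independent:
  assumes "finite I"
    and w: "\<And>i j. i \<in> I \<Longrightarrow> poly_in n (w i j)" "\<And>i j. i \<in> I \<Longrightarrow> homogeneous (d i) (w i j)"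
    and ind: "\<And>c. (\<And>j. (\<Sum>i\<in>I. pconst (c i) * w i j) \<in> Vs.pideal) \<Longrightarrow> \<forall>i\<in>I. c i = 0"
    and h: "\<And>i. i \<in> I \<Longrightarrow> h i \<in> Vs.pinv"
    and rel: "\<And>j. (\<Sum>i\<in>I. h i * w i j) = 0"
  shows "\<forall>i\<in>I. h i = 0"
proof
  fix i assume "i \<in> I"
  show "h i = 0"
  proof (rule hcomp_eqI)
    fix e
    \<comment> \<open>The total degree in which the degree \<open>e\<close> part of
      \<open>h i\<close> meets \<open>w i\<close>.\<close>
    define D where "D = e + d i"
    define h' :: "_ \<Rightarrow> 'a mpoly" where "h' k = (if d k \<le> D then hcomp (D - d k) (h k) else 0)" for k
    have h'rel: "(\<Sum>k\<in>I. h' k * w k j) = 0" for j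
    proof -
      have "(\<Sum>k\<in>I. h' k * w k j) = hcomp D (\<Sum>k\<in>I. h k * w k j)"
        unfolding hcomp_sum using w(2) by (intro sum.cong) (simp_all add: hcomp_mult_homogeneous[OF w(2)] h'_def)
      then show ?thesis using rel by simp
    qed
    have h'deg: "h' k = 0 \<or> (\<exists>e. homogeneous e (h' k) \<and> e + d k = D)" for k
      unfolding h'_def using homogeneous_hcomp le_add_diff_inverse2 by (metis (full_types))
    have h'inv: "h' k \<in> Vs.pinv" if "k \<in> I" for k using h[OF that] by (simp add: h'_def Vs.pinv_hcomp)
    have "\<forall>k\<in>I. h' k = 0"
      by (rule homogeneous_independent_aux[where w = w and d = d and D = D, OF assms(1)])
         (assumption | rule w ind h'inv h'deg h'rel)+
    then have "h' i = 0" using \<open>i \<in> I\<close> by simp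
    then show "hcomp e (h i) = hcomp e 0" by (simp add: h'_def D_def)
  qed
qed

end

subsection \<open>Exterior algebra\<close>

text \<open>Coefficients of the wedge of the one-forms \<open>c s\<close>, with \<open>s\<close>
  running through \<open>xs\<close>. The coefficient ring is left open: scalars give
  \<open>act_wedge\<close>, polynomials give wedges of the rows of \<open>t\<close>.\<close>

abbreviation wedge_prod :: "nat \<Rightarrow> ('i \<Rightarrow> nat \<Rightarrow> 'b) \<Rightarrow> 'i list \<Rightarrow> nat set \<Rightarrow> 'b::comm_ring_1" where
  "wedge_prod r c xs \<equiv> foldr (\<lambda>s. eps_lin r (c s)) xs ext_one"

text \<open>For \<open>i < j\<close> in \<open>T\<close>, removing \<open>i\<close> lowers the
  position of \<open>j\<close> by one, whereas removing \<open>j\<close> leaves the position of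
  \<open>i\<close> unchanged; this is the one extra sign.\<close>

lemma eps_eps_anti: "i \<noteq> j \<Longrightarrow> eps i (eps j E) T = - eps j (eps i E) T"
proof (induction i j rule: linorder_wlog)
  case (le i j)
  show ?case
  proof (cases "i \<in> T \<and> j \<in> T")
    case True
    have "{s \<in> T. s < j} = insert i {s \<in> T - {i}. s < j}" using True le by auto
    then have "card {s \<in> T. s < j} = Suc (card {s \<in> T - {i}. s < j})" by simp
    moreover have "{s \<in> T - {j}. s < i} = {s \<in> T. s < i}" using le by auto
    moreover have "T - {i} - {j} = T - {j} - {i}" by auto
    ultimately show ?thesis using True le by (simp add: eps_def)
  qed (auto simp: eps_def)
next
  case (sym i j) then show ?case by (metis minus_minus)
qed

lemma eps_eps_same: "eps i (eps i E) T = 0"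
  by (simp add: eps_def)

lemma eps_sum: "eps i (\<lambda>T. \<Sum>k\<in>K. F k T) T = (\<Sum>k\<in>K. eps i (F k) T)"
  by (simp add: eps_def sum_distrib_left)

lemma eps_mult: "eps i (\<lambda>T. a * F T) T = a * eps i F T"
  by (simp add: eps_def mult.left_commute)

lemma eps_lin_sum: "eps_lin r c (\<lambda>T. \<Sum>k\<in>K. F k T) T = (\<Sum>k\<in>K. eps_lin r c (F k) T)"
  unfolding eps_lin_def eps_sum sum_distrib_left by (rule sum.swap)

lemma eps_lin_mult: "eps_lin r c (\<lambda>T. a * F T) T = a * eps_lin r c F T"
  unfolding eps_lin_def eps_mult sum_distrib_left by (simp add: mult.left_commute)

lemma eps_lin_cong: "(\<And>i. i < r \<Longrightarrow> c i = d i) \<Longrightarrow> eps_lin r c E = eps_lin r d E"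
  unfolding eps_lin_def by (intro ext sum.cong) auto

lemma eps_lin_zero: "eps_lin r c (\<lambda>_. 0) T = 0"
  by (simp add: eps_lin_def eps_def)

lemma eps_lin_eps_lin:
  "eps_lin r c (eps_lin r d E) T = (\<Sum>i<r. \<Sum>j<r. c i * d j * eps i (eps j E) T)"
  unfolding eps_lin_def[of r d] unfolding eps_lin_def[of r c] eps_sum eps_mult
  by (simp add: sum_distrib_left mult.assoc)

lemma eps_lin_anti: "eps_lin r c (eps_lin r d E) T = - eps_lin r d (eps_lin r c E) T"
proof -
  have "eps i (eps j E) T = - eps j (eps i E) T" for i j
    by (cases "i = j") (simp_all add: eps_eps_same eps_eps_anti[of i j])
  then have "eps_lin r c (eps_lin r d E) T = (\<Sum>i<r. \<Sum>j<r. c i * d j * - eps j (eps i E) T)"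
    unfolding eps_lin_eps_lin by (intro sum.cong refl) metis
  also have "\<dots> = - (\<Sum>j<r. \<Sum>i<r. d j * c i * eps j (eps i E) T)"
    by (subst sum.swap) (simp add: sum_negf mult.commute mult.left_commute)
  finally show ?thesis unfolding eps_lin_eps_lin .
qed

lemma eps_lin_same: "eps_lin r c (eps_lin r c E) T = (0 :: 'b::{idom, ring_char_0})"
  using eps_lin_anti[of r c c E T] by (simp add: eq_neg_iff_add_eq_0 flip: mult_2)

lemma wedge_prod_support:
  "\<not> T \<subseteq> {..<r} \<Longrightarrow> wedge_prod r c xs T = 0"
proof (induction xs arbitrary: T)
  case Nil then show ?case by (auto simp: ext_one_def)
next
  case (Cons x xs)
  have "eps i (wedge_prod r c xs) T = 0" if "i < r" for i
  proof -
    have "\<not> T - {i} \<subseteq> {..<r}" using that Cons.prems by auto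
    then show ?thesis by (simp add: eps_def Cons.IH)
  qed
  then show ?case by (simp add: eps_lin_def[of r "c x"])
qed

lemma wedge_prod_mem:
  fixes c :: "'i \<Rightarrow> nat \<Rightarrow> 'b::{idom, ring_char_0}"
  shows "x \<in> set xs \<Longrightarrow> eps_lin r (c x) (wedge_prod r c xs) T = 0"
proof (induction xs arbitrary: T)
  case (Cons y ys)
  show ?case
  proof (cases "x = y")
    case True then show ?thesis by (simp add: eps_lin_same)
  next
    case False
    then have "eps_lin r (c x) (wedge_prod r c ys) = (\<lambda>_. 0)" using Cons by auto
    then show ?thesis by (simp add: eps_lin_anti[of r "c x"] eps_lin_zero)
  qed
qed simp

text \<open>On its way to its sorted place \<open>x\<close> passes the smaller entries, at the cost
  of one sign each.\<close>

lemma wedge_prod_insort: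
  fixes c :: "nat \<Rightarrow> nat \<Rightarrow> 'b::comm_ring_1"
  assumes "sorted xs" "distinct xs" "x \<notin> set xs"
  shows "eps_lin r (c x) (wedge_prod r c xs) T
    = (- 1) ^ card {s \<in> set xs. s < x} * wedge_prod r c (insort x xs) T"
  using assms
proof (induction xs arbitrary: T)
  case (Cons y ys)
  show ?case
  proof (cases "x \<le> y")
    case True
    then have "{s \<in> set (y # ys). s < x} = {}" using Cons.prems by auto
    then show ?thesis using True by (simp only: card.empty insort_key.simps) simp
  next
    case False
    have "{s \<in> set (y # ys). s < x} = insert y {s \<in> set ys. s < x}" using False by auto
    then have card: "card {s \<in> set (y # ys). s < x} = Suc (card {s \<in> set ys. s < x})"
      using Cons.prems by simp
    have IH: "eps_lin r (c x) (wedge_prod r c ys)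
        = (\<lambda>T. (- 1) ^ card {s \<in> set ys. s < x} * wedge_prod r c (insort x ys) T)"
      using Cons by auto
    show ?thesis
      unfolding card using False
      by (simp add: eps_lin_anti[of r "c x"] IH eps_lin_mult)
  qed
qed simp

lemma wedge_prod_insert:
  fixes c :: "nat \<Rightarrow> nat \<Rightarrow> 'b::comm_ring_1"
  assumes "finite S" "x \<notin> S"
  shows "eps_lin r (c x) (wedge_prod r c (sorted_list_of_set S)) T
    = (- 1) ^ card {s \<in> S. s < x} * wedge_prod r c (sorted_list_of_set (insert x S)) T"
  using wedge_prod_insort[of "sorted_list_of_set S" x r c T] assms by (simp add: sorted_list_of_set_insert)

text \<open>Used with \<open>pconst\<close>, to compare scalar with polynomial coefficients, and
  with the action of a group element on coefficients.\<close>

lemma wedge_prod_hom: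
  assumes f: "\<And>a b. f (a + b) = f a + f b" "\<And>a b. f (a * b) = f a * f b" "f 1 = 1" "f 0 = 0"
  shows "f (wedge_prod r c xs T) = wedge_prod r (\<lambda>s j. f (c s j)) xs T"
proof (induction xs arbitrary: T)
  case Nil then show ?case by (simp add: ext_one_def f)
next
  case (Cons x xs)
  have f_sum: "f (\<Sum>i<k. g i) = (\<Sum>i<k. f (g i))" for g and k :: nat
    by (induction k) (simp_all add: f)
  have "f (- 1) = - 1" using f(1)[of "- 1" 1] f(3,4) by (simp add: eq_neg_iff_add_eq_0)
  then have f_pow: "f ((- 1) ^ k) = (- 1) ^ k" for k by (induction k) (simp_all only: power_0 power_Suc f)
  show ?case
    by (simp add: eps_lin_def[of r "c x"] eps_lin_def[of r "\<lambda>j. f (c x j)"] f_sum f)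
       (auto simp: eps_def f f_pow Cons.IH intro!: sum.cong)
qed

lemma wedge_prod_cong:
  assumes "\<And>s j. s \<in> set xs \<Longrightarrow> j < r \<Longrightarrow> c s j = d s j"
  shows "wedge_prod r c xs = wedge_prod r d xs"
  using assms by (induction xs) (auto intro: eps_lin_cong)

lemma wedge_prod_unit:
  assumes "sorted xs" "distinct xs" "set xs \<subseteq> {..<r}"
  shows "wedge_prod r (\<lambda>s j. if j = s then 1 else 0) xs T = (if T = set xs then 1 else 0)"
  using assms
proof (induction xs arbitrary: T)
  case Nil then show ?case by (simp add: ext_one_def)
next
  case (Cons x xs)
  have IH: "wedge_prod r (\<lambda>s j. if j = s then 1 else 0 :: 'a) xs = (\<lambda>T. if T = set xs then 1 else 0)"
    using Cons by auto
  have unit: "eps_lin r (\<lambda>j. if j = x then 1 else 0) E T = (eps x E T :: 'a)" for E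
  proof -
    have "eps_lin r (\<lambda>j. if j = x then 1 else 0) E T = (\<Sum>i<r. if i = x then eps x E T else 0)"
      unfolding eps_lin_def by (intro sum.cong) auto
    then show ?thesis using Cons.prems by simp
  qed
  have card: "card {s \<in> T. s < x} = 0" if "x \<in> T" "T - {x} = set xs"
  proof -
    have "\<not> s < x" if "s \<in> T" for s
    proof
      assume "s < x"
      then have "s \<in> set xs" using \<open>T - {x} = set xs\<close> that by blast
      then show False using Cons.prems \<open>s < x\<close> by auto
    qed
    then have "{s \<in> T. s < x} = {}" by blast
    then show ?thesis by simp
  qed
  have set: "T = set (x # xs) \<longleftrightarrow> x \<in> T \<and> T - {x} = set xs" using Cons.prems by auto
  have "wedge_prod r (\<lambda>s j. if j = s then 1 else 0 :: 'a) (x # xs) T = eps x (\<lambda>T. if T = set xs then 1 else 0) T"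
    by (simp only: foldr_Cons comp_apply IH unit)
  also have "\<dots> = (if x \<in> T \<and> T - {x} = set xs then 1 else 0)"
  proof (cases "x \<in> T \<and> T - {x} = set xs")
    case True
    then have "card {s \<in> T. s < x} = 0" using card by blast
    then show ?thesis using True by (simp only: eps_def) simp
  qed (auto simp: eps_def)
  finally show ?case unfolding set .
qed

text \<open>The endomorphism of the exterior algebra induced by the linear map that sends the
  \<open>j\<close>-th basis form to the form with coefficients \<open>R j\<close>.\<close>

definition wedge_map :: "nat \<Rightarrow> (nat \<Rightarrow> nat \<Rightarrow> 'b) \<Rightarrow> (nat set \<Rightarrow> 'b) \<Rightarrow> nat set \<Rightarrow> 'b::comm_ring_1" where
  "wedge_map r R E T = (\<Sum>S\<in>Pow {..<r}. E S * wedge_prod r R (sorted_list_of_set S) T)"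

text \<open>On the right, sets containing \<open>j\<close> drop out because of a repeated factor; on
  the left, only sets containing \<open>j\<close> contribute. Inserting \<open>j\<close> matches the
  remaining terms, with the sign of \<open>wedge_prod_insert\<close>.\<close>

lemma wedge_map_eps:
  fixes R :: "nat \<Rightarrow> nat \<Rightarrow> 'b::{idom, ring_char_0}"
  assumes "j < r"
  shows "wedge_map r R (eps j E) T = eps_lin r (R j) (wedge_map r R E) T"
proof -
  let ?w = "\<lambda>S. wedge_prod r R (sorted_list_of_set S)"
  have fin: "finite S" if "S \<subseteq> {..<r}" for S using that finite_subset by blast
  have "eps_lin r (R j) (wedge_map r R E) T = (\<Sum>S\<in>Pow {..<r}. E S * eps_lin r (R j) (?w S) T)"
  proof -
    have "wedge_map r R E = (\<lambda>T. \<Sum>S\<in>Pow {..<r}. E S * ?w S T)" by (simp add: wedge_map_def[abs_def])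
    then have "eps_lin r (R j) (wedge_map r R E) T = eps_lin r (R j) (\<lambda>T. \<Sum>S\<in>Pow {..<r}. E S * ?w S T) T"
      by (rule arg_cong)
    also have "\<dots> = (\<Sum>S\<in>Pow {..<r}. eps_lin r (R j) (\<lambda>T. E S * ?w S T) T)"
      by (rule eps_lin_sum)
    also have "\<dots> = (\<Sum>S\<in>Pow {..<r}. E S * eps_lin r (R j) (?w S) T)"
      by (rule sum.cong[OF refl], rule eps_lin_mult)
    finally show ?thesis .
  qed
  also have "\<dots> = (\<Sum>S | S \<subseteq> {..<r} \<and> j \<notin> S. E S * eps_lin r (R j) (?w S) T)"
    by (rule sum.mono_neutral_right) (auto simp: wedge_prod_mem fin)
  also have "\<dots> = (\<Sum>S | S \<subseteq> {..<r} \<and> j \<in> S. eps j E S * ?w S T)"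
  proof (rule sum.reindex_bij_witness[of _ "\<lambda>S. S - {j}" "\<lambda>S. insert j S"])
    fix S assume S: "S \<in> {S. S \<subseteq> {..<r} \<and> j \<notin> S}"
    have "{s \<in> insert j S. s < j} = {s \<in> S. s < j}" by auto
    then show "eps j E (insert j S) * ?w (insert j S) T = E S * eps_lin r (R j) (?w S) T"
      using S fin[of S] by (simp add: eps_def wedge_prod_insert)
  qed (use assms in auto)
  also have "\<dots> = wedge_map r R (eps j E) T"
    unfolding wedge_map_def by (rule sum.mono_neutral_left) (auto simp: eps_def)
  finally show ?thesis by simp
qed

lemma wedge_map_eps_lin:
  fixes R :: "nat \<Rightarrow> nat \<Rightarrow> 'b::{idom, ring_char_0}"
  shows "wedge_map r R (eps_lin r c E) T = eps_lin r (\<lambda>k. \<Sum>j<r. c j * R j k) (wedge_map r R E) T"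
proof -
  have "wedge_map r R (eps_lin r c E) T = (\<Sum>j<r. c j * wedge_map r R (eps j E) T)"
    unfolding wedge_map_def eps_lin_def[of r c] sum_distrib_left sum_distrib_right
    by (subst sum.swap) (simp add: mult.assoc)
  also have "\<dots> = (\<Sum>j<r. c j * eps_lin r (R j) (wedge_map r R E) T)"
    by (simp add: wedge_map_eps)
  also have "\<dots> = eps_lin r (\<lambda>k. \<Sum>j<r. c j * R j k) (wedge_map r R E) T"
    unfolding eps_lin_def sum_distrib_left sum_distrib_right by (subst sum.swap) (simp add: mult.assoc)
  finally show ?thesis .
qed

lemma wedge_map_ext_one: "wedge_map r R ext_one = ext_one"
proof
  fix T
  have "wedge_map r R ext_one T = (\<Sum>S\<in>Pow {..<r}. if S = {} then wedge_prod r R [] T else 0)"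
    unfolding wedge_map_def by (intro sum.cong refl) (auto simp: ext_one_def)
  then show "wedge_map r R ext_one T = ext_one T" by simp
qed

text \<open>Functoriality of the exterior algebra. Multiplicativity of \<open>act_wedge\<close> and
  invariance of wedges of invariant vectors both come from here.\<close>

lemma wedge_map_wedge_prod:
  fixes R :: "nat \<Rightarrow> nat \<Rightarrow> 'b::{idom, ring_char_0}"
  shows "wedge_map r R (wedge_prod r c xs) = wedge_prod r (\<lambda>s k. \<Sum>j<r. c s j * R j k) xs"
  by (induction xs) (auto simp: wedge_map_ext_one wedge_map_eps_lin)

text \<open>The coefficients are minors: multiplying by the first form is Laplace expansion along
  the first row. The sign in \<open>eps\<close> counts the elements of \<open>T\<close> below the
  removed one, that is, its column index.\<close>

lemma wedge_prod_det:
  fixes c :: "'i \<Rightarrow> nat \<Rightarrow> 'b::comm_ring_1"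
  assumes "T \<subseteq> {..<r}" "card T = length xs"
  shows "wedge_prod r c xs T
    = det (mat (length xs) (length xs) (\<lambda>(a, b). c (xs ! a) (sorted_list_of_set T ! b)))"
  using assms
proof (induction xs arbitrary: T)
  case Nil
  then have "T = {}" using finite_subset by fastforce
  then show ?case by (simp add: ext_one_def det_dim_zero)
next
  case (Cons x xs)
  let ?k = "length xs"
  let ?L = "sorted_list_of_set T"
  let ?A = "mat (Suc ?k) (Suc ?k) (\<lambda>(a, b). c ((x # xs) ! a) (?L ! b))"
  have finT: "finite T" using Cons.prems finite_subset by blast
  have L: "set ?L = T" "sorted ?L" "distinct ?L" "length ?L = Suc ?k"
    using finT Cons.prems by auto
  have cof: "(- 1) ^ card {s \<in> T. s < ?L ! b} * wedge_prod r c xs (T - {?L ! b}) = cofactor ?A 0 b"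
    if b: "b < Suc ?k" for b
  proof -
    have sl: "?L ! i < ?L ! j" if "i < j" "j < Suc ?k" for i j
      using sorted_wrt_nth_less[of "(<)" ?L i j] that L by (simp add: strict_sorted_iff)
    have "{s \<in> T. s < ?L ! b} = (\<lambda>i. ?L ! i) ` {..<b}"
    proof (intro equalityI subsetI)
      fix s assume "s \<in> {s \<in> T. s < ?L ! b}"
      then obtain i where i: "i < Suc ?k" "s = ?L ! i" "?L ! i < ?L ! b"
        using L(1,4) by (metis (mono_tags, lifting) in_set_conv_nth mem_Collect_eq)
      then have "i < b" using sl[of b i] by (metis less_asym linorder_neqE_nat)
      then show "s \<in> (\<lambda>i. ?L ! i) ` {..<b}" using i by auto
    next
      fix s assume "s \<in> (\<lambda>i. ?L ! i) ` {..<b}"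
      then obtain i where "i < b" "s = ?L ! i" by auto
      then show "s \<in> {s \<in> T. s < ?L ! b}" using sl[of i b] b L(1,4) nth_mem[of i ?L] by auto
    qed
    moreover have "inj_on (\<lambda>i. ?L ! i) {..<b}"
      using L(3,4) b by (auto simp: inj_on_def nth_eq_iff_index_eq)
    ultimately have card: "card {s \<in> T. s < ?L ! b} = b" by (simp add: card_image)
    let ?M = "take b ?L @ drop (Suc b) ?L"
    have split: "?L = take b ?L @ ?L ! b # drop (Suc b) ?L" using b L(4) by (simp add: id_take_nth_drop)
    have "sorted (take b ?L @ ?L ! b # drop (Suc b) ?L)" "distinct (take b ?L @ ?L ! b # drop (Suc b) ?L)"
      using L(2,3) unfolding split[symmetric] .
    then have M: "sorted ?M" "distinct ?M" by (auto simp: sorted_append)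
    have "T = set (take b ?L @ ?L ! b # drop (Suc b) ?L)" using L(1) unfolding split[symmetric] by simp
    moreover have "?L ! b \<notin> set ?M"
      using \<open>distinct (take b ?L @ ?L ! b # drop (Suc b) ?L)\<close> by auto
    ultimately have "set ?M = T - {?L ! b}" by auto
    then have Leq: "sorted_list_of_set (T - {?L ! b}) = ?M"
      using sorted_list_of_set.idem_if_sorted_distinct[OF M] by simp
    have "wedge_prod r c xs (T - {?L ! b})
        = det (mat ?k ?k (\<lambda>(a, b'). c (xs ! a) (sorted_list_of_set (T - {?L ! b}) ! b')))"
      using Cons.prems finT L(1,4) b nth_mem[of b ?L] by (intro Cons.IH) (auto simp: card_Diff_singleton)
    also have "mat ?k ?k (\<lambda>(a, b'). c (xs ! a) (sorted_list_of_set (T - {?L ! b}) ! b')) = mat_delete ?A 0 b"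
      unfolding Leq using b L(4)
      by (intro eq_matI) (auto simp: mat_delete_def nth_append min_def)
    finally show ?thesis by (simp add: card cofactor_def)
  qed
  have "wedge_prod r c (x # xs) T = (\<Sum>i<r. c x i * eps i (wedge_prod r c xs) T)"
    by (simp add: eps_lin_def)
  also have "\<dots> = (\<Sum>i\<in>T. c x i * eps i (wedge_prod r c xs) T)"
    using Cons.prems by (intro sum.mono_neutral_right) (auto simp: eps_def)
  also have "\<dots> = (\<Sum>b<Suc ?k. c x (?L ! b) * eps (?L ! b) (wedge_prod r c xs) T)"
    using L by (intro sum.reindex_bij_betw[symmetric] bij_betw_nth) auto
  also have "\<dots> = (\<Sum>b<Suc ?k. ?A $$ (0, b) * cofactor ?A 0 b)"
  proof (intro sum.cong refl)
    fix b assume "b \<in> {..<Suc ?k}"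
    then have "b < Suc ?k" "?L ! b \<in> T" using L(1,4) nth_mem[of b ?L] by auto
    then show "c x (?L ! b) * eps (?L ! b) (wedge_prod r c xs) T = ?A $$ (0, b) * cofactor ?A 0 b"
      by (simp add: cof[symmetric] eps_def)
  qed
  also have "\<dots> = det ?A"
    by (rule laplace_expansion_row[symmetric]) auto
  finally show ?case by simp
qed

lemma wedge_prod_top: "wedge_prod r c [0..<r] {..<r} = det (mat r r (\<lambda>(i, j). c i j))"
proof -
  have "sorted_list_of_set {..<r} = [0..<r]" by (simp add: lessThan_atLeast0)
  moreover have "mat r r (\<lambda>(a, b). c ([0..<r] ! a) ([0..<r] ! b)) = mat r r (\<lambda>(i, j). c i j)"
    by (rule eq_matI) auto
  ultimately show ?thesis using wedge_prod_det[of "{..<r}" r "[0..<r]" c] by simp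
qed

subsection \<open>Representations\<close>

lemma diff_op_sgn_mult:
  fixes p :: "'a::field_char_0 mpoly"
  shows "diff_op ((- 1) ^ k * s) p = (- 1) ^ k * diff_op s p"
proof -
  have "(- 1 :: 'a mpoly) ^ k = pconst ((- 1) ^ k)" by (induction k) (simp_all add: pconst_minus pconst_mult)
  then show ?thesis by (simp add: diff_op_pconst_mult)
qed

lemma pairing_eqI_vars:
  fixes f g :: "'a::field_char_0 mpoly"
  assumes "vars_in A f" "vars_in A g" "\<And>m. Poly_Mapping.keys m \<subseteq> A \<Longrightarrow> pairing f (pmonom m) = pairing g (pmonom m)"
  shows "f = g"
proof (rule pairing_eqI)
  fix m
  show "pairing f (pmonom m) = pairing g (pmonom m)"
  proof (cases "Poly_Mapping.keys m \<subseteq> A")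
    case False
    then have "Poly_Mapping.lookup f m = 0" "Poly_Mapping.lookup g m = 0"
      using assms(1,2) by (auto simp: vars_in_def in_keys_iff)
    then show ?thesis by (simp add: pairing_pmonom_right)
  qed (rule assms(3))
qed

text \<open>Constant coefficient operators compose like their symbols, so \<open>d_star\<close> acts
  on the symbol \<open>X\<close> as left multiplication by the one-form \<open>t i\<close>.
  Questions about the operators thus become questions about forms with coefficients in
  \<open>S(V)\<close>.\<close>

lemma d_star_diff_op:
  fixes t :: "nat \<Rightarrow> nat \<Rightarrow> 'a::field_char_0 mpoly"
  shows "d_star r t i (\<lambda>T. diff_op (X T) p) = (\<lambda>T. diff_op (eps_lin r (t i) X T) p)"
proof
  fix T
  have "eps j (\<lambda>S. diff_op (t i j) (diff_op (X S) p)) T = diff_op (t i j * eps j X T) p" for j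
    by (cases "j \<in> T")
       (simp_all add: eps_def mult.left_commute[of "t i j"] diff_op_sgn_mult flip: diff_op_mult)
  then show "d_star r t i (\<lambda>T. diff_op (X T) p) T = diff_op (eps_lin r (t i) X T) p"
    by (simp add: d_star_def eps_lin_def diff_op_sum)
qed

lemma foldr_d_star_diff_op:
  fixes t :: "nat \<Rightarrow> nat \<Rightarrow> 'a::field_char_0 mpoly"
  shows "foldr (d_star r t) xs (\<lambda>T. diff_op (X T) p) = (\<lambda>T. diff_op (foldr (\<lambda>i. eps_lin r (t i)) xs X T) p)"
  by (induction xs) (simp_all add: d_star_diff_op)

lemma basis_elem_eq:
  fixes t :: "nat \<Rightarrow> nat \<Rightarrow> 'a::field_char_0 mpoly"
  shows "basis_elem r t p I T = diff_op (wedge_prod r t (sorted_list_of_set I) T) p"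
proof -
  have "(\<lambda>T. if T = {} then p else 0) = (\<lambda>T :: nat set. diff_op (ext_one T) p)"
    by (auto simp: ext_one_def)
  then show ?thesis by (simp add: basis_elem_def foldr_d_star_diff_op)
qed

lemma vars_in_wedge_prod:
  fixes c :: "'i \<Rightarrow> nat \<Rightarrow> 'a::field_char_0 mpoly"
  assumes "\<And>i j. i \<in> set xs \<Longrightarrow> j < r \<Longrightarrow> vars_in A (c i j)"
  shows "vars_in A (wedge_prod r c xs T)"
  using assms
proof (induction xs arbitrary: T)
  case Nil then show ?case by (simp add: ext_one_def)
next
  case (Cons x xs)
  have s: "vars_in A ((- 1 :: 'a mpoly) ^ k)" for k
    by (induction k) (auto intro: vars_in_minus)
  show ?case
    unfolding foldr_Cons comp_apply eps_lin_def[of r "c x"] eps_def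
    using Cons s by (auto intro!: vars_in_sum vars_in_mult)
qed

lemma homogeneous_wedge_prod:
  fixes c :: "'i \<Rightarrow> nat \<Rightarrow> 'a::field_char_0 mpoly"
  assumes "\<And>i j. i \<in> set xs \<Longrightarrow> j < r \<Longrightarrow> homogeneous (d i) (c i j)"
  shows "homogeneous (\<Sum>i\<leftarrow>xs. d i) (wedge_prod r c xs T)"
  using assms
proof (induction xs arbitrary: T)
  case Nil then show ?case by (simp add: ext_one_def)
next
  case (Cons x xs)
  have s: "homogeneous 0 ((- 1 :: 'a mpoly) ^ k)" for k
  proof (induction k)
    case (Suc k) then show ?case by (simp add: homogeneous_minus)
  qed simp
  have t: "homogeneous (\<Sum>i\<leftarrow>xs. d i) (eps j (wedge_prod r c xs) T)" for j
  proof (cases "j \<in> T")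
    case True
    have "homogeneous (0 + (\<Sum>i\<leftarrow>xs. d i)) ((- 1) ^ card {s \<in> T. s < j} * wedge_prod r c xs (T - {j}))"
      using Cons by (intro homogeneous_mult s) auto
    then show ?thesis using True by (simp add: eps_def)
  qed (simp add: eps_def)
  show ?case
    unfolding foldr_Cons comp_apply eps_lin_def[of r "c x"] list.map sum_list.Cons
    using Cons.prems by (intro homogeneous_sum homogeneous_mult t) auto
qed

context matrix_group
begin

text \<open>Equivariance of differentiation, obtained from the adjunction and the invariance of the
  pairing.\<close>

lemma actVs_diff_op:
  assumes g: "g \<in> G" and s: "poly_in n s" and f: "poly_in n f"
  shows "actVs n G g (diff_op s f) = diff_op (actV n g s) (actVs n G g f)"
proof (rule pairing_eqI_vars[where A = "{..<n}"])
  have d: "poly_in n (diff_op s f)" using f vars_in_diff_op by (auto simp: poly_in_vars_in)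
  then show "vars_in {..<n} (actVs n G g (diff_op s f))"
    using Vs.poly_in_act g by (simp add: poly_in_vars_in)
  show "vars_in {..<n} (diff_op (actV n g s) (actVs n G g f))"
    using Vs.poly_in_act g f by (intro vars_in_diff_op) (simp add: poly_in_vars_in)
  fix m :: "nat \<Rightarrow>\<^sub>0 nat" assume "Poly_Mapping.keys m \<subseteq> {..<n}"
  then have m: "poly_in n (pmonom m :: 'a mpoly)" by (simp add: poly_in_pmonom)
  have "pairing (actVs n G g (diff_op s f)) (pmonom m) = pairing f (s * actV n (ginv n G g) (pmonom m))"
    by (simp add: pairing_actVs[OF g d m] pairing_diff_op)
  also have "\<dots> = pairing f (actV n (ginv n G g) (actV n g s * pmonom m))"
    by (simp add: V.act_mult V.act_ginv_act[OF g s])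
  also have "\<dots> = pairing (diff_op (actV n g s) (actVs n G g f)) (pmonom m)"
    by (simp add: pairing_actVs[OF g f poly_in_mult[OF V.poly_in_act[OF g s] m]] pairing_diff_op)
  finally show "pairing (actVs n G g (diff_op s f)) (pmonom m)
      = pairing (diff_op (actV n g s) (actVs n G g f)) (pmonom m)" .
qed

end

locale group_rep = matrix_group n G for n :: nat and G :: "'a::field_char_0 mat set" +
  fixes r :: nat and \<rho> :: "'a mat \<Rightarrow> 'a mat"
  assumes rep: "representation n r G \<rho>"
begin

lemma rho_carrier: "g \<in> G \<Longrightarrow> \<rho> g \<in> carrier_mat r r"
  and rho_one: "\<rho> (1\<^sub>m n) = 1\<^sub>m r"
  and rho_mult: "g \<in> G \<Longrightarrow> h \<in> G \<Longrightarrow> \<rho> (g * h) = \<rho> g * \<rho> h"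
  using rep by (auto simp: representation_def)

lemma rho_mult_index:
  assumes "g \<in> G" "h \<in> G" "i < r" "j < r"
  shows "\<rho> (g * h) $$ (i, j) = (\<Sum>k<r. \<rho> g $$ (i, k) * \<rho> h $$ (k, j))"
  unfolding rho_mult[OF assms(1,2)] using rho_carrier[OF assms(1)] rho_carrier[OF assms(2)] assms(3,4)
  by (simp add: scalar_prod_def lessThan_atLeast0)

lemma rho_ginv_mult_index:
  assumes "g \<in> G" "h \<in> G" "i < r" "j < r"
  shows "\<rho> (ginv n G (g * h)) $$ (i, j) = (\<Sum>k<r. \<rho> (ginv n G h) $$ (i, k) * \<rho> (ginv n G g) $$ (k, j))"
  unfolding ginv_mult[OF assms(1,2)] using assms by (intro rho_mult_index) auto

text \<open>The matrix of \<open>\<rho> g\<close> is transposed to fit the row vector convention.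
  The cut-off at \<open>r\<close> gives the value \<open>0\<close> that \<open>R_outside\<close>
  demands where matrix entries are unspecified.\<close>

sublocale SM: vec_action n G "actVs n G" "{..<r}" "\<lambda>g j k. if k < r then \<rho> g $$ (k, j) else 0"
proof
  fix g h j k assume "g \<in> G" "h \<in> G" "j \<in> {..<r}" "k \<in> {..<r}"
  then show "(if k < r then \<rho> (g * h) $$ (k, j) else 0)
      = (\<Sum>l<r. (if l < r then \<rho> h $$ (l, j) else 0) * (if k < r then \<rho> g $$ (k, l) else 0))"
    by (simp only: rho_mult_index lessThan_iff if_True) (rule sum.cong, auto)
qed (auto simp: rho_one)

sublocale SMs: vec_action n G "actV n" "{..<r}" "\<lambda>g j k. if k < r then \<rho> (ginv n G g) $$ (j, k) else 0"
proof
  fix g h j k assume "g \<in> G" "h \<in> G" "j \<in> {..<r}" "k \<in> {..<r}"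
  then show "(if k < r then \<rho> (ginv n G (g * h)) $$ (j, k) else 0)
      = (\<Sum>l<r. (if l < r then \<rho> (ginv n G h) $$ (j, l) else 0) * (if k < r then \<rho> (ginv n G g) $$ (l, k) else 0))"
    by (simp only: rho_ginv_mult_index lessThan_iff if_True) (rule sum.cong, auto)
qed (auto simp: rho_one)

lemma act_wedge_mult:
  assumes "g \<in> G" "h \<in> G" and S: "S \<in> Pow {..<r}"
  shows "act_wedge n r G \<rho> (g * h) S T = (\<Sum>U\<in>Pow {..<r}. act_wedge n r G \<rho> h S U * act_wedge n r G \<rho> g U T)"
proof -
  let ?R = "\<lambda>g s j. \<rho> (ginv n G g) $$ (s, j)"
  have "(\<Sum>U\<in>Pow {..<r}. act_wedge n r G \<rho> h S U * act_wedge n r G \<rho> g U T)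
      = wedge_map r (?R g) (wedge_prod r (?R h) (sorted_list_of_set S)) T"
    by (simp add: act_wedge_def wedge_map_def)
  also have "\<dots> = wedge_prod r (\<lambda>s k. \<Sum>j<r. ?R h s j * ?R g j k) (sorted_list_of_set S) T"
    by (simp only: wedge_map_wedge_prod)
  also have "\<dots> = wedge_prod r (?R (g * h)) (sorted_list_of_set S) T"
  proof -
    have "(\<Sum>j<r. ?R h s j * ?R g j k) = ?R (g * h) s k" if "s \<in> set (sorted_list_of_set S)" "k < r" for s k
      using that S assms finite_subset[of S "{..<r}"] by (subst rho_ginv_mult_index) auto
    from wedge_prod_cong[OF this] show ?thesis by (rule fun_cong)
  qed
  finally show ?thesis by (simp add: act_wedge_def)
qed

lemma act_wedge_one:
  assumes "S \<in> Pow {..<r}"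
  shows "act_wedge n r G \<rho> (1\<^sub>m n) S T = (if S = T then 1 else 0)"
proof -
  have fin: "finite S" using assms finite_subset by blast
  have "wedge_prod r (\<lambda>s j. \<rho> (ginv n G (1\<^sub>m n)) $$ (s, j)) (sorted_list_of_set S)
      = wedge_prod r (\<lambda>s j. if j = s then 1 else 0) (sorted_list_of_set S)"
    by (rule wedge_prod_cong) (use assms fin in \<open>auto simp: rho_one\<close>)
  then have "act_wedge n r G \<rho> (1\<^sub>m n) S T = wedge_prod r (\<lambda>s j. if j = s then 1 else 0) (sorted_list_of_set S) T"
    unfolding act_wedge_def by (rule fun_cong)
  also have "\<dots> = (if T = set (sorted_list_of_set S) then 1 else 0)"
    by (rule wedge_prod_unit) (use assms fin in auto)
  also have "\<dots> = (if S = T then 1 else 0)" using fin by auto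
  finally show ?thesis .
qed

lemma act_wedge_outside: "T \<notin> Pow {..<r} \<Longrightarrow> act_wedge n r G \<rho> g S T = 0"
  unfolding act_wedge_def by (rule wedge_prod_support) auto

text \<open>The space of the symbols: forms on \<open>M\<close> with coefficients in
  \<open>S(V)\<close>, in which products of the rows of \<open>t\<close> live.\<close>

sublocale SEV: vec_action n G "actV n" "Pow {..<r}" "act_wedge n r G \<rho>"
  by unfold_locales (auto simp: act_wedge_mult act_wedge_one act_wedge_outside)

lemma SM_vok: "tens_ok n r w \<longleftrightarrow> SM.vok w"
  by (auto simp: tens_ok_def SM.vok_def)

lemma SMs_vok: "tens_ok n r w \<longleftrightarrow> SMs.vok w"
  by (auto simp: tens_ok_def SMs.vok_def)

lemma SM_inv_eq: "SM_inv n r G \<rho> = SM.vinv"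
proof -
  have "actSM n r G \<rho> g w = SM.vact g w" for g w
    by (rule ext) (simp add: actSM_def SM.vact_def)
  then show ?thesis by (simp add: SM_inv_def SM.vinv_def SM_vok)
qed

lemma SMs_inv_eq: "SMs_inv n r G \<rho> = SMs.vinv"
proof -
  have "actSMs n r G \<rho> g w = SMs.vact g w" for g w
    by (rule ext) (simp add: actSMs_def SMs.vact_def)
  then show ?thesis by (simp add: SMs_inv_def SMs.vinv_def SMs_vok)
qed

lemma SEV_vact_wedge_prod:
  assumes g: "g \<in> G" and t: "\<And>i. i \<in> set xs \<Longrightarrow> t i \<in> SMs.vinv"
  shows "SEV.vact g (wedge_prod r t xs) T = wedge_prod r t xs T"
proof -
  let ?R = "\<lambda>s j. pconst (\<rho> (ginv n G g) $$ (s, j))"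
  have aw: "pconst (act_wedge n r G \<rho> g S T) = wedge_prod r ?R (sorted_list_of_set S) T" for S
    unfolding act_wedge_def by (rule wedge_prod_hom) (simp_all add: pconst_add pconst_mult)
  have at: "actV n g (wedge_prod r t xs S) = wedge_prod r (\<lambda>s j. actV n g (t s j)) xs S" for S
    by (rule wedge_prod_hom) (simp_all add: V.act_add V.act_mult)
  have "SEV.vact g (wedge_prod r t xs) T = wedge_map r ?R (wedge_prod r (\<lambda>s j. actV n g (t s j)) xs) T"
    unfolding SEV.vact_def wedge_map_def aw at by (simp add: mult.commute)
  also have "\<dots> = wedge_prod r (\<lambda>s k. \<Sum>j<r. actV n g (t s j) * ?R j k) xs T"
    by (simp only: wedge_map_wedge_prod)
  also have "\<dots> = wedge_prod r t xs T"
  proof -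
    have "(\<Sum>j<r. actV n g (t s j) * ?R j k) = t s k" if "s \<in> set xs" "k < r" for s k
      using fun_cong[OF SMs.vinv_vact[OF t[OF that(1)] g], of k] that(2)
      by (simp add: SMs.vact_def mult.commute)
    from wedge_prod_cong[OF this] show ?thesis by (rule fun_cong)
  qed
  finally show ?thesis .
qed

text \<open>The invariant pairing between vectors of \<open>SM\<close> and of \<open>SMs\<close>;
  the coordinates refer to dual bases of the two modules.\<close>

definition tpair :: "(nat \<Rightarrow> 'a mpoly) \<Rightarrow> (nat \<Rightarrow> 'a mpoly) \<Rightarrow> 'a" where
  "tpair w z = (\<Sum>k<r. pairing (w k) (z k))"

lemma tpair_vact:
  assumes g: "g \<in> G" and w: "SM.vok w" and z: "SMs.vok z"
  shows "tpair (SM.vact g w) z = tpair w (SMs.vact (ginv n G g) z)"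
proof -
  have "tpair (SM.vact g w) z = (\<Sum>k<r. \<Sum>j<r. \<rho> g $$ (k, j) * pairing (w j) (actV n (ginv n G g) (z k)))"
    unfolding tpair_def SM.vact_def using g SM.vok_poly_in[OF w] SMs.vok_poly_in[OF z]
    by (intro sum.cong refl) (simp add: pairing_sum_left pairing_pconst_mult_left pairing_actVs)
  also have "\<dots> = (\<Sum>j<r. \<Sum>k<r. \<rho> g $$ (k, j) * pairing (w j) (actV n (ginv n G g) (z k)))"
    by (rule sum.swap)
  also have "\<dots> = tpair w (SMs.vact (ginv n G g) z)"
    unfolding tpair_def SMs.vact_def using g
    by (intro sum.cong refl) (simp add: pairing_sum_right pairing_pconst_mult_right)
  finally show ?thesis .
qed

lemma det_rho_mult: "g \<in> G \<Longrightarrow> h \<in> G \<Longrightarrow> det (\<rho> (g * h)) = det (\<rho> g) * det (\<rho> h)"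
  unfolding rho_mult by (rule det_mult[OF rho_carrier rho_carrier])

lemma det_rho_ginv: "g \<in> G \<Longrightarrow> det (\<rho> g) * det (\<rho> (ginv n G g)) = 1"
  by (simp add: det_rho_mult[symmetric] rho_one)

lemma act_jacobian:
  fixes act :: "'a mpoly \<Rightarrow> 'a mpoly"
  assumes "\<And>p q. act (p + q) = act p + act q" "\<And>p q. act (p * q) = act p * act q" "act 1 = 1" "act 0 = 0"
    and R: "R \<in> carrier_mat r r"
    and w: "\<And>i k. i < r \<Longrightarrow> k < r \<Longrightarrow> w i k = (\<Sum>j<r. pconst (R $$ (j, k)) * act (w i j))"
  shows "jacobian r w = act (jacobian r w) * pconst (det R)"
proof -
  interpret h: comm_ring_hom act
    by unfold_locales (simp_all add: assms)
  interpret c: comm_ring_hom "pconst :: 'a \<Rightarrow> 'a mpoly"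
    by unfold_locales (simp_all add: pconst_add pconst_mult)
  let ?W = "mat r r (\<lambda>(i, j). w i j)"
  have "?W = map_mat act ?W * map_mat pconst R"
  proof (rule eq_matI)
    fix i k assume "i < dim_row (map_mat act ?W * map_mat pconst R)" "k < dim_col (map_mat act ?W * map_mat pconst R)"
    then have ik: "i < r" "k < r" using R by auto
    have "(map_mat act ?W * map_mat pconst R) $$ (i, k) = (\<Sum>j<r. act (w i j) * pconst (R $$ (j, k)))"
      using R ik by (simp add: scalar_prod_def lessThan_atLeast0)
    also have "\<dots> = w i k" unfolding w[OF ik] by (intro sum.cong refl mult.commute)
    finally show "?W $$ (i, k) = (map_mat act ?W * map_mat pconst R) $$ (i, k)" using ik by simp
  qed (use R in auto)
  then have "det ?W = det (map_mat act ?W * map_mat pconst R)" by (rule arg_cong)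
  also have "\<dots> = det (map_mat act ?W) * det (map_mat pconst R)"
    using R by (intro det_mult[of _ r]) auto
  finally show ?thesis unfolding jacobian_def h.hom_det c.hom_det .
qed

end

subsection \<open>Degrees of the two bases\<close>

text \<open>A basis of \<open>W\<close> together with \<open>x\<close> is independent, so its values
  can be prescribed.\<close>

lemma ex_tensor_functional:
  fixes W :: "(nat \<Rightarrow> 'a::field mpoly) set"
  assumes add: "\<And>w z. w \<in> W \<Longrightarrow> z \<in> W \<Longrightarrow> (\<lambda>k. w k + z k) \<in> W"
    and scale: "\<And>c w. w \<in> W \<Longrightarrow> (\<lambda>k. pconst c * w k) \<in> W"
    and zero: "(\<lambda>k. 0) \<in> W" and x: "x \<notin> W"
  shows "\<exists>l :: (nat \<Rightarrow> 'a mpoly) \<Rightarrow> 'a. (\<forall>w z. l (\<lambda>k. w k + z k) = l w + l z) \<and>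
    (\<forall>c w. l (\<lambda>k. pconst c * w k) = c * l w) \<and> l x = 1 \<and> (\<forall>w\<in>W. l w = 0)"
proof -
  interpret vector_space_pair "\<lambda>c (w :: nat \<Rightarrow> 'a mpoly) k. pconst c * w k" "(*) :: 'a \<Rightarrow> _"
    by unfold_locales (auto simp: plus_fun_def fun_eq_iff algebra_simps pconst_add pconst_mult)
  have W: "vs1.subspace W"
    unfolding vs1.subspace_def using add scale zero by (simp add: plus_fun_def zero_fun_def)
  obtain B where B: "B \<subseteq> W" "vs1.independent B" "W \<subseteq> vs1.span B"
    using vs1.basis_exists[of W] by metis
  have sp: "vs1.span B = W" using B W vs1.span_minimal[of B W] by blast
  then have "vs1.independent (insert x B)" using B x by (simp add: vs1.independent_insert)
  then obtain l where l: "Vector_Spaces.linear (\<lambda>c (w :: nat \<Rightarrow> 'a mpoly) k. pconst c * w k) (*) l"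
      "\<forall>b\<in>insert x B. l b = (if b = x then 1 else 0)"
    using linear_independent_extend[of "insert x B" "\<lambda>b. if b = x then 1 else 0"] by blast
  interpret l: Vector_Spaces.linear "\<lambda>c (w :: nat \<Rightarrow> 'a mpoly) k. pconst c * w k" "(*)" l by (fact l(1))
  have "l b = 0" if "b \<in> B" for b using that l(2) B(1) x by auto
  then have "l w = 0" if "w \<in> W" for w
    using l.eq_0_on_span[of B w] that sp by blast
  moreover have "l (\<lambda>k. w k + z k) = l w + l z" for w z using l.add[of w z] by (simp add: plus_fun_def)
  moreover have "l (\<lambda>k. pconst c * w k) = c * l w" for c w using l.scale[of c w] by simp
  ultimately show ?thesis using l(2) by auto
qed

lemma finite_monomials: "finite {m. Poly_Mapping.keys m \<subseteq> {..<n} \<and> tdeg m = e}"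
proof -
  let ?M = "{m. Poly_Mapping.keys m \<subseteq> {..<n} \<and> tdeg m = e}"
  let ?f = "\<lambda>m. restrict (Poly_Mapping.lookup m) {..<n}"
  have "?f m \<in> PiE {..<n} (\<lambda>_. {..e})" if "m \<in> ?M" for m
  proof -
    have "Poly_Mapping.lookup m i \<le> e" if "i < n" for i
      using member_le_sum[of i "{..<n}" "Poly_Mapping.lookup m"] tdeg_eq[of "{..<n}" m] that \<open>m \<in> ?M\<close> by auto
    then show ?thesis by (intro restrict_PiE_iff[THEN iffD2]) auto
  qed
  then have "?f ` ?M \<subseteq> PiE {..<n} (\<lambda>_. {..e})" by (rule image_subsetI)
  then have "finite (?f ` ?M)" by (rule finite_subset) (simp add: finite_PiE)
  moreover have "inj_on ?f ?M"
  proof (rule inj_onI)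
    fix m m' assume m: "m \<in> ?M" "m' \<in> ?M" "?f m = ?f m'"
    show "m = m'"
    proof (rule poly_mapping_eqI)
      fix i
      show "Poly_Mapping.lookup m i = Poly_Mapping.lookup m' i"
      proof (cases "i < n")
        case True then show ?thesis using fun_cong[OF m(3), of i] by simp
      next
        case False
        then have "i \<notin> Poly_Mapping.keys m" "i \<notin> Poly_Mapping.keys m'" using m by auto
        then show ?thesis by (simp add: in_keys_iff)
      qed
    qed
  qed
  ultimately show ?thesis by (rule finite_imageD)
qed

text \<open>Inequalities between the fibres whose totals agree are equalities.\<close>

lemma sum_eq_if_fibre_card_le:
  fixes f :: "'i \<Rightarrow> nat" and g :: "'j \<Rightarrow> nat"
  assumes A: "finite A" and B: "finite B" and card: "card A = card B"
    and le: "\<And>e. card {a \<in> A. f a = e} \<le> card {b \<in> B. g b = e}"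
  shows "sum f A = sum g B"
proof -
  define E where "E = f ` A \<union> g ` B"
  have E: "finite E" using A B by (simp add: E_def)
  have fA: "(\<Sum>e\<in>E. \<Sum>a | a \<in> A \<and> f a = e. h a) = sum h A" for h :: "'i \<Rightarrow> nat"
    using A E by (intro sum.group) (auto simp: E_def)
  have gB: "(\<Sum>e\<in>E. \<Sum>b | b \<in> B \<and> g b = e. h b) = sum h B" for h :: "'j \<Rightarrow> nat"
    using B E by (intro sum.group) (auto simp: E_def)
  have "(\<Sum>e\<in>E. card {a \<in> A. f a = e}) = (\<Sum>e\<in>E. card {b \<in> B. g b = e})"
    using fA[of "\<lambda>_. 1"] gB[of "\<lambda>_. 1"] card by simp
  then have eq: "card {a \<in> A. f a = e} = card {b \<in> B. g b = e}" if "e \<in> E" for e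
    using sum_mono_inv[of "\<lambda>e. card {a \<in> A. f a = e}" E "\<lambda>e. card {b \<in> B. g b = e}" e] le E that by auto
  have "sum f A = (\<Sum>e\<in>E. card {a \<in> A. f a = e} * e)"
    unfolding fA[of f, symmetric] by (intro sum.cong refl) simp
  also have "\<dots> = (\<Sum>e\<in>E. card {b \<in> B. g b = e} * e)" using eq by simp
  also have "\<dots> = sum g B"
    unfolding gB[of g, symmetric] by (intro sum.cong refl) simp
  finally show ?thesis .
qed

locale two_bases = group_rep n G r \<rho>
  for n :: nat and G :: "'a::field_char_0 mat set" and r \<rho> +
  fixes \<omega> t :: "nat \<Rightarrow> nat \<Rightarrow> 'a mpoly" and d td :: "nat \<Rightarrow> nat"
  assumes \<omega>_basis: "homogeneous_free_basis r (SVs_inv n G) (SM_inv n r G \<rho>) \<omega>"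
    and t_basis: "homogeneous_free_basis r (SV_inv n G) (SMs_inv n r G \<rho>) t"
    and \<omega>_homogeneous: "\<And>i j. i < r \<Longrightarrow> homogeneous (d i) (\<omega> i j)"
    and t_homogeneous: "\<And>i j. i < r \<Longrightarrow> homogeneous (td i) (t i j)"
begin

lemma free_basisD:
  assumes "homogeneous_free_basis r R W b"
  shows "i < r \<Longrightarrow> b i \<in> W"
    and "w \<in> W \<Longrightarrow> \<exists>a. (\<forall>i<r. a i \<in> R) \<and> w = (\<lambda>j. \<Sum>i<r. a i * b i j)"
    and "(\<lambda>j. \<Sum>i<r. a i * b i j) = (\<lambda>j. 0) \<Longrightarrow> \<forall>i<r. a i \<in> R \<Longrightarrow> i < r \<Longrightarrow> a i = 0"
proof -
  note * = assms[unfolded homogeneous_free_basis_def]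
  show "b i \<in> W" if "i < r" using conjunct1[OF *, rule_format, OF that] by (rule conjunct1)
  show "\<exists>a. (\<forall>i<r. a i \<in> R) \<and> w = (\<lambda>j. \<Sum>i<r. a i * b i j)" if "w \<in> W"
    by (rule bspec[OF conjunct1[OF conjunct2[OF *]] that])
  show "a i = 0" if "(\<lambda>j. \<Sum>i<r. a i * b i j) = (\<lambda>j. 0)" "\<forall>i<r. a i \<in> R" "i < r"
    using spec[OF conjunct2[OF conjunct2[OF *]], of a, THEN mp, OF conjI[OF that(2,1)]] that(3) by blast
qed

lemmas \<omega>_vinv = free_basisD(1)[OF \<omega>_basis, unfolded SM_inv_eq]
lemmas \<omega>_gen = free_basisD(2)[OF \<omega>_basis, unfolded SM_inv_eq SVs_inv_eq]
lemmas t_vinv = free_basisD(1)[OF t_basis, unfolded SMs_inv_eq]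
lemmas t_gen = free_basisD(2)[OF t_basis, unfolded SMs_inv_eq SV_inv_eq]

lemma t_free:
  assumes "\<And>i. i < r \<Longrightarrow> a i \<in> V.pinv" "\<And>j. (\<Sum>i<r. a i * t i j) = 0" "i < r"
  shows "a i = 0"
proof (rule free_basisD(3)[OF t_basis _ _ assms(3), unfolded SV_inv_eq])
  show "(\<lambda>j. \<Sum>i<r. a i * t i j) = (\<lambda>j. 0)" by (rule ext) (rule assms(2))
  show "\<forall>i<r. a i \<in> V.pinv" using assms(1) by blast
qed

lemma \<omega>_poly_in: "i < r \<Longrightarrow> poly_in n (\<omega> i j)"
  using \<omega>_vinv SM.vinv_vok SM.vok_poly_in by blast

lemma t_poly_in: "i < r \<Longrightarrow> poly_in n (t i j)"
  using t_vinv SMs.vinv_vok SMs.vok_poly_in by blast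

text \<open>Averaging is linear over the invariants, so for a product \<open>a * h\<close> the
  invariant \<open>h\<close> comes out of the average and multiplies every coefficient with respect
  to \<open>t\<close>. Having positive degree, it leaves no constant term.\<close>

lemma vavg_pideal_coeffs:
  assumes "\<And>k. z k \<in> V.pideal" "SMs.vok z"
  shows "\<exists>b. (\<forall>i<r. b i \<in> V.pinv \<and> Poly_Mapping.lookup (b i) 0 = 0) \<and>
    SMs.vavg z = (\<lambda>k. \<Sum>i<r. b i * t i k)"
proof -
  let ?u = "\<lambda>k0 f k. if k = k0 then f else 0 :: 'a mpoly"
  have "\<exists>b. (\<forall>i<r. b i \<in> V.pinv \<and> Poly_Mapping.lookup (b i) 0 = 0) \<and>
    SMs.vavg (?u k0 f) = (\<lambda>k. \<Sum>i<r. b i * t i k)" if "f \<in> V.pideal" and k0: "k0 < r" for f k0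
    using that(1)
  proof (induction f rule: V.pideal_induct)
    case (base a h e)
    have "SMs.vok (?u k0 a)" using base k0 by (auto simp: SMs.vok_def)
    then obtain b where b: "\<And>i. i < r \<Longrightarrow> b i \<in> V.pinv" "SMs.vavg (?u k0 a) = (\<lambda>k. \<Sum>i<r. b i * t i k)"
      using t_gen[OF SMs.vavg_vinv] by blast
    have "?u k0 (a * h) = (\<lambda>k. h * ?u k0 a k)" by (auto simp: mult.commute)
    then have "SMs.vavg (?u k0 (a * h)) = SMs.vavg (\<lambda>k. h * ?u k0 a k)" by (rule arg_cong)
    also have "\<dots> = (\<lambda>k. h * (\<Sum>i<r. b i * t i k))"
      by (rule ext) (simp only: SMs.vavg_mult[OF base(2)] b(2))
    also have "\<dots> = (\<lambda>k. \<Sum>i<r. (b i * h) * t i k)"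
      by (simp add: sum_distrib_left mult_ac)
    finally have "SMs.vavg (?u k0 (a * h)) = (\<lambda>k. \<Sum>i<r. (b i * h) * t i k)" .
    moreover have "b i * h \<in> V.pinv \<and> Poly_Mapping.lookup (b i * h) 0 = 0" if "i < r" for i
      using V.pinv_mult[OF b(1)[OF that] base(2)] V.lookup_0_mult_homogeneous[OF base(3,4)] by simp
    ultimately show ?case by (intro exI[of _ "\<lambda>i. b i * h"]) simp
  next
    case (add f f')
    then obtain b b' where b: "\<forall>i<r. b i \<in> V.pinv \<and> Poly_Mapping.lookup (b i) 0 = 0"
      "SMs.vavg (?u k0 f) = (\<lambda>k. \<Sum>i<r. b i * t i k)"
      "\<forall>i<r. b' i \<in> V.pinv \<and> Poly_Mapping.lookup (b' i) 0 = 0"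
      "SMs.vavg (?u k0 f') = (\<lambda>k. \<Sum>i<r. b' i * t i k)" by blast
    have "?u k0 (f + f') = (\<lambda>k. ?u k0 f k + ?u k0 f' k)" by auto
    then have "SMs.vavg (?u k0 (f + f')) = SMs.vavg (\<lambda>k. ?u k0 f k + ?u k0 f' k)" by (rule arg_cong)
    also have "\<dots> = (\<lambda>k. SMs.vavg (?u k0 f) k + SMs.vavg (?u k0 f') k)"
      unfolding SMs.vavg_def SMs.vact_add by (simp add: sum.distrib distrib_left)
    also have "\<dots> = (\<lambda>k. \<Sum>i<r. (b i + b' i) * t i k)"
      unfolding b(2,4) by (simp add: sum.distrib distrib_right)
    finally have "SMs.vavg (?u k0 (f + f')) = (\<lambda>k. \<Sum>i<r. (b i + b' i) * t i k)" .
    then show ?case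
      using b(1,3) by (intro exI[of _ "\<lambda>i. b i + b' i"]) (simp add: V.pinv_add lookup_add)
  qed
  then have "\<forall>k0\<in>{..<r}. \<exists>b. (\<forall>i<r. b i \<in> V.pinv \<and> Poly_Mapping.lookup (b i) 0 = 0) \<and>
    SMs.vavg (?u k0 (z k0)) = (\<lambda>k. \<Sum>i<r. b i * t i k)"
    using assms(1) by simp
  from bchoice[OF this] obtain b where
    b: "\<forall>k0\<in>{..<r}. (\<forall>i<r. b k0 i \<in> V.pinv \<and> Poly_Mapping.lookup (b k0 i) 0 = 0) \<and>
      SMs.vavg (?u k0 (z k0)) = (\<lambda>k. \<Sum>i<r. b k0 i * t i k)" by (rule exE)
  have z: "z = (\<lambda>k. \<Sum>k0<r. ?u k0 (z k0) k)" using assms(2) by (auto simp: SMs.vok_def fun_eq_iff)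
  have "SMs.vavg z k = (\<Sum>i<r. (\<Sum>k0<r. b k0 i) * t i k)" for k
  proof -
    have "SMs.vavg z k = SMs.vavg (\<lambda>k. \<Sum>k0<r. ?u k0 (z k0) k) k"
      by (rule arg_cong[OF z, of "\<lambda>z. SMs.vavg z k"])
    also have "\<dots> = (\<Sum>k0<r. SMs.vavg (?u k0 (z k0)) k)" by (rule SMs.vavg_sum)
    also have "\<dots> = (\<Sum>k0<r. \<Sum>i<r. b k0 i * t i k)" using b by (intro sum.cong refl) simp
    also have "\<dots> = (\<Sum>i<r. (\<Sum>k0<r. b k0 i) * t i k)" unfolding sum_distrib_right by (rule sum.swap)
    finally show ?thesis .
  qed
  moreover have "(\<Sum>k0<r. b k0 i) \<in> V.pinv \<and> Poly_Mapping.lookup (\<Sum>k0<r. b k0 i) 0 = 0" if "i < r" for i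
    using b that by (auto intro!: V.pinv_sum simp: lookup_sum)
  ultimately show ?thesis by (intro exI[of _ "\<lambda>i. \<Sum>k0<r. b k0 i"]) auto
qed

text \<open>The combination is invariant, hence equal to its own average, whose coefficients have no
  constant term by \<open>vavg_pideal_coeffs\<close>; freeness identifies them with the constants
  \<open>c j\<close>.\<close>

lemma t_independent_mod_ideal:
  assumes "\<And>k. (\<Sum>j<r. pconst (c j) * t j k) \<in> V.pideal" and "j < r"
  shows "c j = 0"
proof -
  define z where "z k = (\<Sum>j<r. pconst (c j) * t j k)" for k
  have z: "z \<in> SMs.vinv"
    unfolding z_def[abs_def] using t_vinv by (intro SMs.vinv_sum SMs.vinv_mult) auto
  have "z k \<in> V.pideal" for k unfolding z_def by (rule assms(1))
  from vavg_pideal_coeffs[OF this SMs.vinv_vok[OF z]]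
  obtain b where b: "\<forall>i<r. b i \<in> V.pinv \<and> Poly_Mapping.lookup (b i) 0 = 0"
    "SMs.vavg z = (\<lambda>k. \<Sum>i<r. b i * t i k)" by (elim exE conjE)
  have "z k = (\<Sum>i<r. b i * t i k)" for k using fun_cong[OF b(2), of k] by (simp only: SMs.vavg_vinv_eq[OF z])
  then have "(\<Sum>i<r. (pconst (c i) - b i) * t i k) = 0" for k
    by (simp add: z_def left_diff_distrib sum_subtractf)
  then have "pconst (c j) - b j = 0"
    using b(1) by (intro t_free[where a = "\<lambda>i. pconst (c i) - b i", OF _ _ assms(2)]) (auto intro: V.pinv_diff)
  then have "Poly_Mapping.lookup (pconst (c j)) 0 = 0" using b(1) assms(2) by simp
  then show ?thesis by (simp add: lookup_pconst)
qed

text \<open>In degree \<open>td j\<close> the pairing represents a functional that is 1 on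
  \<open>t j\<close> and vanishes on the ideal and on the other \<open>t i\<close>. Averaging makes
  its representative invariant and does not change its values on the invariant \<open>t j'\<close>;
  vanishing on the ideal is harmonicity.\<close>

lemma ex_dual_harmonic:
  assumes j: "j < r"
  shows "\<exists>\<eta>. \<eta> \<in> SM.vinv \<and> (\<forall>k. homogeneous (td j) (\<eta> k) \<and> \<eta> k \<in> harmonics n G) \<and>
    (\<forall>j'<r. td j' = td j \<longrightarrow> tpair \<eta> (t j') = (if j' = j then 1 else 0))"
proof -
  let ?e = "td j"
  \<comment> \<open>Vectors congruent, modulo the ideal in each coordinate, to a combination of the
    \<open>t i\<close> other than \<open>t j\<close>.\<close>
  let ?W = "{z. \<exists>c. \<forall>k. z k - (\<Sum>i\<in>{..<r} - {j}. pconst (c i) * t i k) \<in> V.pideal}"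
  have Wadd: "(\<lambda>k. w k + z k) \<in> ?W" if wz: "w \<in> ?W" "z \<in> ?W" for w z
  proof -
    obtain c c' where c: "\<And>k. w k - (\<Sum>i\<in>{..<r} - {j}. pconst (c i) * t i k) \<in> V.pideal"
      "\<And>k. z k - (\<Sum>i\<in>{..<r} - {j}. pconst (c' i) * t i k) \<in> V.pideal" using wz by blast
    have "w k + z k - (\<Sum>i\<in>{..<r} - {j}. pconst (c i + c' i) * t i k) \<in> V.pideal" for k
      using V.pideal_add[OF c(1)[of k] c(2)[of k]]
      by (simp add: pconst_add distrib_right sum.distrib algebra_simps)
    then show ?thesis by (intro CollectI exI[of _ "\<lambda>i. c i + c' i"]) auto
  qed
  have Wscale: "(\<lambda>k. pconst a * w k) \<in> ?W" if w: "w \<in> ?W" for a w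
  proof -
    obtain c where c: "\<And>k. w k - (\<Sum>i\<in>{..<r} - {j}. pconst (c i) * t i k) \<in> V.pideal" using w by blast
    have "pconst a * w k - (\<Sum>i\<in>{..<r} - {j}. pconst (a * c i) * t i k) \<in> V.pideal" for k
      using V.pideal_pconst_mult[OF c[of k], of a]
      by (simp add: pconst_mult right_diff_distrib sum_distrib_left mult.assoc)
    then show ?thesis by (intro CollectI exI[of _ "\<lambda>i. a * c i"]) auto
  qed
  have Wzero: "(\<lambda>k. 0) \<in> ?W" by (intro CollectI exI[of _ "\<lambda>_. 0"]) auto
  have tj: "t j \<notin> ?W"
  proof
    assume "t j \<in> ?W"
    then obtain c where c: "\<And>k. t j k - (\<Sum>i\<in>{..<r} - {j}. pconst (c i) * t i k) \<in> V.pideal" by blast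
    let ?c = "\<lambda>i. if i = j then 1 else - c i"
    have "(\<Sum>i<r. pconst (?c i) * t i k) = t j k - (\<Sum>i\<in>{..<r} - {j}. pconst (c i) * t i k)" for k
      using j by (subst sum.remove[of _ j]) (auto simp: pconst_minus sum_negf[symmetric] intro!: sum.cong)
    then have "?c j = 0" using c j by (intro t_independent_mod_ideal) auto
    then show False by simp
  qed
  obtain l :: "(nat \<Rightarrow> 'a mpoly) \<Rightarrow> 'a" where l: "\<And>w z. l (\<lambda>k. w k + z k) = l w + l z"
    "\<And>c w. l (\<lambda>k. pconst c * w k) = c * l w" "l (t j) = 1" "\<And>w. w \<in> ?W \<Longrightarrow> l w = 0"
    using ex_tensor_functional[OF Wadd Wscale Wzero tj] by blast
  have l0: "l (\<lambda>k. 0) = 0" using l(1)[of "\<lambda>_. 0" "\<lambda>_. 0"] by simp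
  have l_sum': "l (\<lambda>k. \<Sum>i\<in>I. f i k) = (\<Sum>i\<in>I. l (f i))" if "finite I" for I :: "nat set" and f
    using that by (induction I rule: finite_induct) (simp_all add: l0 l(1))
  have l_sumM: "l (\<lambda>k. \<Sum>i\<in>I. f i k) = (\<Sum>i\<in>I. l (f i))" if "finite I" for I :: "(nat \<Rightarrow>\<^sub>0 nat) set" and f
    using that by (induction I rule: finite_induct) (simp_all add: l0 l(1))
  let ?u = "\<lambda>k0 f k. if k = k0 then f else 0 :: 'a mpoly"
  let ?M = "{m. Poly_Mapping.keys m \<subseteq> {..<n} \<and> tdeg m = ?e}"
  \<comment> \<open>Dividing by \<open>mfact m\<close> compensates the norms of the monomials, so
    that pairing with \<open>\<eta>\<close> is the functional \<open>l\<close> in degree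
    \<open>?e\<close>.\<close>
  define \<eta> where "\<eta> k = (if k < r then \<Sum>m\<in>?M. pconst (l (?u k (pmonom m)) / mfact m) * pmonom m else 0)" for k
  have \<eta>_vok: "SM.vok \<eta>"
    by (auto simp: SM.vok_def \<eta>_def intro!: poly_in_sum poly_in_mult poly_in_pmonom)
  have \<eta>_hom: "homogeneous ?e (\<eta> k)" for k
  proof -
    have "homogeneous ?e (pmonom m :: 'a mpoly)" if "m \<in> ?M" for m
      using homogeneous_pmonom[of m] that by simp
    then show ?thesis unfolding \<eta>_def by (auto intro!: homogeneous_sum homogeneous_pconst_mult)
  qed
  have pair: "tpair \<eta> z = l z" if z: "SMs.vok z" "\<And>k. homogeneous ?e (z k)" for z
  proof -
    have zk: "z k = (\<Sum>m\<in>?M. pconst (Poly_Mapping.lookup (z k) m) * pmonom m)" for k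
    proof -
      have "Poly_Mapping.keys (z k) \<subseteq> ?M"
        using SMs.vok_poly_in[OF z(1), of k] z(2)[of k] by (auto simp: poly_in_def homogeneous_def)
      then have "(\<Sum>m\<in>Poly_Mapping.keys (z k). pconst (Poly_Mapping.lookup (z k) m) * pmonom m)
          = (\<Sum>m\<in>?M. pconst (Poly_Mapping.lookup (z k) m) * pmonom m)"
        by (intro sum.mono_neutral_left finite_monomials) (auto simp: in_keys_iff)
      then show ?thesis using mpoly_sum_monomials[of "z k"] by simp
    qed
    have "pairing (\<eta> k) (z k) = l (?u k (z k))" if "k < r" for k
    proof -
      have "pairing (\<eta> k) (z k) = (\<Sum>m\<in>?M. Poly_Mapping.lookup (z k) m * l (?u k (pmonom m)))"
        unfolding \<eta>_def if_P[OF that] pairing_sum_left pairing_pconst_mult_left pairing_pmonom_left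
        by (intro sum.cong refl) simp
      also have "\<dots> = (\<Sum>m\<in>?M. l (\<lambda>k'. pconst (Poly_Mapping.lookup (z k) m) * ?u k (pmonom m) k'))"
        by (simp only: l(2))
      also have "\<dots> = l (\<lambda>k'. \<Sum>m\<in>?M. pconst (Poly_Mapping.lookup (z k) m) * ?u k (pmonom m) k')"
        by (rule l_sumM[OF finite_monomials, symmetric])
      also have "(\<lambda>k'. \<Sum>m\<in>?M. pconst (Poly_Mapping.lookup (z k) m) * ?u k (pmonom m) k') = ?u k (z k)"
        by (rule ext) (auto simp: zk[symmetric])
      finally show ?thesis .
    qed
    then have "tpair \<eta> z = (\<Sum>k<r. l (?u k (z k)))" by (simp add: tpair_def)
    also have "\<dots> = l (\<lambda>k'. \<Sum>k<r. ?u k (z k) k')" by (rule l_sum'[symmetric]) simp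
    also have "(\<lambda>k'. \<Sum>k<r. ?u k (z k) k') = z" using z(1) by (auto simp: SMs.vok_def fun_eq_iff)
    finally show ?thesis .
  qed
  define \<eta>' where "\<eta>' = SM.vavg \<eta>"
  have \<eta>'inv: "\<eta>' \<in> SM.vinv" unfolding \<eta>'_def by (rule SM.vavg_vinv[OF \<eta>_vok])
  have \<eta>'hom: "homogeneous ?e (\<eta>' k)" for k
    unfolding \<eta>'_def SM.vavg_def SM.vact_def using \<eta>_hom SM.vok_poly_in[OF \<eta>_vok]
    by (intro homogeneous_pconst_mult homogeneous_sum Vs.homogeneous_act) auto
  have pair': "tpair \<eta>' z = (1 / of_nat (card G)) * (\<Sum>g\<in>G. l (SMs.vact (ginv n G g) z))"
    if z: "SMs.vok z" "\<And>k. homogeneous ?e (z k)" for z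
  proof -
    have "homogeneous ?e (SMs.vact g z k)" if "g \<in> G" for g k
      unfolding SMs.vact_def using z SMs.vok_poly_in[OF z(1)] that
      by (intro homogeneous_sum homogeneous_pconst_mult V.homogeneous_act) auto
    then have *: "tpair \<eta> (SMs.vact (ginv n G g) z) = l (SMs.vact (ginv n G g) z)" if "g \<in> G" for g
      using that by (intro pair SMs.vok_vact z) auto
    have "tpair \<eta>' z = (1 / of_nat (card G)) * (\<Sum>g\<in>G. tpair (SM.vact g \<eta>) z)"
      unfolding tpair_def \<eta>'_def SM.vavg_def
      by (simp add: pairing_pconst_mult_left pairing_sum_left sum_divide_distrib[symmetric] sum.swap[of _ G])
    also have "(\<Sum>g\<in>G. tpair (SM.vact g \<eta>) z) = (\<Sum>g\<in>G. l (SMs.vact (ginv n G g) z))"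
      by (intro sum.cong refl) (simp add: tpair_vact[OF _ \<eta>_vok z(1)] *)
    finally show ?thesis .
  qed
  have dual: "tpair \<eta>' (t j') = (if j' = j then 1 else 0)" if j': "j' < r" "td j' = td j" for j'
  proof -
    have "l (t j') = (if j' = j then 1 else 0)"
    proof (cases "j' = j")
      case False
      have "t j' k - (\<Sum>i\<in>{..<r} - {j}. pconst (if i = j' then 1 else 0) * t i k) \<in> V.pideal" for k
      proof -
        have "(\<Sum>i\<in>{..<r} - {j}. pconst (if i = j' then 1 else 0) * t i k)
            = (\<Sum>i\<in>{..<r} - {j}. if i = j' then t i k else 0)" by (intro sum.cong) auto
        then show ?thesis using j' False by simp
      qed
      then have "t j' \<in> ?W" by (intro CollectI exI[of _ "\<lambda>i. if i = j' then 1 else 0"]) auto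
      then show ?thesis using l(4) False by simp
    qed (simp add: l(3))
    moreover have "homogeneous ?e (t j' k)" for k using t_homogeneous[OF j'(1)] j'(2) by simp
    ultimately show ?thesis
      using pair'[OF SMs.vinv_vok[OF t_vinv[OF j'(1)]]] SMs.vinv_vact[OF t_vinv[OF j'(1)]] by simp
  qed
  have vanish: "tpair \<eta>' z = 0" if z: "SMs.vok z" "\<And>k. homogeneous ?e (z k)" "\<And>k. z k \<in> V.pideal" for z
  proof -
    have "SMs.vact (ginv n G g) z \<in> ?W" if "g \<in> G" for g
      using that SMs.vact_pideal[of z "ginv n G g"] z(3)
      by (intro CollectI exI[of _ "\<lambda>_. 0"]) auto
    then show ?thesis using pair'[OF z(1,2)] l(4) by simp
  qed
  have "\<eta>' k \<in> harmonics n G" for k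
  proof (cases "k < r")
    case True
    have "pairing (\<eta>' k) s = 0" if s: "s \<in> V.pideal" for s
    proof -
      have hs: "hcomp ?e s \<in> V.pideal" by (rule V.pideal_hcomp[OF s])
      have "pairing (\<eta>' k) s = pairing (\<eta>' k) (hcomp ?e s)" by (rule pairing_hcomp[OF \<eta>'hom, symmetric])
      also have "\<dots> = (\<Sum>k'<r. if k' = k then pairing (\<eta>' k) (hcomp ?e s) else 0)" using True by simp
      also have "\<dots> = tpair \<eta>' (?u k (hcomp ?e s))"
        unfolding tpair_def by (intro sum.cong) auto
      also have "\<dots> = 0"
        by (rule vanish) (use True hs V.pideal_poly_in[OF hs] homogeneous_hcomp in \<open>auto simp: SMs.vok_def\<close>)
      finally show ?thesis .
    qed
    then show ?thesis
      using SM.vok_poly_in[OF SM.vinv_vok[OF \<eta>'inv]] by (simp add: harmonics_def ideal_I_eq)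
  next
    case False
    then have "\<eta>' k = 0" using SM.vinv_vok[OF \<eta>'inv] by (simp add: SM.vok_def)
    then show ?thesis by simp
  qed
  then show ?thesis using \<eta>'inv \<eta>'hom dual by blast
qed

text \<open>With more \<open>t j\<close> than \<open>\<omega> i\<close> in degree \<open>e\<close>,
  some nontrivial combination of the dual harmonics would have coefficients of positive degree only.
  It would lie in the ideal, hence vanish by \<open>harmonics_Istar_0\<close>, against duality with
  the \<open>t j\<close>.\<close>

lemma fibre_card_le: "card {j \<in> {..<r}. td j = e} \<le> card {i \<in> {..<r}. d i = e}"
proof (rule ccontr)
  let ?C' = "{j \<in> {..<r}. td j = e}" and ?C = "{i \<in> {..<r}. d i = e}"
  assume "\<not> ?thesis"
  then have less: "card ?C < card ?C'" by simp
  have "\<forall>j\<in>?C'. \<exists>\<eta>. \<eta> \<in> SM.vinv \<and> (\<forall>k. homogeneous e (\<eta> k) \<and> \<eta> k \<in> harmonics n G) \<and>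
      (\<forall>j'\<in>?C'. tpair \<eta> (t j') = (if j' = j then 1 else 0))"
  proof
    fix j assume "j \<in> ?C'"
    then have j: "j < r" "td j = e" by auto
    show "\<exists>\<eta>. \<eta> \<in> SM.vinv \<and> (\<forall>k. homogeneous e (\<eta> k) \<and> \<eta> k \<in> harmonics n G) \<and>
      (\<forall>j'\<in>?C'. tpair \<eta> (t j') = (if j' = j then 1 else 0))"
      using ex_dual_harmonic[OF j(1)] unfolding j(2) by (elim ex_forward) auto
  qed
  from bchoice[OF this] obtain \<eta> where \<eta>all: "\<forall>j\<in>?C'. \<eta> j \<in> SM.vinv \<and>
      (\<forall>k. homogeneous e (\<eta> j k) \<and> \<eta> j k \<in> harmonics n G) \<and>
      (\<forall>j'\<in>?C'. tpair (\<eta> j) (t j') = (if j' = j then 1 else 0))" by (rule exE)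
  have \<eta>: "\<eta> j \<in> SM.vinv" "homogeneous e (\<eta> j k)" "\<eta> j k \<in> harmonics n G" if "j \<in> ?C'" for j k
    using bspec[OF \<eta>all that] by auto
  have \<eta>dual: "tpair (\<eta> j) (t j') = (if j' = j then 1 else 0)" if "j \<in> ?C'" "j' \<in> ?C'" for j j'
    using bspec[OF \<eta>all that(1)] that(2) by auto
  have "\<forall>j\<in>?C'. \<exists>a. (\<forall>i<r. a i \<in> Vs.pinv) \<and> \<eta> j = (\<lambda>k. \<Sum>i<r. a i * \<omega> i k)"
    using \<omega>_gen[OF \<eta>(1)] by (rule ballI)
  from bchoice[OF this] obtain a where
    aall: "\<forall>j\<in>?C'. (\<forall>i<r. a j i \<in> Vs.pinv) \<and> \<eta> j = (\<lambda>k. \<Sum>i<r. a j i * \<omega> i k)" by (rule exE)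
  have a: "i < r \<Longrightarrow> a j i \<in> Vs.pinv" "\<eta> j k = (\<Sum>i<r. a j i * \<omega> i k)" if "j \<in> ?C'" for i j k
    using bspec[OF aall that] by auto
  \<comment> \<open>The constant terms of the coefficients along the \<open>\<omega> i\<close> of
    degree \<open>e\<close> give fewer linear conditions than there are unknowns
    \<open>b j\<close>.\<close>
  have "\<exists>b. (\<forall>j\<in>?C'. b j \<in> UNIV) \<and> (\<exists>j\<in>?C'. b j \<noteq> 0) \<and>
      (\<forall>i\<in>?C. (\<Sum>j\<in>?C'. b j * Poly_Mapping.lookup (a j i) 0) = 0)"
    using less by (intro ex_linear_relation) auto
  then obtain b where b: "\<exists>j\<in>?C'. b j \<noteq> 0"
    "\<And>i. i \<in> ?C \<Longrightarrow> (\<Sum>j\<in>?C'. b j * Poly_Mapping.lookup (a j i) 0) = 0" by (elim exE conjE) (rule that, auto)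
  define v where "v k = (\<Sum>j\<in>?C'. pconst (b j) * \<eta> j k)" for k
  define A where "A i = (\<Sum>j\<in>?C'. pconst (b j) * a j i)" for i
  have A: "A i \<in> Vs.pinv" if "i < r" for i
    unfolding A_def using a(1)[OF _ that] by (intro Vs.pinv_sum Vs.pinv_mult Vs.pinv_pconst)
  have vA: "v k = (\<Sum>i<r. A i * \<omega> i k)" for k
  proof -
    have "v k = (\<Sum>j\<in>?C'. \<Sum>i<r. pconst (b j) * a j i * \<omega> i k)"
      unfolding v_def by (intro sum.cong refl) (simp only: a(2) sum_distrib_left mult.assoc)
    also have "\<dots> = (\<Sum>i<r. A i * \<omega> i k)" unfolding A_def sum_distrib_right by (rule sum.swap)
    finally show ?thesis .
  qed
  have "v k \<in> Vs.pideal" for k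
  proof -
    have "homogeneous e (v k)" unfolding v_def using \<eta>(2) by (intro homogeneous_sum homogeneous_pconst_mult) auto
    then have "v k = hcomp e (v k)" by (simp add: hcomp_homogeneous)
    also have "\<dots> = (\<Sum>i<r. hcomp e (A i * \<omega> i k))" unfolding vA hcomp_sum ..
    also have "\<dots> \<in> Vs.pideal"
    proof (rule Vs.pideal_sum)
      fix i assume "i \<in> {..<r}"
      then have i: "i < r" by simp
      have eq: "hcomp e (A i * \<omega> i k) = (if d i \<le> e then hcomp (e - d i) (A i) * \<omega> i k else 0)"
        by (rule hcomp_mult_homogeneous[OF \<omega>_homogeneous[OF i]])
      consider "d i = e" | "d i < e" | "e < d i" by linarith
      then show "hcomp e (A i * \<omega> i k) \<in> Vs.pideal"
      proof cases
        case 1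
        have "hcomp 0 (A i) = pconst (Poly_Mapping.lookup (hcomp 0 (A i)) 0)"
          by (rule homogeneous_0_const[OF homogeneous_hcomp])
        also have "Poly_Mapping.lookup (hcomp 0 (A i)) 0 = 0"
          using b(2)[of i] i 1 by (simp add: lookup_hcomp A_def lookup_sum)
        finally show ?thesis using eq 1 by simp
      next
        case 2
        then have "hcomp (e - d i) (A i) \<in> Vs.pideal"
          by (intro Vs.pinv_homogeneous_pideal[OF Vs.pinv_hcomp[OF A[OF i]] homogeneous_hcomp]) simp
        from Vs.pideal_mult[OF this \<omega>_poly_in[OF i, of k]]
        show ?thesis unfolding eq using 2 by (simp add: mult.commute)
      next
        case 3 then show ?thesis using eq by simp
      qed
    qed
    finally show ?thesis .
  qed
  moreover have "v k \<in> harmonics n G" for k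
    unfolding v_def using \<eta>(3) by (intro harmonics_sum harmonics_pconst_mult) auto
  ultimately have v0: "v k = 0" for k by (rule harmonics_Istar_0[rotated])
  obtain j where j: "j \<in> ?C'" "b j \<noteq> 0" using b(1) by blast
  have "0 = tpair v (t j)" by (simp add: tpair_def v0)
  also have "\<dots> = (\<Sum>j'\<in>?C'. b j' * tpair (\<eta> j') (t j))"
    unfolding tpair_def v_def pairing_sum_left pairing_pconst_mult_left
    by (subst sum.swap) (simp add: sum_distrib_left)
  also have "\<dots> = (\<Sum>j'\<in>?C'. if j' = j then b j' else 0)"
    by (intro sum.cong refl) (simp add: \<eta>dual[OF _ j(1)])
  also have "\<dots> = b j" using j(1) by simp
  finally show False using j(2) by simp
qed

lemma sum_degrees_eq: "(\<Sum>i<r. td i) = (\<Sum>i<r. d i)"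
  by (rule sum_eq_if_fibre_card_le) (simp_all add: fibre_card_le[unfolded lessThan_iff])

end

subsection \<open>The basis\<close>

context matrix_group
begin

text \<open>Up to the factor \<open>card G\<close>, the sum is the projection onto the component of
  the character inverse to \<open>\<theta>\<close>.\<close>

lemma sum_act_V_twisted:
  assumes p: "poly_in n p" and \<theta>: "\<And>g h. g \<in> G \<Longrightarrow> h \<in> G \<Longrightarrow> \<theta> (g * h) = \<theta> g * \<theta> h" and h: "h \<in> G"
    and one: "\<theta> (1\<^sub>m n) = 1"
  shows "actV n h (\<Sum>g\<in>G. pconst (\<theta> g) * actV n g p) = pconst (\<theta> (ginv n G h)) * (\<Sum>g\<in>G. pconst (\<theta> g) * actV n g p)"
proof -
  have split: "\<theta> g = \<theta> (ginv n G h) * \<theta> (h * g)" if "g \<in> G" for g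
    using \<theta>[of "ginv n G h" "h * g"] that h by (simp add: ginv_mult_cancel)
  have "actV n h (\<Sum>g\<in>G. pconst (\<theta> g) * actV n g p)
      = (\<Sum>g\<in>G. pconst (\<theta> (ginv n G h) * \<theta> (h * g)) * actV n (h * g) p)"
    unfolding V.act_sum V.act_mult V.act_pconst
  proof (intro sum.cong refl)
    fix g assume g: "g \<in> G"
    show "pconst (\<theta> g) * actV n h (actV n g p) = pconst (\<theta> (ginv n G h) * \<theta> (h * g)) * actV n (h * g) p"
      by (simp only: V.act_act[OF h g p] split[OF g, symmetric])
  qed
  also have "\<dots> = (\<Sum>g\<in>G. pconst (\<theta> (ginv n G h) * \<theta> g) * actV n g p)"
    by (rule sum_mult_left[OF h, of "\<lambda>g. pconst (\<theta> (ginv n G h) * \<theta> g) * actV n g p"])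
  finally show ?thesis by (simp add: pconst_mult sum_distrib_left mult.assoc)
qed

lemma pairing_actV:
  assumes "g \<in> G" "poly_in n f" "poly_in n s"
  shows "pairing f (actV n g s) = pairing (actVs n G (ginv n G g) f) s"
  using pairing_actVs[of "ginv n G g" f s] assms by simp

end

locale chi_setting = two_bases n G r \<rho> \<omega> t d td + reflection_group n G
  for n :: nat and G :: "'a::field_char_0 mat set" and r \<rho> \<omega> t d td +
  fixes \<chi> :: "'a mat \<Rightarrow> 'a" and \<Delta> :: "'a mpoly" and e :: nat
  assumes chi: "linear_character G \<chi>"
    and Delta_chi: "\<Delta> \<in> SVs_chi n G \<chi>" and Delta_homogeneous: "homogeneous e \<Delta>" and Delta_nonzero: "\<Delta> \<noteq> 0"
    and Delta_gen: "SVs_chi n G \<chi> = {a * \<Delta> | a. a \<in> SVs_inv n G}"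
    and J_dvd: "\<exists>k. poly_in n k \<and> \<Delta> = jacobian r \<omega> * k"
begin

abbreviation "B \<equiv> basis_elem r t \<Delta>"

lemma chi_mult: "g \<in> G \<Longrightarrow> h \<in> G \<Longrightarrow> \<chi> (g * h) = \<chi> g * \<chi> h"
  and chi_nonzero: "g \<in> G \<Longrightarrow> \<chi> g \<noteq> 0"
  using chi by (auto simp: linear_character_def)

lemma chi_one: "\<chi> (1\<^sub>m n) = 1"
  using chi_mult[of "1\<^sub>m n" "1\<^sub>m n"] chi_nonzero[of "1\<^sub>m n"] by simp

lemma chi_ginv: "g \<in> G \<Longrightarrow> \<chi> (ginv n G g) * \<chi> g = 1"
  using chi_mult[of "ginv n G g" g] chi_one by simp

lemma Delta_poly_in: "poly_in n \<Delta>"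
  and Delta_act: "g \<in> G \<Longrightarrow> actVs n G g \<Delta> = pconst (\<chi> g) * \<Delta>"
  using Delta_chi by (auto simp: SVs_chi_def)

text \<open>The twist by \<open>inverse (\<chi> g)\<close> turns semi-invariants of character \<chi>
  into invariants, so that the results on \<open>vinv\<close> apply to them.\<close>

sublocale SE: vec_action n G "actVs n G" "Pow {..<r}" "\<lambda>g S T. inverse (\<chi> g) * act_wedge n r G \<rho> g S T"
proof
  fix g h S T assume "g \<in> G" "h \<in> G" "S \<in> Pow {..<r}"
  then show "inverse (\<chi> (g * h)) * act_wedge n r G \<rho> (g * h) S T
      = (\<Sum>U\<in>Pow {..<r}. inverse (\<chi> h) * act_wedge n r G \<rho> h S U * (inverse (\<chi> g) * act_wedge n r G \<rho> g U T))"
    by (simp add: chi_mult act_wedge_mult sum_distrib_left mult_ac)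
qed (auto simp: chi_one act_wedge_one act_wedge_outside)

lemma SE_vact: "SE.vact g w T = pconst (inverse (\<chi> g)) * actSE n r G \<rho> g w T"
  by (simp add: SE.vact_def actSE_def pconst_mult sum_distrib_left mult_ac)

lemma SE_vok: "SE_ok n r w \<longleftrightarrow> SE.vok w"
  by (auto simp: SE_ok_def SE.vok_def)

lemma actSE_eq_iff:
  assumes "g \<in> G"
  shows "actSE n r G \<rho> g w = (\<lambda>T. pconst (\<chi> g) * w T) \<longleftrightarrow> SE.vact g w = w"
proof -
  have "actSE n r G \<rho> g w T = pconst (\<chi> g) * w T \<longleftrightarrow> SE.vact g w T = w T" for T
  proof
    assume "actSE n r G \<rho> g w T = pconst (\<chi> g) * w T"
    then show "SE.vact g w T = w T"
      using chi_nonzero[OF assms] by (simp add: SE_vact mult.assoc[symmetric] pconst_mult[symmetric])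
  next
    assume *: "SE.vact g w T = w T"
    have "pconst (\<chi> g) * SE.vact g w T = actSE n r G \<rho> g w T"
      using chi_nonzero[OF assms] by (simp add: SE_vact mult.assoc[symmetric] pconst_mult[symmetric])
    then show "actSE n r G \<rho> g w T = pconst (\<chi> g) * w T" using * by simp
  qed
  then show ?thesis by (simp add: fun_eq_iff)
qed

lemma HE_chi_iff: "w \<in> HE_chi n r G \<rho> \<chi> \<longleftrightarrow> w \<in> SE.vinv \<and> (\<forall>T. w T \<in> harmonics n G)"
  by (auto simp: HE_chi_def SE.vinv_def SE_vok actSE_eq_iff)

text \<open>Semi-invariants are invariant multiples of \<Delta>; comparing degrees leaves a constant
  factor in degree \<open>e\<close>.\<close>

lemma chi_homogeneous:
  assumes "f \<in> SVs_chi n G \<chi>" "homogeneous k f" "f \<noteq> 0"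
  shows "e \<le> k" and "k = e \<Longrightarrow> \<exists>c. f = pconst c * \<Delta>"
proof -
  obtain a where a: "f = a * \<Delta>" using assms(1) Delta_gen by blast
  have f: "f = (if e \<le> k then hcomp (k - e) a * \<Delta> else 0)"
    using hcomp_mult_homogeneous[OF Delta_homogeneous, of k a] hcomp_homogeneous[OF assms(2), of k] a by simp
  then show "e \<le> k" using assms(3) by (auto split: if_splits)
  show "\<exists>c. f = pconst c * \<Delta>" if "k = e"
    using f homogeneous_0_const[OF homogeneous_hcomp, of a] that by auto
qed

text \<open>\<open>\<Delta>\<close> is harmonic because it has the least degree in its isotypic component.\<close>

lemma Delta_harmonic: "\<Delta> \<in> harmonics n G"
proof -
  have "pairing \<Delta> s = 0" if "s \<in> V.pideal" for s
    using that
  proof (induction s rule: V.pideal_induct)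
    case (base a h k)
    have "diff_op h \<Delta> = 0"
    proof (rule ccontr)
      assume nz: "diff_op h \<Delta> \<noteq> 0"
      \<comment> \<open>Excludes truncation in \<open>e - k\<close>, where the inequality obtained
        below would not be absurd.\<close>
      have "k \<le> e" using diff_op_eq_0[OF Delta_homogeneous base(3)] nz by linarith
      have "actVs n G g (diff_op h \<Delta>) = pconst (\<chi> g) * diff_op h \<Delta>" if "g \<in> G" for g
        using that base
        by (simp add: actVs_diff_op V.pinv_poly_in Delta_poly_in V.pinv_act Delta_act diff_op_pconst_mult_right)
      moreover have "poly_in n (diff_op h \<Delta>)"
        using Delta_poly_in vars_in_diff_op by (auto simp: poly_in_vars_in)
      ultimately have "e \<le> e - k"
        by (intro chi_homogeneous(1)[OF _ homogeneous_diff_op[OF Delta_homogeneous base(3)] nz])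
           (simp add: SVs_chi_def)
      then show False using \<open>k \<le> e\<close> \<open>0 < k\<close> by simp
    qed
    then show ?case by (metis mult.commute pairing_0_left pairing_diff_op)
  qed (simp add: pairing_add_right)
  then show ?thesis by (simp add: harmonics_def Delta_poly_in ideal_I_eq)
qed

text \<open>The symbol of the basis element: \<open>B I\<close> results from letting
  \<open>Om I\<close> act on \<Delta>, by \<open>basis_elem_eq\<close>.\<close>

abbreviation "Om I \<equiv> wedge_prod r t (sorted_list_of_set I)"

lemma in_sorted_list: "I \<subseteq> {..<r} \<Longrightarrow> i \<in> set (sorted_list_of_set I) \<Longrightarrow> i < r"
  using finite_subset[of I "{..<r}"] by auto

lemma Om_poly_in: "I \<subseteq> {..<r} \<Longrightarrow> poly_in n (Om I T)"
  unfolding poly_in_vars_in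
  by (rule vars_in_wedge_prod, rule t_poly_in[unfolded poly_in_vars_in], rule in_sorted_list)

lemma Om_homogeneous: "I \<subseteq> {..<r} \<Longrightarrow> homogeneous (\<Sum>i\<leftarrow>sorted_list_of_set I. td i) (Om I T)"
  by (rule homogeneous_wedge_prod, rule t_homogeneous, rule in_sorted_list)

lemma B_harmonic: "I \<subseteq> {..<r} \<Longrightarrow> B I T \<in> harmonics n G"
  unfolding basis_elem_eq by (intro harmonics_diff_op Delta_harmonic Om_poly_in)

lemma B_homogeneous: "I \<subseteq> {..<r} \<Longrightarrow> homogeneous (e - (\<Sum>i\<leftarrow>sorted_list_of_set I. td i)) (B I T)"
  unfolding basis_elem_eq by (intro homogeneous_diff_op Delta_homogeneous Om_homogeneous)

text \<open>Differentiation is equivariant and the symbol \<open>Om I\<close> is invariant, so the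
  only character that appears is that of \<Delta>, and the twist in \<open>SE\<close> removes
  it.\<close>

lemma B_vinv: assumes I: "I \<subseteq> {..<r}" shows "B I \<in> SE.vinv"
proof -
  have out: "B I T = 0" if "\<not> T \<subseteq> {..<r}" for T
    unfolding basis_elem_eq wedge_prod_support[OF that] by simp
  have "SE.vok (B I)"
    using out harmonics_poly_in[OF B_harmonic[OF I]] by (auto simp: SE.vok_def)
  moreover have "SE.vact g (B I) = B I" if g: "g \<in> G" for g
  proof
    fix T
    have "SE.vact g (B I) T = (\<Sum>S\<in>Pow {..<r}. pconst (inverse (\<chi> g) * act_wedge n r G \<rho> g S T)
        * diff_op (actV n g (Om I S)) (pconst (\<chi> g) * \<Delta>))"
      unfolding SE.vact_def basis_elem_eq
      by (simp add: actVs_diff_op[OF g Om_poly_in[OF I] Delta_poly_in] Delta_act[OF g])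
    also have "\<dots> = (\<Sum>S\<in>Pow {..<r}. diff_op (pconst (act_wedge n r G \<rho> g S T) * actV n g (Om I S)) \<Delta>)"
    proof (intro sum.cong refl)
      fix S
      have "pconst (inverse (\<chi> g) * act_wedge n r G \<rho> g S T) * (pconst (\<chi> g) * diff_op (actV n g (Om I S)) \<Delta>)
          = pconst (inverse (\<chi> g) * act_wedge n r G \<rho> g S T * \<chi> g) * diff_op (actV n g (Om I S)) \<Delta>"
        by (simp only: pconst_mult mult.assoc)
      also have "inverse (\<chi> g) * act_wedge n r G \<rho> g S T * \<chi> g = act_wedge n r G \<rho> g S T"
        using chi_nonzero[OF g] by simp
      finally show "pconst (inverse (\<chi> g) * act_wedge n r G \<rho> g S T) * diff_op (actV n g (Om I S)) (pconst (\<chi> g) * \<Delta>)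
          = diff_op (pconst (act_wedge n r G \<rho> g S T) * actV n g (Om I S)) \<Delta>"
        by (simp only: diff_op_pconst_mult_right diff_op_pconst_mult)
    qed
    also have "\<dots> = diff_op (SEV.vact g (Om I) T) \<Delta>"
      by (simp add: SEV.vact_def diff_op_sum)
    also have "\<dots> = B I T"
      unfolding basis_elem_eq
      by (rule arg_cong[where f = "\<lambda>X. diff_op X \<Delta>"], rule SEV_vact_wedge_prod[OF g t_vinv[OF in_sorted_list[OF I]]])
    finally show "SE.vact g (B I) T = B I T" .
  qed
  ultimately show ?thesis by (simp add: SE.vinv_def)
qed

section \<open>The determinants of the two bases\<close>

lemma t_independent:
  assumes "\<And>i. i < r \<Longrightarrow> poly_in n (a i)" "\<And>k. k < r \<Longrightarrow> (\<Sum>i<r. a i * t i k) = 0" "i < r"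
  shows "a i = 0"
proof -
  have "\<forall>i\<in>{..<r}. a i = 0"
  proof (rule SMs.vinv_independent[where w = t])
    fix h assume "\<And>i. i \<in> {..<r} \<Longrightarrow> h i \<in> V.pinv" "\<And>j. (\<Sum>i<r. h i * t i j) = 0"
    then have "h i = 0" if "i < r" for i by (intro t_free[where a = h and i = i, OF _ _ that]) simp_all
    then show "\<forall>i\<in>{..<r}. h i = 0" by blast
  next
    fix i assume "i \<in> {..<r}"
    then show "t i \<in> SMs.vinv" "poly_in n (a i)" using assms(1) t_vinv by (simp_all only: lessThan_iff)
  next
    fix k assume "k \<in> {..<r}"
    then show "(\<Sum>i<r. a i * t i k) = 0" using assms(2) by (simp only: lessThan_iff)
  qed
  then show ?thesis using assms(3) by blast
qed

text \<open>The \<open>r\<close> rows of \<open>t\<close> and a unit vector are dependent, while the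
  rows alone are not, so some nonzero multiple of the unit vector is a combination of the rows.
  Collecting these combinations gives a matrix whose product with that of \<open>t\<close> is
  diagonal with nonzero entries.\<close>

lemma jacobian_t_nonzero: "jacobian r t \<noteq> 0"
proof -
  \<comment> \<open>Index \<open>r\<close> adds the unit vector to the rows of
    \<open>t\<close>.\<close>
  let ?w = "\<lambda>j i k. if i < r then t i k else if k = j then 1 else 0 :: 'a mpoly"
  have rel: "\<exists>a. a r \<noteq> 0 \<and>
      (\<forall>k<r. (\<Sum>i<r. a i * t i k) = (if k = j then a r else 0))" for j
  proof -
    have "\<exists>a. (\<forall>i\<in>{..<Suc r}. a i \<in> Collect (poly_in n)) \<and> (\<exists>i\<in>{..<Suc r}. a i \<noteq> 0) \<and>
        (\<forall>k\<in>{..<r}. (\<Sum>i<Suc r. a i * ?w j i k) = 0)"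
    proof (rule ex_linear_relation)
      fix i k assume "i \<in> {..<Suc r}" "k \<in> {..<r}"
      show "?w j i k \<in> Collect (poly_in n)"
        by (cases "i < r") (simp_all add: t_poly_in)
    qed (simp_all add: poly_in_add poly_in_mult poly_in_minus)
    then obtain a where a0: "\<forall>i\<in>{..<Suc r}. a i \<in> Collect (poly_in n)" "\<exists>i\<in>{..<Suc r}. a i \<noteq> 0"
      "\<forall>k\<in>{..<r}. (\<Sum>i<Suc r. a i * ?w j i k) = 0" by (elim exE conjE)
    have a: "\<And>i. i < Suc r \<Longrightarrow> poly_in n (a i)" using a0(1) by blast
    have a3: "(\<Sum>i<Suc r. a i * ?w j i k) = 0" if "k < r" for k
      by (rule bspec[OF a0(3)]) (simp add: that)
    have k: "(\<Sum>i<r. - a i * t i k) = (if k = j then a r else 0)" if "k < r" for k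
    proof -
      have "(\<Sum>i<r. a i * ?w j i k) = (\<Sum>i<r. a i * t i k)" by (rule sum.cong) auto
      moreover have "a r * ?w j r k = (if k = j then a r else 0)" by simp
      ultimately have "(\<Sum>i<r. a i * t i k) + (if k = j then a r else 0) = 0"
        using a3[OF that] by (simp only: sum.lessThan_Suc)
      then have "- (\<Sum>i<r. a i * t i k) = (if k = j then a r else 0)" by (rule minus_unique)
      then show ?thesis by (simp only: sum_negf mult_minus_left)
    qed
    have "a r \<noteq> 0"
    proof
      assume ar: "a r = 0"
      have "- a i = 0" if "i < r" for i
      proof (rule t_independent[where a = "\<lambda>i. - a i", OF _ _ that])
        show "poly_in n (- a i)" if "i < r" for i using a[of i] that by (simp add: poly_in_minus)
        show "(\<Sum>i<r. - a i * t i k) = 0" if "k < r" for k by (subst k[OF that]) (simp add: ar)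
      qed
      then have "a i = 0" if "i < Suc r" for i using that ar by (cases "i = r") auto
      then show False using a0(2) by blast
    qed
    moreover have "(\<Sum>i<r. (if i < r then - a i else a i) * t i k) = (\<Sum>i<r. - a i * t i k)" for k
      by (rule sum.cong) auto
    ultimately show ?thesis
      using k by (intro exI[of _ "\<lambda>i. if i < r then - a i else a i"]) (simp del: mult_minus_left)
  qed
  have "\<forall>j. \<exists>a. a r \<noteq> 0 \<and> (\<forall>k<r. (\<Sum>i<r. a i * t i k) = (if k = j then a r else 0))"
    using rel by (rule allI)
  from choice[OF this] obtain a where
    "\<forall>j. a j r \<noteq> 0 \<and> (\<forall>k<r. (\<Sum>i<r. a j i * t i k) = (if k = j then a j r else 0))" by (rule exE)
  then have a: "\<And>j. a j r \<noteq> 0"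
    "\<And>j k. k < r \<Longrightarrow> (\<Sum>i<r. a j i * t i k) = (if k = j then a j r else 0)" by simp_all
  let ?A = "mat r r (\<lambda>(j, i). a j i)" and ?T = "mat r r (\<lambda>(i, j). t i j)"
  let ?D = "mat r r (\<lambda>(j, k). if k = j then a j r else 0)"
  have AT: "?A * ?T = ?D"
    by (rule eq_matI) (simp_all add: scalar_prod_def lessThan_atLeast0[symmetric] a(2))
  have "det ?D = prod_list (diag_mat ?D)"
    by (rule det_upper_triangular[of _ r]) (auto simp: upper_triangular_def)
  moreover have "0 \<notin> set (diag_mat ?D)" using a(1) by (auto simp: diag_mat_def)
  ultimately have "det ?D \<noteq> 0" by (simp add: prod_list_zero_iff)
  moreover have "det ?D = det ?A * det ?T" unfolding AT[symmetric] by (rule det_mult[of _ r]) auto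
  ultimately show ?thesis by (auto simp: jacobian_def)
qed

lemma act_jacobian_t: "g \<in> G \<Longrightarrow> actV n g (jacobian r t) = pconst (det (\<rho> g)) * jacobian r t"
proof -
  assume g: "g \<in> G"
  have "jacobian r t = actV n g (jacobian r t) * pconst (det (\<rho> (ginv n G g)))"
  proof (rule act_jacobian)
    fix i k assume "i < r" "k < r"
    then show "t i k = (\<Sum>j<r. pconst (\<rho> (ginv n G g) $$ (j, k)) * actV n g (t i j))"
      using fun_cong[OF SMs.vinv_vact[OF t_vinv g], of i k] by (simp add: SMs.vact_def)
  qed (use g in \<open>auto simp: V.act_add V.act_mult intro: rho_carrier\<close>)
  then have "pconst (det (\<rho> g)) * jacobian r t
      = actV n g (jacobian r t) * pconst (det (\<rho> g) * det (\<rho> (ginv n G g)))"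
    by (simp add: pconst_mult mult_ac)
  then show ?thesis using det_rho_ginv[OF g] by simp
qed

lemma act_jacobian_\<omega>: "g \<in> G \<Longrightarrow> jacobian r \<omega> = pconst (det (\<rho> g)) * actVs n G g (jacobian r \<omega>)"
proof -
  assume g: "g \<in> G"
  have "jacobian r \<omega> = actVs n G g (jacobian r \<omega>) * pconst (det ((\<rho> g)\<^sup>T))"
  proof (rule act_jacobian)
    fix i k assume "i < r" "k < r"
    then show "\<omega> i k = (\<Sum>j<r. pconst ((\<rho> g)\<^sup>T $$ (j, k)) * actVs n G g (\<omega> i j))"
      using fun_cong[OF SM.vinv_vact[OF \<omega>_vinv g], of i k] rho_carrier[OF g] by (simp add: SM.vact_def)
  qed (use rho_carrier[OF g] in \<open>auto simp: Vs.act_add Vs.act_mult\<close>)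
  then show ?thesis using det_transpose[OF rho_carrier[OF g]] by (simp add: mult.commute)
qed

lemma jacobian_eq_wedge: "jacobian r w = wedge_prod r w [0..<r] {..<r}"
  by (simp only: jacobian_def wedge_prod_top)

lemma sum_list_upt: "(\<Sum>i\<leftarrow>[0..<r]. f i) = (\<Sum>i<r. f i)"
  by (simp add: sum_list_distinct_conv_sum_set lessThan_atLeast0)

lemma jacobian_\<omega>_homogeneous: "homogeneous (\<Sum>i<r. d i) (jacobian r \<omega>)"
  unfolding jacobian_eq_wedge sum_list_upt[symmetric]
  by (rule homogeneous_wedge_prod) (auto intro: \<omega>_homogeneous)

lemma jacobian_t_homogeneous: "homogeneous (\<Sum>i<r. d i) (jacobian r t)"
proof -
  have "homogeneous (\<Sum>i\<leftarrow>[0..<r]. td i) (wedge_prod r t [0..<r] {..<r})"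
    by (rule homogeneous_wedge_prod) (auto intro: t_homogeneous)
  then show ?thesis unfolding sum_list_upt sum_degrees_eq jacobian_eq_wedge .
qed

lemma jacobian_t_poly_in: "poly_in n (jacobian r t)"
  unfolding jacobian_eq_wedge poly_in_vars_in
  by (rule vars_in_wedge_prod) (simp add: t_poly_in[unfolded poly_in_vars_in])

text \<open>Some monomial pairs nontrivially with \<open>q\<close>. Projecting it to the component
  of \<chi> only multiplies this value by \<open>card G\<close>, and the projection has degree
  \<open>e\<close>, hence is a multiple of \<Delta>.\<close>

lemma pairing_Delta_nonzero:
  assumes q: "poly_in n q" "homogeneous e q" "q \<noteq> 0"
    and act: "\<And>g. g \<in> G \<Longrightarrow> actV n g q = pconst (\<chi> (ginv n G g)) * q"
  shows "pairing \<Delta> q \<noteq> 0"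
proof -
  obtain m where m: "pairing q (pmonom m) \<noteq> 0" "Poly_Mapping.keys m \<subseteq> {..<n}" "tdeg m = e"
    using pairing_neq_0_ex[OF q(3) _ q(2), of "{..<n}"] q(1) by (auto simp: poly_in_vars_in)
  have pm: "poly_in n (pmonom m :: 'a mpoly)" using m(2) by (rule poly_in_pmonom)
  define f where "f = (\<Sum>g\<in>G. pconst (\<chi> (ginv n G g)) * actVs n G g (pmonom m))"
  have "actVs n G h f = pconst (\<chi> h) * f" if h: "h \<in> G" for h
  proof -
    have split: "\<chi> h * \<chi> (ginv n G (h * g)) = \<chi> (ginv n G g)" if "g \<in> G" for g
      using chi_ginv[OF h] that h by (simp add: ginv_mult chi_mult mult.left_commute mult.commute)
    have "actVs n G h f = (\<Sum>g\<in>G. pconst (\<chi> h * \<chi> (ginv n G (h * g))) * actVs n G (h * g) (pmonom m))"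
      unfolding f_def Vs.act_sum Vs.act_mult Vs.act_pconst
      by (intro sum.cong refl) (simp only: Vs.act_act[OF h _ pm] split)
    also have "\<dots> = (\<Sum>g\<in>G. pconst (\<chi> h * \<chi> (ginv n G g)) * actVs n G g (pmonom m))"
      by (rule sum_mult_left[OF h, of "\<lambda>g. pconst (\<chi> h * \<chi> (ginv n G g)) * actVs n G g (pmonom m)"])
    finally show ?thesis by (simp add: f_def pconst_mult sum_distrib_left mult.assoc)
  qed
  moreover have "poly_in n f" unfolding f_def using pm by (auto intro!: poly_in_sum poly_in_mult Vs.poly_in_act)
  ultimately have f: "f \<in> SVs_chi n G \<chi>" by (simp add: SVs_chi_def)
  have fh: "homogeneous e f"
    unfolding f_def using pm homogeneous_pmonom[of m] m(3)
    by (intro homogeneous_sum homogeneous_pconst_mult Vs.homogeneous_act) auto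
  have "pairing f q = (\<Sum>g\<in>G. pairing (pmonom m) q)"
    unfolding f_def pairing_sum_left pairing_pconst_mult_left
  proof (intro sum.cong refl)
    fix g assume g: "g \<in> G"
    have "pairing (actVs n G g (pmonom m)) q = \<chi> g * pairing (pmonom m) q"
      using g by (simp add: pairing_actVs[OF g pm q(1)] act pairing_pconst_mult_right)
    then show "\<chi> (ginv n G g) * pairing (actVs n G g (pmonom m)) q = pairing (pmonom m) q"
      using chi_ginv[OF g] by (simp add: mult.assoc[symmetric])
  qed
  also have "\<dots> \<noteq> 0" using m(1) by (simp add: pairing_commute)
  finally have nz: "pairing f q \<noteq> 0" .
  then have "f \<noteq> 0" by auto
  then obtain c where "f = pconst c * \<Delta>" using chi_homogeneous(2)[OF f fh] by blast
  then show ?thesis using nz by (auto simp: pairing_pconst_mult_left)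
qed

text \<open>Writing \<open>\<Delta> = J k\<close>, a dual semi-invariant \<open>q\<close> of the degree of \<open>k\<close> makes
  \<open>jacobian r t * q\<close> a nonzero semi-invariant of the degree of \<open>\<Delta>\<close>, and such elements pair
  nontrivially with \<open>\<Delta>\<close>.\<close>

lemma diff_op_jacobian_Delta: "diff_op (jacobian r t) \<Delta> \<noteq> 0"
proof -
  let ?J = "jacobian r \<omega>" and ?T = "jacobian r t" and ?D = "\<Sum>i<r. d i"
  obtain k where k: "poly_in n k" "\<Delta> = ?J * k" using J_dvd by blast
  have nz: "?J \<noteq> 0" "k \<noteq> 0" using Delta_nonzero k(2) by auto
  have De: "?D \<le> e"
    using hcomp_homogeneous_mult[OF jacobian_\<omega>_homogeneous, of e k] hcomp_homogeneous[OF Delta_homogeneous, of e]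
      Delta_nonzero k(2) by (auto split: if_splits)
  have kh: "homogeneous (e - ?D) k"
    using homogeneous_factor[OF jacobian_\<omega>_homogeneous _ nz(1) De] Delta_homogeneous k(2) by simp
  \<comment> \<open>The character of \<open>k\<close>: \<Delta> contributes \<chi>, and the Jacobian
    transforms by the inverse of det \<rho>.\<close>
  define \<theta> where "\<theta> g = det (\<rho> g) * \<chi> g" for g
  have \<theta>_mult: "\<theta> (g * h) = \<theta> g * \<theta> h" if "g \<in> G" "h \<in> G" for g h
    using that by (simp add: \<theta>_def det_rho_mult chi_mult mult_ac)
  have \<theta>_one: "\<theta> (1\<^sub>m n) = 1" by (simp add: \<theta>_def rho_one chi_one)
  have k_act: "actVs n G g k = pconst (\<theta> g) * k" if g: "g \<in> G" for g
  proof -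
    have "?J * (pconst (\<theta> g) * k) = pconst (det (\<rho> g)) * (pconst (\<chi> g) * (?J * k))"
      by (simp add: \<theta>_def pconst_mult mult_ac)
    also have "\<dots> = pconst (det (\<rho> g)) * (actVs n G g ?J * actVs n G g k)"
      using Delta_act[OF g] by (simp add: k(2) Vs.act_mult)
    also have "\<dots> = ?J * actVs n G g k"
      unfolding mult.assoc[symmetric] act_jacobian_\<omega>[OF g, symmetric] ..
    finally show ?thesis using nz(1) by simp
  qed
  obtain m where m: "pairing k (pmonom m) \<noteq> 0" "Poly_Mapping.keys m \<subseteq> {..<n}" "tdeg m = e - ?D"
    using pairing_neq_0_ex[OF nz(2) _ kh, of "{..<n}"] k(1) by (auto simp: poly_in_vars_in)
  have pm: "poly_in n (pmonom m :: 'a mpoly)" using m(2) by (rule poly_in_pmonom)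
  \<comment> \<open>A monomial that meets \<open>k\<close>, projected to the component of the
    character inverse to \<open>\<theta>\<close>; its pairing with \<open>k\<close> survives, which
    shows that \<open>q\<close> is nonzero.\<close>
  define q where "q = (\<Sum>g\<in>G. pconst (\<theta> g) * actV n g (pmonom m))"
  have "pairing k q = (\<Sum>g\<in>G. pairing k (pmonom m))"
    unfolding q_def pairing_sum_right pairing_pconst_mult_right
  proof (intro sum.cong refl)
    fix g assume g: "g \<in> G"
    have "\<theta> g * \<theta> (ginv n G g) = 1" using g by (simp add: \<theta>_mult[symmetric] \<theta>_one)
    then show "\<theta> g * pairing k (actV n g (pmonom m)) = pairing k (pmonom m)"
      using g by (simp add: pairing_actV[OF g k(1) pm] k_act pairing_pconst_mult_left mult.assoc[symmetric])
  qed
  then have "pairing k q \<noteq> 0" using m(1) by simp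
  then have "q \<noteq> 0" by auto
  then have "?T * q \<noteq> 0" using jacobian_t_nonzero by simp
  moreover have q_in: "poly_in n q"
    unfolding q_def using pm by (auto intro!: poly_in_sum poly_in_mult V.poly_in_act)
  moreover have "homogeneous (e - ?D) q"
    unfolding q_def using pm homogeneous_pmonom[of m] m(3)
    by (intro homogeneous_sum homogeneous_pconst_mult V.homogeneous_act) auto
  from homogeneous_mult[OF jacobian_t_homogeneous this] have "homogeneous e (?T * q)" using De by simp
  moreover have "actV n g (?T * q) = pconst (\<chi> (ginv n G g)) * (?T * q)" if g: "g \<in> G" for g
  proof -
    have "actV n g q = pconst (\<theta> (ginv n G g)) * q"
      unfolding q_def by (rule sum_act_V_twisted[OF pm \<theta>_mult g \<theta>_one])
    then have "actV n g (?T * q) = pconst (det (\<rho> g) * \<theta> (ginv n G g)) * (?T * q)"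
      by (simp add: V.act_mult act_jacobian_t[OF g] pconst_mult mult_ac)
    also have "det (\<rho> g) * \<theta> (ginv n G g) = \<chi> (ginv n G g)"
      using det_rho_ginv[OF g] by (simp add: \<theta>_def mult.assoc[symmetric])
    finally show ?thesis .
  qed
  ultimately have "pairing \<Delta> (?T * q) \<noteq> 0"
    using jacobian_t_poly_in by (intro pairing_Delta_nonzero poly_in_mult) auto
  then show ?thesis by (metis pairing_0_left pairing_diff_op)
qed

text \<open>The head is moved to its place in \<open>ys\<close> by anticommuting it past one factor
  at a time. The sign stays unspecified, since only nonvanishing is at stake.\<close>

lemma wedge_prod_perm:
  assumes "mset xs = mset ys"
  shows "\<exists>\<epsilon> \<in> {1, - 1}. \<forall>T. wedge_prod r t xs T = pconst \<epsilon> * wedge_prod r t ys T"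
  using assms
proof (induction xs arbitrary: ys)
  case Nil then show ?case by auto
next
  case (Cons x xs)
  have move: "\<exists>\<epsilon> \<in> {1, - 1 :: 'a}. \<forall>T. eps_lin r (t x) (wedge_prod r t (us @ vs)) T = pconst \<epsilon> * wedge_prod r t (us @ x # vs) T"
    for us vs
  proof (induction us)
    case Nil show ?case by (intro bexI[of _ 1]) auto
  next
    case (Cons u us)
    then obtain \<epsilon> where \<epsilon>1: "\<epsilon> \<in> {1, - 1 :: 'a}"
      "\<forall>T. eps_lin r (t x) (wedge_prod r t (us @ vs)) T = pconst \<epsilon> * wedge_prod r t (us @ x # vs) T" by (rule bexE)
    have \<epsilon>: "eps_lin r (t x) (wedge_prod r t (us @ vs)) = (\<lambda>T. pconst \<epsilon> * wedge_prod r t (us @ x # vs) T)"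
    proof
      fix T
      show "eps_lin r (t x) (wedge_prod r t (us @ vs)) T = pconst \<epsilon> * wedge_prod r t (us @ x # vs) T"
        by (rule spec[OF \<epsilon>1(2)])
    qed
    have "eps_lin r (t x) (wedge_prod r t ((u # us) @ vs)) T = pconst (- \<epsilon>) * wedge_prod r t ((u # us) @ x # vs) T" for T
      by (simp only: append_Cons foldr_Cons comp_apply eps_lin_anti[of r "t x"] \<epsilon> eps_lin_mult
          pconst_minus mult_minus_left)
    moreover have "- \<epsilon> \<in> {1, - 1}" using \<epsilon>1(1) by auto
    ultimately show ?case by blast
  qed
  have "x \<in> set ys" using Cons.prems by (metis list.set_intros(1) set_mset_mset)
  then obtain us vs where ys: "ys = us @ x # vs" by (meson split_list)
  then have "mset xs = mset (us @ vs)" using Cons.prems by simp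
  from Cons.IH[OF this] obtain \<epsilon> where \<epsilon>: "\<epsilon> \<in> {1, - 1 :: 'a}"
    "\<forall>T. wedge_prod r t xs T = pconst \<epsilon> * wedge_prod r t (us @ vs) T" by (rule bexE)
  have fn: "wedge_prod r t xs = (\<lambda>T. pconst \<epsilon> * wedge_prod r t (us @ vs) T)"
    by (rule ext) (rule spec[OF \<epsilon>(2)])
  from move[of us vs] obtain \<epsilon>' where \<epsilon>': "\<epsilon>' \<in> {1, - 1 :: 'a}"
    "\<forall>T. eps_lin r (t x) (wedge_prod r t (us @ vs)) T = pconst \<epsilon>' * wedge_prod r t (us @ x # vs) T"
    by (rule bexE)
  have "wedge_prod r t (x # xs) T = pconst (\<epsilon> * \<epsilon>') * wedge_prod r t ys T" for T
    by (simp only: foldr_Cons comp_apply fn eps_lin_mult spec[OF \<epsilon>'(2)] ys pconst_mult mult.assoc)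
  moreover have "\<epsilon> * \<epsilon>' \<in> {1, - 1}" using \<epsilon>(1) \<epsilon>'(1) by auto
  ultimately show ?case by blast
qed

lemma wedge_prod_not_distinct:
  "\<not> distinct xs \<Longrightarrow> wedge_prod r t xs T = 0"
proof (induction xs arbitrary: T)
  case (Cons x xs)
  show ?case
  proof (cases "x \<in> set xs")
    case True then show ?thesis by (simp add: wedge_prod_mem)
  next
    case False
    then have "wedge_prod r t xs = (\<lambda>T. 0)" using Cons by auto
    then show ?thesis by (simp add: eps_lin_zero)
  qed
qed simp

text \<open>Multiplying a relation by \<open>d\<^sub>K\<^sup>*\<close>, where \<open>K\<close> is the complement of a smallest index set \<open>I\<close> in its
  support, leaves only the term of \<open>I\<close>.\<close>

lemma B_independent:
  assumes rel: "\<And>T. lin_comb r c B T = 0" and "I \<subseteq> {..<r}"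
  shows "c I = 0"
proof (rule ccontr)
  assume "c I \<noteq> 0"
  define S where "S = {I. I \<subseteq> {..<r} \<and> c I \<noteq> 0}"
  have "finite S" "S \<noteq> {}" using assms(2) \<open>c I \<noteq> 0\<close> by (auto simp: S_def)
  then obtain I0 where I0: "I0 \<in> S" "\<And>I. I \<in> S \<Longrightarrow> card I0 \<le> card I"
    using ex_min_if_finite[of "card ` S"] by (metis (no_types, lifting) arg_min_if_finite(1) arg_min_least)
  have I0r: "I0 \<subseteq> {..<r}" using I0(1) by (simp add: S_def)
  define K where "K = sorted_list_of_set ({..<r} - I0)"
  have setK: "set K = {..<r} - I0" "distinct K" by (simp_all add: K_def)
  have Om_sum: "(\<lambda>T. lin_comb r c B T) = (\<lambda>T. diff_op (\<Sum>I\<in>Pow {..<r}. pconst (c I) * Om I T) \<Delta>)"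
    by (simp add: lin_comb_def basis_elem_eq diff_op_sum diff_op_pconst_mult)
  have fold: "foldr (\<lambda>i. eps_lin r (t i)) K (\<lambda>T. \<Sum>I\<in>Pow {..<r}. pconst (c I) * Om I T)
      = (\<lambda>T. \<Sum>I\<in>Pow {..<r}. pconst (c I) * wedge_prod r t (K @ sorted_list_of_set I) T)"
  proof (induction K)
    case (Cons i K)
    have "foldr (\<lambda>i. eps_lin r (t i)) (i # K) (\<lambda>T. \<Sum>I\<in>Pow {..<r}. pconst (c I) * Om I T)
        = eps_lin r (t i) (\<lambda>T. \<Sum>I\<in>Pow {..<r}. pconst (c I) * wedge_prod r t (K @ sorted_list_of_set I) T)"
      by (simp only: foldr_Cons comp_apply Cons.IH)
    also have "\<dots> = (\<lambda>T. \<Sum>I\<in>Pow {..<r}. pconst (c I) * wedge_prod r t ((i # K) @ sorted_list_of_set I) T)"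
      by (rule ext, subst eps_lin_sum) (simp only: eps_lin_mult append_Cons foldr_Cons comp_apply)
    finally show ?case .
  qed simp
  have zero: "foldr (d_star r t) K (\<lambda>T. 0) = (\<lambda>T. 0 :: 'a mpoly)"
  proof (induction K)
    case (Cons i K) then show ?case by (simp add: d_star_def eps_def)
  qed simp
  have "foldr (d_star r t) K (\<lambda>T. lin_comb r c B T) = (\<lambda>T. 0)" unfolding rel by (rule zero)
  then have eq: "diff_op (\<Sum>I\<in>Pow {..<r}. pconst (c I) * wedge_prod r t (K @ sorted_list_of_set I) {..<r}) \<Delta> = 0"
    unfolding Om_sum foldr_d_star_diff_op fold by (rule fun_cong)
  have "(\<Sum>I\<in>Pow {..<r}. pconst (c I) * wedge_prod r t (K @ sorted_list_of_set I) {..<r})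
      = (\<Sum>I\<in>{I0}. pconst (c I) * wedge_prod r t (K @ sorted_list_of_set I) {..<r})"
  proof (rule sum.mono_neutral_right)
    show "\<forall>I\<in>Pow {..<r} - {I0}. pconst (c I) * wedge_prod r t (K @ sorted_list_of_set I) {..<r} = 0"
    proof
      fix I assume I: "I \<in> Pow {..<r} - {I0}"
      show "pconst (c I) * wedge_prod r t (K @ sorted_list_of_set I) {..<r} = 0"
      proof (cases "c I = 0")
        case False
        then have card: "card I0 \<le> card I" using I I0(2) by (simp add: S_def)
        have fin: "finite I0" "finite I" using I0r I finite_subset by blast+
        \<comment> \<open>A set at least as large as \<open>I0\<close> and different from it meets
          the complement listed by \<open>K\<close>, which produces a repeated factor.\<close>
        have "\<not> I \<subseteq> I0" using card_seteq[OF fin(1) _ card] I by blast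
        then have "\<not> distinct (K @ sorted_list_of_set I)" using I setK fin by auto
        then show ?thesis by (simp add: wedge_prod_not_distinct del: foldr_append)
      qed simp
    qed
  qed (use I0r in auto)
  then have eq': "diff_op (pconst (c I0) * wedge_prod r t (K @ sorted_list_of_set I0) {..<r}) \<Delta> = 0"
    using eq by (simp del: foldr_append)
  have "mset (K @ sorted_list_of_set I0) = mset [0..<r]"
  proof -
    have "finite I0" using I0r finite_subset by blast
    then have "distinct (K @ sorted_list_of_set I0)" "set (K @ sorted_list_of_set I0) = set [0..<r]"
      using setK I0r by (auto simp: lessThan_atLeast0)
    then show ?thesis by (metis distinct_upt set_eq_iff_mset_eq_distinct)
  qed
  from wedge_prod_perm[OF this] obtain \<epsilon> where \<epsilon>: "\<epsilon> \<in> {1, - 1 :: 'a}"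
    "wedge_prod r t (K @ sorted_list_of_set I0) {..<r} = pconst \<epsilon> * wedge_prod r t [0..<r] {..<r}" by blast
  have "pconst (c I0 * \<epsilon>) * diff_op (jacobian r t) \<Delta> = 0"
    using eq' unfolding \<epsilon>(2) jacobian_eq_wedge[symmetric]
    by (simp add: mult.assoc[symmetric] diff_op_pconst_mult flip: pconst_mult)
  then show False using diff_op_jacobian_Delta \<epsilon>(1) I0(1) by (auto simp: S_def)
qed

section \<open>Independence modulo the ideal and spanning\<close>

lemma lin_comb_harmonic: "lin_comb r c B T \<in> harmonics n G"
  unfolding lin_comb_def by (intro harmonics_sum harmonics_pconst_mult B_harmonic) auto

lemma B_independent_mod_ideal:
  assumes "\<And>T. lin_comb r c B T \<in> Vs.pideal" and "I \<subseteq> {..<r}"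
  shows "c I = 0"
  using B_independent[OF harmonics_Istar_0[OF lin_comb_harmonic assms(1)] assms(2)] .

text \<open>Otherwise \<open>w\<close> and the elements \<open>B I\<close> would together be
  independent modulo the ideal, hence over the invariants by \<open>homogeneous_independent\<close>.
  Their number exceeds by one the bound \<open>card (Pow {..<r})\<close> of
  \<open>SE.card_le_vinv_independent\<close>.\<close>

lemma span_homogeneous:
  assumes w: "w \<in> SE.vinv" and hom: "\<And>T. homogeneous k (w T)"
  shows "\<exists>c. \<forall>T. w T - lin_comb r c B T \<in> Vs.pideal"
proof (rule ccontr)
  assume not: "\<not> ?thesis"
  \<comment> \<open>The index \<open>None\<close> stands for the additional element
    \<open>w\<close>.\<close>
  define W where "W x = (case x of None \<Rightarrow> w | Some I \<Rightarrow> B I)" for x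
  define D where "D x = (case x of None \<Rightarrow> k | Some I \<Rightarrow> e - (\<Sum>i\<leftarrow>sorted_list_of_set I. td i))" for x
  let ?X = "insert None (Some ` Pow {..<r})"
  have sumX: "(\<Sum>x\<in>?X. f x) = f None + (\<Sum>I\<in>Pow {..<r}. f (Some I))" for f :: "nat set option \<Rightarrow> 'a mpoly"
    by (subst sum.insert) (auto simp: sum.reindex)
  have W: "W x \<in> SE.vinv" if "x \<in> ?X" for x using that w B_vinv by (auto simp: W_def)
  have "card ?X \<le> card (Pow {..<r})"
  proof (rule SE.card_le_vinv_independent[where w = W])
    fix h assume h: "\<And>x. x \<in> ?X \<Longrightarrow> h x \<in> Vs.pinv" "\<And>T. (\<Sum>x\<in>?X. h x * W x T) = 0"
    show "\<forall>x\<in>?X. h x = 0"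
    proof (rule homogeneous_independent[where w = W and d = D])
      fix c assume c: "\<And>T. (\<Sum>x\<in>?X. pconst (c x) * W x T) \<in> Vs.pideal"
      let ?c = "\<lambda>I. c (Some I)"
      have c': "pconst (c None) * w T + lin_comb r ?c B T \<in> Vs.pideal" for T
        using c[of T] unfolding sumX by (simp add: W_def lin_comb_def)
      have c0: "c None = 0"
      proof (rule ccontr)
        assume nz: "c None \<noteq> 0"
        let ?b = "\<lambda>I. - c (Some I) / c None"
        have "w T - lin_comb r ?b B T \<in> Vs.pideal" for T
        proof -
          have "pconst (1 / c None) * (pconst (c None) * w T + lin_comb r ?c B T) \<in> Vs.pideal"
            by (rule Vs.pideal_pconst_mult[OF c'])
          also have "pconst (1 / c None) * (pconst (c None) * w T + lin_comb r ?c B T)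
              = pconst (1 / c None * c None) * w T + (\<Sum>I\<in>Pow {..<r}. pconst (1 / c None * c (Some I)) * B I T)"
            by (simp only: distrib_left pconst_mult mult.assoc lin_comb_def sum_distrib_left)
          also have "\<dots> = w T - lin_comb r ?b B T"
            using nz by (simp add: lin_comb_def pconst_minus sum_negf)
          finally show ?thesis .
        qed
        then show False using not by blast
      qed
      then have "?c I = 0" if "I \<subseteq> {..<r}" for I
        using c' that by (intro B_independent_mod_ideal[where c = ?c]) simp_all
      then show "\<forall>x\<in>?X. c x = 0" using c0 by auto
    next
      fix x T assume "x \<in> ?X"
      then show "poly_in n (W x T)" using W SE.vinv_vok SE.vok_poly_in by blast
      show "homogeneous (D x) (W x T)"
        using \<open>x \<in> ?X\<close> hom B_homogeneous by (auto simp: W_def D_def)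
    qed (use h in auto)
  qed (use W in auto)
  moreover have "card ?X = Suc (card (Pow {..<r}))"
    by (subst card_insert_disjoint) (auto simp: card_image)
  ultimately show False by simp
qed

text \<open>Homogeneous components of an invariant vector are invariant, and only finitely many
  degrees occur in all coordinates together.\<close>

lemma span_mod_ideal:
  assumes w: "w \<in> SE.vinv"
  shows "\<exists>c. \<forall>T. w T - lin_comb r c B T \<in> Vs.pideal"
proof -
  define E where "E = (\<Union>T\<in>Pow {..<r}. tdeg ` Poly_Mapping.keys (w T))"
  have E: "finite E" by (simp add: E_def)
  have wT: "w T = (\<Sum>k\<in>E. hcomp k (w T))" for T
  proof (cases "T \<subseteq> {..<r}")
    case True
    have "w T = (\<Sum>k\<in>tdeg ` Poly_Mapping.keys (w T). hcomp k (w T))" by (rule hcomp_decomp)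
    also have "\<dots> = (\<Sum>k\<in>E. hcomp k (w T))"
    proof (rule sum.mono_neutral_left[OF E])
      show "\<forall>k\<in>E - tdeg ` Poly_Mapping.keys (w T). hcomp k (w T) = 0"
      proof (intro ballI poly_mapping_eqI)
        fix k m assume "k \<in> E - tdeg ` Poly_Mapping.keys (w T)"
        then have "tdeg m \<noteq> k \<or> m \<notin> Poly_Mapping.keys (w T)" by blast
        then show "Poly_Mapping.lookup (hcomp k (w T)) m = Poly_Mapping.lookup 0 m"
          by (auto simp: lookup_hcomp in_keys_iff)
      qed
    qed (use True in \<open>auto simp: E_def\<close>)
    finally show ?thesis .
  next
    case False
    then have "w T = 0" using SE.vinv_vok[OF w] by (auto simp: SE.vok_def)
    then show ?thesis by simp
  qed
  have "\<forall>k. \<exists>c. \<forall>T. hcomp k (w T) - lin_comb r c B T \<in> Vs.pideal"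
    using span_homogeneous[OF SE.vinv_hcomp[OF w] homogeneous_hcomp] by blast
  from choice[OF this] obtain c where c: "\<And>k T. hcomp k (w T) - lin_comb r (c k) B T \<in> Vs.pideal" by blast
  have "w T - lin_comb r (\<lambda>I. \<Sum>k\<in>E. c k I) B T \<in> Vs.pideal" for T
  proof -
    have "lin_comb r (\<lambda>I. \<Sum>k\<in>E. c k I) B T = (\<Sum>k\<in>E. lin_comb r (c k) B T)"
      unfolding lin_comb_def pconst_sum sum_distrib_right by (rule sum.swap)
    then have "w T - lin_comb r (\<lambda>I. \<Sum>k\<in>E. c k I) B T = (\<Sum>k\<in>E. hcomp k (w T) - lin_comb r (c k) B T)"
      using wT[of T] by (simp add: sum_subtractf)
    then show ?thesis using c by (simp add: Vs.pideal_sum)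
  qed
  then show ?thesis by blast
qed

text \<open>The difference between \<open>w\<close> and the combination that approximates it modulo
  the ideal is itself harmonic, hence zero.\<close>

lemma HE_chi_span:
  assumes "w \<in> HE_chi n r G \<rho> \<chi>"
  shows "\<exists>c. w = lin_comb r c B"
proof -
  have w: "w \<in> SE.vinv" "\<And>T. w T \<in> harmonics n G" using assms by (auto simp: HE_chi_iff)
  obtain c where c: "\<And>T. w T - lin_comb r c B T \<in> Vs.pideal" using span_mod_ideal[OF w(1)] by blast
  have "w T - lin_comb r c B T = 0" for T
    by (rule harmonics_Istar_0[OF harmonics_diff[OF w(2) lin_comb_harmonic] c])
  then show ?thesis by (intro exI[of _ c]) (simp add: fun_eq_iff)
qed

text \<open>Here \<open>w\<close> is semi-invariant only modulo the ideal. Its twisted average is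
  semi-invariant on the nose and congruent to \<open>w\<close>, so it represents the same
  class.\<close>

lemma quot_chi_span:
  assumes "quot_chi n r G \<rho> \<chi> w"
  shows "\<exists>c. \<forall>T. w T - lin_comb r c B T \<in> Vs.pideal"
proof -
  have ok: "SE.vok w"
    and diff: "\<And>g T. g \<in> G \<Longrightarrow> actSE n r G \<rho> g w T - pconst (\<chi> g) * w T \<in> Vs.pideal"
    using assms by (auto simp: quot_chi_def SE_vok in_IE_def ideal_Istar_eq)
  have vact: "w T - SE.vact g w T \<in> Vs.pideal" if g: "g \<in> G" for g T
  proof -
    have "w T - SE.vact g w T = pconst (- inverse (\<chi> g)) * (actSE n r G \<rho> g w T - pconst (\<chi> g) * w T)"
      using chi_nonzero[OF g]
      by (simp add: SE_vact pconst_minus right_diff_distrib mult.assoc[symmetric] flip: pconst_mult)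
    then show ?thesis using Vs.pideal_pconst_mult[OF diff[OF g]] by simp
  qed
  have avg: "w T - SE.vavg w T \<in> Vs.pideal" for T
  proof -
    have "w T - SE.vavg w T = pconst (1 / of_nat (card G)) * (\<Sum>g\<in>G. w T - SE.vact g w T)"
      by (simp add: SE.vavg_def sum_subtractf right_diff_distrib mult.assoc[symmetric] flip: pconst_of_nat pconst_mult)
    then show ?thesis using vact by (simp add: Vs.pideal_pconst_mult Vs.pideal_sum)
  qed
  obtain c where c: "\<And>T. SE.vavg w T - lin_comb r c B T \<in> Vs.pideal"
    using span_mod_ideal[OF SE.vavg_vinv[OF ok]] by blast
  have "w T - lin_comb r c B T \<in> Vs.pideal" for T
    using Vs.pideal_add[OF avg[of T] c[of T]] by simp
  then show ?thesis by blast
qed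

lemma quot_chi_B: "I \<subseteq> {..<r} \<Longrightarrow> quot_chi n r G \<rho> \<chi> (B I)"
  using B_vinv[of I] SE.vinv_vact[OF B_vinv, of I]
  by (auto simp: quot_chi_def SE_vok SE.vinv_vok in_IE_def ideal_Istar_eq actSE_eq_iff[symmetric])

end

theorem theorem4p5:
  fixes n r :: nat
    and G :: "'a::field_char_0 mat set"
    and \<rho> :: "'a mat \<Rightarrow> 'a mat"
    and \<chi> :: "'a mat \<Rightarrow> 'a"
    and \<Delta> :: "'a mpoly"
    and \<omega> t\<omega> :: "nat \<Rightarrow> nat \<Rightarrow> 'a mpoly"
  assumes G: "mat_group n G" "generated_by_pseudo_reflections n G"
    and M: "representation n r G \<rho>"
    and chi: "linear_character G \<chi>"
    and Delta: "\<Delta> \<in> SVs_chi n G \<chi>" "\<exists>d. homogeneous d \<Delta>" "\<Delta> \<noteq> 0"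
      "SVs_chi n G \<chi> = {a * \<Delta> | a. a \<in> SVs_inv n G}"
    and omega: "homogeneous_free_basis r (SVs_inv n G) (SM_inv n r G \<rho>) \<omega>"
    and tomega: "homogeneous_free_basis r (SV_inv n G) (SMs_inv n r G \<rho>) t\<omega>"
    and J_dvd: "\<exists>k. poly_in n k \<and> \<Delta> = jacobian r \<omega> * k"
  shows "(\<forall>I\<subseteq>{..<r}. basis_elem r t\<omega> \<Delta> I \<in> HE_chi n r G \<rho> \<chi>) \<and>
         (\<forall>c. lin_comb r c (basis_elem r t\<omega> \<Delta>) = (\<lambda>T. 0) \<longrightarrow> (\<forall>I\<subseteq>{..<r}. c I = 0)) \<and>
         (\<forall>w\<in>HE_chi n r G \<rho> \<chi>. \<exists>c. w = lin_comb r c (basis_elem r t\<omega> \<Delta>)) \<and>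
         (\<forall>I\<subseteq>{..<r}. quot_chi n r G \<rho> \<chi> (basis_elem r t\<omega> \<Delta> I)) \<and>
         (\<forall>c. in_IE n G (lin_comb r c (basis_elem r t\<omega> \<Delta>)) \<longrightarrow> (\<forall>I\<subseteq>{..<r}. c I = 0)) \<and>
         (\<forall>w. quot_chi n r G \<rho> \<chi> w \<longrightarrow>
              (\<exists>c. in_IE n G (\<lambda>T. w T - lin_comb r c (basis_elem r t\<omega> \<Delta>) T)))"
proof -
  have deg: "\<exists>d. \<forall>i. i < r \<longrightarrow> (\<forall>j. homogeneous (d i) (b i j))"
    if "homogeneous_free_basis r R W b" for R W and b :: "nat \<Rightarrow> nat \<Rightarrow> 'a mpoly"
  proof (rule choice, rule allI)
    fix i
    show "\<exists>k. i < r \<longrightarrow> (\<forall>j. homogeneous k (b i j))"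
      using conjunct1[OF that[unfolded homogeneous_free_basis_def]] by blast
  qed
  obtain d where d: "\<And>i j. i < r \<Longrightarrow> homogeneous (d i) (\<omega> i j)" using deg[OF omega] by blast
  obtain td where td: "\<And>i j. i < r \<Longrightarrow> homogeneous (td i) (t\<omega> i j)" using deg[OF tomega] by blast
  obtain e where e: "homogeneous e \<Delta>" using Delta(2) by blast
  interpret chi_setting n G r \<rho> \<omega> t\<omega> d td \<chi> \<Delta> e
    by unfold_locales (fact G M chi Delta(1,3,4) omega tomega J_dvd d td e)+
  show ?thesis
  proof (intro conjI allI impI ballI)
    fix I assume I: "I \<subseteq> {..<r}"
    show "B I \<in> HE_chi n r G \<rho> \<chi>" using B_vinv[OF I] B_harmonic[OF I] by (simp add: HE_chi_iff)
    show "quot_chi n r G \<rho> \<chi> (B I)" by (rule quot_chi_B[OF I])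
  next
    fix c I assume "lin_comb r c B = (\<lambda>T. 0)" "I \<subseteq> {..<r}"
    then show "c I = 0" using B_independent[of c I] by simp
  next
    fix w assume "w \<in> HE_chi n r G \<rho> \<chi>"
    then show "\<exists>c. w = lin_comb r c B" by (rule HE_chi_span)
  next
    fix c I assume "in_IE n G (lin_comb r c B)" "I \<subseteq> {..<r}"
    then show "c I = 0" by (intro B_independent_mod_ideal[of c I]) (auto simp: in_IE_def ideal_Istar_eq)
  next
    fix w assume "quot_chi n r G \<rho> \<chi> w"
    then show "\<exists>c. in_IE n G (\<lambda>T. w T - lin_comb r c B T)"
      unfolding in_IE_def ideal_Istar_eq by (rule quot_chi_span)
  qed
qed

end
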